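(* Let $s\in\mathbb{R}$ and $\varphi,\varphi_1\in\mathcal{M}$. The identity mapping $u\mapsto u$, with $u\in C^\infty(\Gamma,V)$, extends uniquely (by continuity) to a compact embedding $H^{s+\varepsilon,\varphi_1}(\Gamma,V)\hookrightarrow H^{s,\varphi}(\Gamma,V)$ for every $\varepsilon>0$.
   Context: **Class $\mathcal{M}$.** $\mathcal{M}$ is the set of all Borel measurable functions $\varphi:[1,\infty)\to(0,\infty)$ such that (i) $\varphi$ and $1/\varphi$ are bounded on each interval $[1,b]$ with $1<b<\infty$; (ii) $\lim_{t\to\infty}\varphi(\lambda t)/\varphi(t)=1$ for every $\lambda>0$. **Spaces on $\mathbb{R}^n$.** Let $\langle\xi\rangle=(1+|\xi|^2)^{1/2}$. For $s\in\mathbb{R}$, $\varphi\in\mathcal{M}$, $H^{s,\varphi}(\mathbb{R}^n)$ is the Hilbert space of all tempered distributions $w$ on $\mathbb{R}^n$ whose Fourier transform $\widehat w$ is locally integrable and satisfies $\|w\|_{s,\varphi;\mathbb{R}^n}^2:=\int_{\mathbb{R}^n}\langle\xi\rangle^{2s}\varphi^2(\langle\xi\rangle)|\widehat w(\xi)|^2\,d\xi<\infty$. **Spaces on a vector bundle.** $\Gamma$ is a closed (compact, without boundary) infinitely smooth real manifold of dimension $n\ge1$ with a given $C^\infty$-density $dx$, and $\pi:V\to\Gamma$ is an infinitely smooth complex vector bundle of rank $p\ge1$; $C^\infty(\Gamma,V)$ is the space of its smooth sections. Choose a finite atlas of local charts (smooth diffeomorphisms) $\alpha_j:\mathbb{R}^n\leftrightarrow\Gamma_j$,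 $j=1,\dots,\varkappa$, where the open sets $\Gamma_j$ cover $\Gamma$, local trivializations $\beta_j:\pi^{-1}(\Gamma_j)\leftrightarrow\Gamma_j\times\mathbb{C}^p$, and real-valued $\chi_j\in C^\infty(\Gamma)$ with $\mathrm{supp}\,\chi_j\subset\Gamma_j$ forming a partition of unity on $\Gamma$. Let $\Pi_k:(x,a)\mapsto a_k$ for $x\in\Gamma$, $a=(a_1,\dots,a_p)\in\mathbb{C}^p$, and for a section $u$ put $u_{j,k}:=\Pi_k(\beta_j\circ(\chi_ju)\circ\alpha_j)$, a function on $\mathbb{R}^n$. $H^{s,\varphi}(\Gamma,V)$ is the completion of $C^\infty(\Gamma,V)$ in the Hilbert norm $$\|u\|_{s,\varphi;\Gamma,V}:=\Bigl(\sum_{j=1}^{\varkappa}\sum_{k=1}^{p}\|u_{j,k}\|^2_{s,\varphi;\mathbb{R}^n}\Bigr)^{1/2}.$$ A compact embedding is an injective compact linear operator. *)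

theory Defs
  imports "HOL-Analysis.Analysis"
begin

section \<open>Smooth functions between Euclidean spaces\<close>

primrec partials :: "'a::euclidean_space list \<Rightarrow> ('a \<Rightarrow> 'b::real_normed_vector) \<Rightarrow> 'a \<Rightarrow> 'b" where
  "partials [] f = f"
| "partials (v # vs) f = (\<lambda>x. frechet_derivative (partials vs f) (at x) v)"

text \<open>Used on open sets only: all iterated partial derivatives exist and are (Frechet)
  differentiable, hence continuous.\<close>

definition smooth_on :: "'a::euclidean_space set \<Rightarrow> ('a \<Rightarrow> 'b::real_normed_vector) \<Rightarrow> bool" where
  "smooth_on S f \<longleftrightarrow> (\<forall>vs\<in>lists Basis. \<forall>x\<in>S. partials vs f differentiable (at x))"


section \<open>The class M of weight functions\<close>

text \<open>A function on the half-line is a total function whose values below 1 are irrelevant.\<close>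

definition class_M :: "(real \<Rightarrow> real) set" where
  "class_M = {\<phi>. \<phi> \<in> borel_measurable (restrict_space borel {1..}) \<and>
     (\<forall>t\<ge>1. \<phi> t > 0) \<and>
     (\<forall>b>1. bounded (\<phi> ` {1..b}) \<and> bounded ((\<lambda>t. 1 / \<phi> t) ` {1..b})) \<and>
     (\<forall>c>0. ((\<lambda>t. \<phi> (c * t) / \<phi> t) \<longlongrightarrow> 1) at_top)}"


section \<open>Tempered distributions and the spaces on Euclidean space\<close>

definition schwartz_space :: "(real^'n \<Rightarrow> complex) set" where
  "schwartz_space = {f. smooth_on UNIV f \<and>
     (\<forall>k. \<forall>vs\<in>lists Basis. bounded (range (\<lambda>x. (1 + norm x) ^ k *\<^sub>R partials vs f x)))}"

definition schwartz_seminorm :: "nat \<Rightarrow> (real^'n \<Rightarrow> complex) \<Rightarrow> real" where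
  "schwartz_seminorm N f =
     Sup {(1 + norm x) ^ N * cmod (partials vs f x) | vs x. vs \<in> lists Basis \<and> length vs \<le> N}"

text \<open>Functionals are total functions; only their values on the Schwartz space matter.\<close>

definition tempered_distribution :: "((real^'n \<Rightarrow> complex) \<Rightarrow> complex) \<Rightarrow> bool" where
  "tempered_distribution w \<longleftrightarrow>
     (\<forall>f\<in>schwartz_space. \<forall>g\<in>schwartz_space. w (\<lambda>x. f x + g x) = w f + w g) \<and>
     (\<forall>c. \<forall>f\<in>schwartz_space. w (\<lambda>x. c * f x) = c * w f) \<and>
     (\<exists>C N. \<forall>f\<in>schwartz_space. cmod (w f) \<le> C * schwartz_seminorm N f)"

definition test_functions :: "(real^'n \<Rightarrow> complex) set" where
  "test_functions = {f. smooth_on UNIV f \<and> compact (closure {x. f x \<noteq> 0})}"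

definition locally_integrable :: "(real^'n \<Rightarrow> complex) \<Rightarrow> bool" where
  "locally_integrable g \<longleftrightarrow> (\<forall>K. compact K \<longrightarrow> set_integrable lborel K g)"

definition regular_distribution :: "(real^'n \<Rightarrow> complex) \<Rightarrow> (real^'n \<Rightarrow> complex) \<Rightarrow> complex" where
  "regular_distribution g f = (LINT x|lborel. g x * f x)"

definition fourier :: "(real^'n \<Rightarrow> complex) \<Rightarrow> real^'n \<Rightarrow> complex" where
  "fourier f \<xi> = (LINT x|lborel. cis (- (x \<bullet> \<xi>)) * f x)"

definition fourier_distribution ::
    "((real^'n \<Rightarrow> complex) \<Rightarrow> complex) \<Rightarrow> (real^'n \<Rightarrow> complex) \<Rightarrow> complex" where
  "fourier_distribution w f = w (fourier f)"

text \<open>The Fourier transform of \<open>w\<close> is the locally integrable function \<open>g\<close>.  The two are compared on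
  compactly supported test functions because \<open>g * f\<close> need not be integrable for every
  Schwartz function \<open>f\<close>.\<close>

definition fourier_is_function ::
    "((real^'n \<Rightarrow> complex) \<Rightarrow> complex) \<Rightarrow> (real^'n \<Rightarrow> complex) \<Rightarrow> bool" where
  "fourier_is_function w g \<longleftrightarrow> locally_integrable g \<and>
     (\<forall>f\<in>test_functions. fourier_distribution w f = regular_distribution g f)"

text \<open>Such a function is unique up to null sets, so the norm below does not depend on the
  representative selected.\<close>

definition fourier_function :: "((real^'n \<Rightarrow> complex) \<Rightarrow> complex) \<Rightarrow> real^'n \<Rightarrow> complex" where
  "fourier_function w = (SOME g. fourier_is_function w g)"

definition japanese_bracket :: "'a::real_normed_vector \<Rightarrow> real" where
  "japanese_bracket \<xi> = sqrt (1 + (norm \<xi>)\<^sup>2)"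

definition weighted_square ::
    "real \<Rightarrow> (real \<Rightarrow> real) \<Rightarrow> (real^'n \<Rightarrow> complex) \<Rightarrow> real^'n \<Rightarrow> real" where
  "weighted_square s \<phi> g \<xi> =
     japanese_bracket \<xi> powr (2 * s) * (\<phi> (japanese_bracket \<xi>))\<^sup>2 * (cmod (g \<xi>))\<^sup>2"

definition H_space :: "real \<Rightarrow> (real \<Rightarrow> real) \<Rightarrow> ((real^'n \<Rightarrow> complex) \<Rightarrow> complex) set" where
  "H_space s \<phi> = {w. tempered_distribution w \<and> (\<exists>g. fourier_is_function w g) \<and>
     integrable lborel (weighted_square s \<phi> (fourier_function w))}"

text \<open>Meaningful on \<^term>\<open>H_space s \<phi>\<close>.\<close>

definition H_norm ::
    "real \<Rightarrow> (real \<Rightarrow> real) \<Rightarrow> ((real^'n \<Rightarrow> complex) \<Rightarrow> complex) \<Rightarrow> real" where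
  "H_norm s \<phi> w = sqrt (LINT \<xi>|lborel. weighted_square s \<phi> (fourier_function w) \<xi>)"


section \<open>Smooth manifolds\<close>

text \<open>A chart is an open set with a coordinate map; the coordinate map is irrelevant outside the set.
  The model space is any Euclidean space, so that the total space of a bundle can be modelled
  on the product of the base coordinates and the fibre.\<close>

type_synonym ('m, 'a) chart = "'m set \<times> ('m \<Rightarrow> 'a)"

definition smooth_atlas :: "('m::topological_space, 'a::euclidean_space) chart set \<Rightarrow> bool" where
  "smooth_atlas A \<longleftrightarrow>
     (\<Union>(U, c)\<in>A. U) = UNIV \<and>
     (\<forall>(U, c)\<in>A. open U \<and> open (c ` U) \<and> homeomorphism U (c ` U) c (inv_into U c)) \<and>
     (\<forall>(U, c)\<in>A. \<forall>(W, d)\<in>A. smooth_on (c ` (U \<inter> W)) (d \<circ> inv_into U c))"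

text \<open>The manifold is the whole type; being Hausdorff and second countable is part of the sort.\<close>

definition closed_manifold ::
    "('m::{t2_space,second_countable_topology}, real^'n) chart set \<Rightarrow> bool" where
  "closed_manifold A \<longleftrightarrow> smooth_atlas A \<and> compact (UNIV :: 'm set)"

definition euclidean_atlas :: "('a::euclidean_space, 'a) chart set" where
  "euclidean_atlas = {(UNIV, \<lambda>x. x)}"

definition product_atlas ::
    "('m, 'a) chart set \<Rightarrow> ('m \<times> 'b, 'a \<times> 'b::euclidean_space) chart set" where
  "product_atlas A = {(U \<times> UNIV, \<lambda>(x, a). (c x, a)) | U c. (U, c) \<in> A}"

definition smooth_map ::
    "('m::topological_space, 'a::euclidean_space) chart set \<Rightarrow>
     ('k::topological_space, 'b::euclidean_space) chart set \<Rightarrow> 'm set \<Rightarrow> ('m \<Rightarrow> 'k) \<Rightarrow> bool" where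
  "smooth_map A B S f \<longleftrightarrow> continuous_on S f \<and>
     (\<forall>(U, c)\<in>A. \<forall>(W, d)\<in>B. smooth_on (c ` (S \<inter> U \<inter> f -` W)) (d \<circ> f \<circ> inv_into U c))"

definition diffeomorphism ::
    "('m::topological_space, 'a::euclidean_space) chart set \<Rightarrow>
     ('k::topological_space, 'b::euclidean_space) chart set \<Rightarrow>
     'm set \<Rightarrow> 'k set \<Rightarrow> ('m \<Rightarrow> 'k) \<Rightarrow> bool" where
  "diffeomorphism A B S T f \<longleftrightarrow> open S \<and> open T \<and> bij_betw f S T \<and>
     smooth_map A B S f \<and> smooth_map B A T (inv_into S f)"

text \<open>A density is given as the measure it induces.\<close>

definition smooth_density ::
    "('m::topological_space, 'a::euclidean_space) chart set \<Rightarrow> 'm measure \<Rightarrow> bool" where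
  "smooth_density A \<mu> \<longleftrightarrow> sets \<mu> = sets borel \<and>
     (\<forall>(U, c)\<in>A. \<exists>\<rho>::'a \<Rightarrow> real. smooth_on (c ` U) \<rho> \<and> (\<forall>y\<in>c ` U. \<rho> y > 0) \<and>
        (\<forall>E\<in>sets borel. E \<subseteq> U \<longrightarrow> emeasure \<mu> E = (\<integral>\<^sup>+y\<in>c ` E. ennreal (\<rho> y) \<partial>lborel)))"


section \<open>Smooth complex vector bundles\<close>

text \<open>The fibre operations are total functions on the total space; \<open>fadd B e e'\<close> is meaningful only
  for \<open>e\<close>, \<open>e'\<close> in the same fibre.\<close>

record ('m, 'e, 'n::finite, 'p::finite) vbundle =
  base_atlas :: "('m, real^'n) chart set"
  total_atlas :: "('e, (real^'n) \<times> (complex^'p)) chart set"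
  proj :: "'e \<Rightarrow> 'm"
  fadd :: "'e \<Rightarrow> 'e \<Rightarrow> 'e"
  fscale :: "complex \<Rightarrow> 'e \<Rightarrow> 'e"

definition local_trivialization ::
    "('m::topological_space, 'e::topological_space, 'n::finite, 'p::finite) vbundle \<Rightarrow>
     'm set \<Rightarrow> ('e \<Rightarrow> 'm \<times> (complex^'p)) \<Rightarrow> bool" where
  "local_trivialization B U \<beta> \<longleftrightarrow> open U \<and>
     diffeomorphism (total_atlas B) (product_atlas (base_atlas B)) (proj B -` U) (U \<times> UNIV) \<beta> \<and>
     (\<forall>e\<in>proj B -` U. fst (\<beta> e) = proj B e) \<and>
     (\<forall>e\<in>proj B -` U. \<forall>e'\<in>proj B -` {proj B e}.
        snd (\<beta> (fadd B e e')) = snd (\<beta> e) + snd (\<beta> e')) \<and>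
     (\<forall>e\<in>proj B -` U. \<forall>c. snd (\<beta> (fscale B c e)) = c *s snd (\<beta> e))"

text \<open>A local trivialization restricts to a bijection of each fibre onto \<open>\<complex>\<^sup>p\<close> that respects both
  operations, so the fibres are complex vector spaces of dimension \<open>p\<close>.\<close>

definition smooth_vector_bundle ::
    "('m::{t2_space,second_countable_topology}, 'e::{t2_space,second_countable_topology},
      'n::finite, 'p::finite) vbundle \<Rightarrow> bool" where
  "smooth_vector_bundle B \<longleftrightarrow>
     smooth_atlas (base_atlas B) \<and> smooth_atlas (total_atlas B) \<and>
     smooth_map (total_atlas B) (base_atlas B) UNIV (proj B) \<and>
     (\<forall>e e'. proj B e = proj B e' \<longrightarrow> proj B (fadd B e e') = proj B e) \<and>
     (\<forall>c e. proj B (fscale B c e) = proj B e) \<and>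
     (\<forall>x. \<exists>U \<beta>. x \<in> U \<and> local_trivialization B U \<beta>)"

definition smooth_sections ::
    "('m::topological_space, 'e::topological_space, 'n::finite, 'p::finite) vbundle \<Rightarrow> ('m \<Rightarrow> 'e) set" where
  "smooth_sections B =
     {u. (\<forall>x. proj B (u x) = x) \<and> smooth_map (base_atlas B) (total_atlas B) UNIV u}"

definition section_add ::
    "('m, 'e, 'n::finite, 'p::finite) vbundle \<Rightarrow> ('m \<Rightarrow> 'e) \<Rightarrow> ('m \<Rightarrow> 'e) \<Rightarrow> 'm \<Rightarrow> 'e" where
  "section_add B u v = (\<lambda>x. fadd B (u x) (v x))"

definition section_scale ::
    "('m, 'e, 'n::finite, 'p::finite) vbundle \<Rightarrow> complex \<Rightarrow> ('m \<Rightarrow> 'e) \<Rightarrow> 'm \<Rightarrow> 'e" where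
  "section_scale B c u = (\<lambda>x. fscale B c (u x))"


section \<open>The norm on smooth sections\<close>

text \<open>The data entering the norm, indexed by \<open>j \<in> {1..patches L}\<close>.\<close>

record ('m, 'e, 'n::finite, 'p::finite) localization =
  patches :: nat
  patch :: "nat \<Rightarrow> 'm set"
  param :: "nat \<Rightarrow> real^'n \<Rightarrow> 'm"
  triv :: "nat \<Rightarrow> 'e \<Rightarrow> 'm \<times> (complex^'p)"
  cutoff :: "nat \<Rightarrow> 'm \<Rightarrow> real"

definition localization_of ::
    "('m::topological_space, 'e::topological_space, 'n::finite, 'p::finite) vbundle \<Rightarrow>
     ('m, 'e, 'n, 'p) localization \<Rightarrow> bool" where
  "localization_of B L \<longleftrightarrow>
     (\<Union>j\<in>{1..patches L}. patch L j) = UNIV \<and>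
     (\<forall>j\<in>{1..patches L}.
        diffeomorphism euclidean_atlas (base_atlas B) UNIV (patch L j) (param L j) \<and>
        local_trivialization B (patch L j) (triv L j) \<and>
        smooth_map (base_atlas B) euclidean_atlas UNIV (cutoff L j) \<and>
        closure {x. cutoff L j x \<noteq> 0} \<subseteq> patch L j \<and>
        (\<forall>x. cutoff L j x \<ge> 0)) \<and>
     (\<forall>x. (\<Sum>j=1..patches L. cutoff L j x) = 1)"

definition local_component ::
    "('m, 'e, 'n::finite, 'p::finite) vbundle \<Rightarrow> ('m, 'e, 'n, 'p) localization \<Rightarrow>
     nat \<Rightarrow> 'p \<Rightarrow> ('m \<Rightarrow> 'e) \<Rightarrow> real^'n \<Rightarrow> complex" where
  "local_component B L j k u = (\<lambda>y.
     let x = param L j y in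
     snd (triv L j (fscale B (complex_of_real (cutoff L j x)) (u x))) $ k)"

definition bundle_norm ::
    "('m, 'e, 'n::finite, 'p::finite) vbundle \<Rightarrow> ('m, 'e, 'n, 'p) localization \<Rightarrow>
     real \<Rightarrow> (real \<Rightarrow> real) \<Rightarrow> ('m \<Rightarrow> 'e) \<Rightarrow> real" where
  "bundle_norm B L s \<phi> u =
     sqrt (\<Sum>j=1..patches L. \<Sum>k\<in>UNIV.
       (H_norm s \<phi> (regular_distribution (local_component B L j k u)))\<^sup>2)"


section \<open>Completions and compact embeddings\<close>

definition complex_banach :: "(complex \<Rightarrow> 'h::banach \<Rightarrow> 'h) \<Rightarrow> bool" where
  "complex_banach scl \<longleftrightarrow> vector_space scl \<and>
     (\<forall>r x. scl (complex_of_real r) x = r *\<^sub>R x) \<and>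
     (\<forall>c x. norm (scl c x) = cmod c * norm x)"

text \<open>\<open>'h\<close> with the complex scaling \<open>scl\<close> and the map \<open>\<iota>\<close> is a completion of
  the smooth sections under \<^term>\<open>bundle_norm B L s \<phi>\<close>, i.e. a model of the space
  \<open>H\<^sup>s\<^sup>,\<^sup>\<phi>(\<Gamma>, V)\<close>: a complete space with a linear isometry from the sections onto a dense subspace.
  It is determined up to isometric isomorphism, and its norm is Hilbertian because the norm on the
  dense subspace is.\<close>

definition H_bundle_space ::
    "('m::topological_space, 'e::topological_space, 'n::finite, 'p::finite) vbundle \<Rightarrow>
     ('m, 'e, 'n, 'p) localization \<Rightarrow> real \<Rightarrow> (real \<Rightarrow> real) \<Rightarrow>
     (complex \<Rightarrow> 'h::banach \<Rightarrow> 'h) \<Rightarrow> (('m \<Rightarrow> 'e) \<Rightarrow> 'h) \<Rightarrow> bool" where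
  "H_bundle_space B L s \<phi> scl \<iota> \<longleftrightarrow> complex_banach scl \<and>
     (\<forall>u\<in>smooth_sections B. \<forall>v\<in>smooth_sections B. \<iota> (section_add B u v) = \<iota> u + \<iota> v) \<and>
     (\<forall>c. \<forall>u\<in>smooth_sections B. \<iota> (section_scale B c u) = scl c (\<iota> u)) \<and>
     (\<forall>u\<in>smooth_sections B. norm (\<iota> u) = bundle_norm B L s \<phi> u) \<and>
     closure (\<iota> ` smooth_sections B) = UNIV"

definition compact_embedding ::
    "(complex \<Rightarrow> 'g::banach \<Rightarrow> 'g) \<Rightarrow> (complex \<Rightarrow> 'h::banach \<Rightarrow> 'h) \<Rightarrow> ('g \<Rightarrow> 'h) \<Rightarrow> bool" where
  "compact_embedding scl scl' T \<longleftrightarrow> Vector_Spaces.linear scl scl' T \<and> inj T \<and>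
     (\<forall>E. bounded E \<longrightarrow> compact (closure (T ` E)))"

end

(* Every norm is a sum over the charts and the fibre components of the energies
   int w |F f|^2, where f is a compactly supported smooth function on R^n whose support lies in a
   ball independent of the section, F is the Fourier transform and w(xi) = <xi>^(2s) phi(<xi>)^2.
   Dyadic iteration of (ii) bounds phi and 1/phi by C t^e for each e > 0.  Hence w and 1/w grow at
   most polynomially, and the quotient of the weights of the target and of the source space is
   O(<xi>^(-epsilon)).

   Functions supported in the ball of radius R satisfy F f(xi) = int G(eta - xi) F f(eta) d eta for
   a rapidly decreasing kernel G.  No Fourier inversion is needed for G: it is a product over the
   coordinates of differences of Fejer kernels, multiplied by powers of sinc.  By the weighted
   inequality of the arithmetic and geometric means, a bound on the energy of f in the source space
   thus makes F f bounded and equicontinuous on balls.  A bounded sequence of sections therefore has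
   a subsequence whose components have locally uniformly convergent transforms (Arzela-Ascoli and a
   diagonal argument); the quotient of the weights controls the rest of the energy near infinity.

   The extended map is injective, because a sequence that is Cauchy in the source norm and null in
   the target norm has null energies on each ball, and by the Cauchy property on all of R^n. *)
theory Submission
  imports Defs "HOL-Library.Diagonal_Subsequence" "HOL-Complex_Analysis.Great_Picard"
    "HOL-Probability.Sinc_Integral"
begin

section \<open>Calculus of smooth functions\<close>

text \<open>A weighted L^2 bound alone gives no pointwise control of F f. What helps is the fixed
  support: multiplication by a cutoff that is one on the ball does not change f, and on the Fourier
  side it is convolution with G. The estimates need the integral of G^2 / w to be finite. For
  negative exponents 1/w may grow like any power, so G must decay at any prescribed polynomial rate;
  this is why the kernels carry an order N.

  The norm is defined through a function selected among all those that represent the Fourier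
  transform against test functions. Before it can be computed as an energy, test functions must be
  shown to separate locally integrable functions.

  The completions are abstract Banach spaces, known only through the dense image of the sections.
  All estimates are therefore made for sequences of smooth sections. Injectivity does not follow
  from density: it is a closability statement about the two norms.\<close>

primrec diff_times :: "nat \<Rightarrow> 'a::euclidean_space set \<Rightarrow> ('a \<Rightarrow> 'b::real_normed_vector) \<Rightarrow> bool" where
  "diff_times 0 S f = True"
| "diff_times (Suc k) S f \<longleftrightarrow> (\<forall>x\<in>S. f differentiable (at x)) \<and>
     (\<forall>b\<in>Basis. diff_times k S (\<lambda>x. frechet_derivative f (at x) b))"

lemma partials_append:
  "partials (vs @ [b]) f = partials vs (\<lambda>x. frechet_derivative f (at x) b)"
  by (induction vs) auto

text \<open>\<open>diff_times\<close> peels off the derivative taken first, \<open>partials\<close>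
  the one taken last. The former suits inductions over products and compositions, with the order k
  as induction variable; the two descriptions differ in the end of the list that is removed.\<close>

lemma diff_times_iff:
  fixes f :: "'a::euclidean_space \<Rightarrow> 'b::real_normed_vector"
  shows
  "diff_times k S f \<longleftrightarrow>
     (\<forall>vs\<in>lists Basis. length vs < k \<longrightarrow> (\<forall>x\<in>S. partials vs f differentiable (at x)))"
proof (induction k arbitrary: f)
  case 0
  then show ?case by simp
next
  case (Suc k)
  show ?case (is "?L = ?R")
  proof
    assume L: ?L
    show ?R
    proof (intro ballI impI)
      fix vs :: "'a list" and x :: 'a assume vs: "vs \<in> lists Basis" "length vs < Suc k" and x: "x \<in> S"
      show "partials vs f differentiable (at x)"
      proof (cases vs rule: rev_exhaust)
        case Nil
        then show ?thesis using L x by simp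
      next
        case (snoc us b)
        then have "b \<in> Basis" "us \<in> lists Basis" "length us < k" using vs by auto
        then show ?thesis using L x Suc.IH[of "\<lambda>x. frechet_derivative f (at x) b"]
          by (simp add: snoc partials_append)
      qed
    qed
  next
    assume R: ?R
    have "\<forall>x\<in>S. f differentiable (at x)"
      using R[rule_format, of "[]"] by simp
    moreover have "diff_times k S (\<lambda>x. frechet_derivative f (at x) b)" if "b \<in> Basis" for b
      unfolding Suc.IH
    proof (intro ballI impI)
      fix vs :: "'a list" and x :: 'a assume "vs \<in> lists Basis" "length vs < k" "x \<in> S"
      then show "partials vs (\<lambda>x. frechet_derivative f (at x) b) differentiable (at x)"
        using R[rule_format, of "vs @ [b]" x] that by (simp add: partials_append)
    qed
    ultimately show ?L by simp
  qed
qed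

lemma smooth_on_iff_diff_times: "smooth_on S f \<longleftrightarrow> (\<forall>k. diff_times k S f)"
  unfolding smooth_on_def diff_times_iff by auto

lemma diff_times_cong:
  assumes "open S" "diff_times k S f" "\<And>x. x \<in> S \<Longrightarrow> f x = g x"
  shows "diff_times k S g"
  using assms(2,3)
proof (induction k arbitrary: f g)
  case (Suc k)
  have "g differentiable (at x)" if "x \<in> S" for x
    using Suc.prems that assms(1) has_derivative_transform_within_open by (metis diff_times.simps(2) differentiable_def)
  moreover have "diff_times k S (\<lambda>x. frechet_derivative g (at x) b)" if b: "b \<in> Basis" for b
  proof (rule Suc.IH)
    show "diff_times k S (\<lambda>x. frechet_derivative f (at x) b)" using Suc.prems b by simp
    show "frechet_derivative f (at x) b = frechet_derivative g (at x) b" if "x \<in> S" for x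
      using frechet_derivative_transform_within_open[of f x S g] Suc.prems that assms(1) by simp
  qed
  ultimately show ?case by simp
qed simp

text \<open>Derivatives at interior points are unique, so an explicitly known derivative D may stand
  for \<open>frechet_derivative\<close>. The closure rules below supply D from the usual
  differentiation formulas.\<close>

lemma diff_times_SucI:
  assumes "open S" "\<And>x. x \<in> S \<Longrightarrow> (f has_derivative D x) (at x)"
    "\<And>b. b \<in> Basis \<Longrightarrow> diff_times k S (\<lambda>x. D x b)"
  shows "diff_times (Suc k) S f"
proof -
  have "diff_times k S (\<lambda>x. frechet_derivative f (at x) b)" if "b \<in> Basis" for b
  proof (rule diff_times_cong[OF assms(1) assms(3)[OF that]])
    show "D x b = frechet_derivative f (at x) b" if "x \<in> S" for x
      by (simp flip: frechet_derivative_at[OF assms(2)[OF that]])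
  qed
  then show ?thesis using assms(2) by (auto simp: differentiable_def)
qed

lemma diff_times_SucD: "diff_times (Suc k) S f \<Longrightarrow> diff_times k S f"
  by (simp only: diff_times_iff less_Suc_eq) blast

lemma diff_times_has_derivative:
  "diff_times (Suc k) S f \<Longrightarrow> x \<in> S \<Longrightarrow> (f has_derivative frechet_derivative f (at x)) (at x)"
  by (simp add: frechet_derivative_works[symmetric])

lemma diff_times_subset: "diff_times k S f \<Longrightarrow> T \<subseteq> S \<Longrightarrow> diff_times k T f"
  by (induction k arbitrary: f) auto

lemma diff_times_const: "open S \<Longrightarrow> diff_times k S (\<lambda>x. c)"
proof (induction k arbitrary: c)
  case (Suc k)
  show ?case by (rule diff_times_SucI[where D="\<lambda>_ _. 0"]) (use Suc in auto)
qed simp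

lemma diff_times_linear:
  assumes "open S" "bounded_linear L" "diff_times k S f"
  shows "diff_times k S (\<lambda>x. L (f x))"
  using assms(3)
proof (induction k arbitrary: f)
  case (Suc k)
  show ?case
  proof (rule diff_times_SucI[OF assms(1)])
    show "((\<lambda>x. L (f x)) has_derivative (\<lambda>b. L (frechet_derivative f (at x) b))) (at x)"
      if "x \<in> S" for x
      using bounded_linear.has_derivative[OF assms(2) diff_times_has_derivative[OF Suc.prems that]] .
  qed (use Suc in simp)
qed simp

lemma diff_times_add:
  assumes "open S" "diff_times k S f" "diff_times k S g"
  shows "diff_times k S (\<lambda>x. f x + g x)"
  using assms(2,3)
proof (induction k arbitrary: f g)
  case (Suc k)
  show ?case
  proof (rule diff_times_SucI[OF assms(1)])
    show "((\<lambda>x. f x + g x) has_derivative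
      (\<lambda>b. frechet_derivative f (at x) b + frechet_derivative g (at x) b)) (at x)" if "x \<in> S" for x
      using has_derivative_add[OF diff_times_has_derivative[OF Suc.prems(1) that]
          diff_times_has_derivative[OF Suc.prems(2) that]] .
  qed (use Suc in simp)
qed simp

lemma diff_times_sum:
  assumes "open S" "\<And>i. i \<in> I \<Longrightarrow> diff_times k S (f i)"
  shows "diff_times k S (\<lambda>x. \<Sum>i\<in>I. f i x)"
  using assms(2)
  by (induction I rule: infinite_finite_induct)
    (auto intro: diff_times_const diff_times_add simp: assms(1))

lemma diff_times_bilinear:
  assumes "open S" "bounded_bilinear h" "diff_times k S f" "diff_times k S g"
  shows "diff_times k S (\<lambda>x. h (f x) (g x))"
  using assms(3,4)
proof (induction k arbitrary: f g)
  case (Suc k)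
  show ?case
  proof (rule diff_times_SucI[OF assms(1),
          where D="\<lambda>x b. h (f x) (frechet_derivative g (at x) b) + h (frechet_derivative f (at x) b) (g x)"])
    show "((\<lambda>x. h (f x) (g x)) has_derivative
      (\<lambda>b. h (f x) (frechet_derivative g (at x) b) + h (frechet_derivative f (at x) b) (g x))) (at x)"
      if "x \<in> S" for x
      using bounded_bilinear.FDERIV[OF assms(2) diff_times_has_derivative[OF Suc.prems(1) that]
          diff_times_has_derivative[OF Suc.prems(2) that]] .
    show "diff_times k S (\<lambda>x. h (f x) (frechet_derivative g (at x) b) + h (frechet_derivative f (at x) b) (g x))"
      if "b \<in> Basis" for b
      using Suc.prems that diff_times_SucD[OF Suc.prems(1)] diff_times_SucD[OF Suc.prems(2)]
      by (intro diff_times_add assms(1) Suc.IH) auto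
  qed
qed simp

lemma diff_times_compose:
  fixes f :: "'b::euclidean_space \<Rightarrow> 'c::real_normed_vector" and g :: "'a::euclidean_space \<Rightarrow> 'b"
  assumes "open S" "open T" "g ` S \<subseteq> T" "diff_times k T f" "diff_times k S g"
  shows "diff_times k S (\<lambda>x. f (g x))"
  using assms(4,5)
proof (induction k arbitrary: f)
  case (Suc k)
  \<comment> \<open>The derivative of f at g x, applied to that of g, depends on x in two places.
    Expansion in the basis separates them into scalar factors and partial derivatives of f composed
    with g, to which the induction hypothesis applies.\<close>
  define D where "D x b = (\<Sum>c\<in>Basis. (frechet_derivative g (at x) b \<bullet> c) *\<^sub>R
      frechet_derivative f (at (g x)) c)" for x b
  have D: "((\<lambda>x. f (g x)) has_derivative D x) (at x)" if x: "x \<in> S" for x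
  proof -
    have f: "(f has_derivative frechet_derivative f (at (g x))) (at (g x))"
      using diff_times_has_derivative[OF Suc.prems(1)] x assms(3) by blast
    then have L: "linear (frechet_derivative f (at (g x)))"
      by (simp add: has_derivative_linear)
    have eq: "frechet_derivative f (at (g x)) v =
       (\<Sum>c\<in>Basis. (v \<bullet> c) *\<^sub>R frechet_derivative f (at (g x)) c)" for v
    proof -
      have "frechet_derivative f (at (g x)) v =
          frechet_derivative f (at (g x)) (\<Sum>c\<in>Basis. (v \<bullet> c) *\<^sub>R c)"
        by (simp only: euclidean_representation)
      also have "\<dots> = (\<Sum>c\<in>Basis. (v \<bullet> c) *\<^sub>R frechet_derivative f (at (g x)) c)"
        by (simp add: linear_sum[OF L] linear_cmul[OF L])
      finally show ?thesis .
    qed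
    have "frechet_derivative f (at (g x)) \<circ> frechet_derivative g (at x) = D x"
      unfolding D_def o_def by (rule ext) (rule eq)
    then show ?thesis
      using diff_chain_at[OF diff_times_has_derivative[OF Suc.prems(2) x] f] by (simp add: o_def)
  qed
  show ?case
  proof (rule diff_times_SucI[OF assms(1) D])
    fix b :: 'a assume "b \<in> Basis"
    then show "diff_times k S (\<lambda>x. D x b)"
      unfolding D_def using Suc.prems diff_times_SucD[OF Suc.prems(2)]
      by (intro diff_times_sum assms(1) diff_times_bilinear[OF _ bounded_bilinear_scaleR] Suc.IH
          diff_times_linear[OF _ bounded_linear_inner_left]) auto
  qed
qed simp

lemma diff_times_id: "open S \<Longrightarrow> diff_times k S (\<lambda>x. x)"
proof (cases k)
  case (Suc j)
  assume "open S"
  then show ?thesis unfolding Suc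
    by (intro diff_times_SucI[where D="\<lambda>_ b. b"]) (auto intro: diff_times_const)
qed simp

lemma smooth_on_cong: "open S \<Longrightarrow> smooth_on S f \<Longrightarrow> (\<And>x. x \<in> S \<Longrightarrow> f x = g x) \<Longrightarrow> smooth_on S g"
  unfolding smooth_on_iff_diff_times using diff_times_cong by blast

lemma smooth_on_subset: "smooth_on S f \<Longrightarrow> T \<subseteq> S \<Longrightarrow> smooth_on T f"
  unfolding smooth_on_iff_diff_times using diff_times_subset by blast

lemma smooth_on_const: "open S \<Longrightarrow> smooth_on S (\<lambda>x. c)"
  unfolding smooth_on_iff_diff_times using diff_times_const by blast

lemma smooth_on_id: "open S \<Longrightarrow> smooth_on S (\<lambda>x. x)"
  unfolding smooth_on_iff_diff_times using diff_times_id by blast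

lemma smooth_on_linear: "open S \<Longrightarrow> bounded_linear L \<Longrightarrow> smooth_on S f \<Longrightarrow> smooth_on S (\<lambda>x. L (f x))"
  unfolding smooth_on_iff_diff_times using diff_times_linear by blast

lemma smooth_on_add: "open S \<Longrightarrow> smooth_on S f \<Longrightarrow> smooth_on S g \<Longrightarrow> smooth_on S (\<lambda>x. f x + g x)"
  unfolding smooth_on_iff_diff_times using diff_times_add by blast

lemma smooth_on_bilinear:
  "open S \<Longrightarrow> bounded_bilinear h \<Longrightarrow> smooth_on S f \<Longrightarrow> smooth_on S g \<Longrightarrow> smooth_on S (\<lambda>x. h (f x) (g x))"
  unfolding smooth_on_iff_diff_times using diff_times_bilinear by blast

lemma smooth_on_compose:
  fixes f :: "'b::euclidean_space \<Rightarrow> 'c::real_normed_vector" and g :: "'a::euclidean_space \<Rightarrow> 'b"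
  shows "open S \<Longrightarrow> open T \<Longrightarrow> g ` S \<subseteq> T \<Longrightarrow> smooth_on T f \<Longrightarrow> smooth_on S g \<Longrightarrow>
    smooth_on S (\<lambda>x. f (g x))"
  unfolding smooth_on_iff_diff_times using diff_times_compose by blast

lemma smooth_on_Pair:
  assumes "open S" "smooth_on S f" "smooth_on S g"
  shows "smooth_on S (\<lambda>x. (f x, g x))"
proof -
  have "smooth_on S (\<lambda>x. (f x, 0) + (0, g x))"
    using assms by (intro smooth_on_add smooth_on_linear[where L="\<lambda>y. (y, 0)"]
      smooth_on_linear[where L="\<lambda>y. (0, y)"])
     (auto intro!: bounded_linear_intros)
  then show ?thesis by simp
qed

lemma smooth_on_prod:
  fixes f :: "'i \<Rightarrow> 'a::euclidean_space \<Rightarrow> 'b::{real_normed_field}"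
  assumes "open S" "\<And>i. i \<in> I \<Longrightarrow> smooth_on S (f i)"
  shows "smooth_on S (\<lambda>x. \<Prod>i\<in>I. f i x)"
  using assms(2)
  by (induction I rule: infinite_finite_induct)
    (auto intro: smooth_on_const smooth_on_bilinear[OF _ bounded_bilinear_mult] simp: assms(1))

text \<open>The iterated partials are taken in the whole space, so smoothness is a condition at each
  single point.\<close>

lemma smooth_on_locally:
  assumes "\<And>x. x \<in> S \<Longrightarrow> \<exists>T. x \<in> T \<and> smooth_on T f"
  shows "smooth_on S f"
  using assms unfolding smooth_on_def by (meson smooth_on_def)

lemma smooth_on_derivative:
  assumes "smooth_on S f" "b \<in> Basis"
  shows "smooth_on S (\<lambda>x. frechet_derivative f (at x) b)"
  using assms unfolding smooth_on_iff_diff_times by (metis diff_times.simps(2))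

lemma smooth_on_has_derivative:
  "smooth_on S f \<Longrightarrow> x \<in> S \<Longrightarrow> (f has_derivative frechet_derivative f (at x)) (at x)"
  unfolding smooth_on_iff_diff_times using diff_times_has_derivative by blast

lemma smooth_on_imp_continuous_on: "smooth_on S f \<Longrightarrow> continuous_on S f"
  by (meson continuous_at_imp_continuous_on has_derivative_continuous smooth_on_has_derivative)

section \<open>Test functions separate locally integrable functions\<close>

text \<open>The function exp (-1/t) extended by zero, with an extra factor t^(-k). The parameter k
  makes the family closed under differentiation up to linear combinations, so that smoothness
  follows by induction on the order.\<close>

definition flat :: "nat \<Rightarrow> real \<Rightarrow> real" where
  "flat k t = (if t > 0 then exp (- inverse t) * inverse t ^ k else 0)"

text \<open>One term of the exponential series gives t^(-(k+2)) <= (k+2)! exp (1/t). Taking k + 2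
  rather than k leaves the factor t^2, which makes the difference quotient at 0 vanish in the
  limit.\<close>

lemma flat_bound: "\<bar>flat k t\<bar> \<le> fact (k + 2) * t\<^sup>2"
proof (cases "t > 0")
  case True
  have "inverse t ^ (k + 2) / fact (k + 2) \<le> exp (inverse t)"
    using sum_le_suminf[OF summable_exp_generic[of "inverse t"], of "{k + 2}"] True
    by (simp add: exp_def divide_inverse mult.commute)
  then have "inverse t ^ (k + 2) \<le> fact (k + 2) * exp (inverse t)"
    by (simp add: divide_le_eq mult.commute del: fact_Suc power_Suc)
  then have "inverse t ^ (k + 2) * exp (- inverse t) \<le> fact (k + 2) * exp (inverse t) * exp (- inverse t)"
    by (rule mult_right_mono) simp
  then have "inverse t ^ (k + 2) * exp (- inverse t) \<le> fact (k + 2)"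
    by (simp only: mult.assoc exp_minus_inverse mult_1_right)
  then have "inverse t ^ (k + 2) * exp (- inverse t) * t\<^sup>2 \<le> fact (k + 2) * t\<^sup>2"
    by (rule mult_right_mono) simp
  moreover have "inverse t ^ (k + 2) * exp (- inverse t) * t\<^sup>2 = flat k t"
    using True by (simp add: flat_def power_add field_simps power2_eq_square)
  moreover have "flat k t \<ge> 0" by (simp add: flat_def)
  ultimately show ?thesis by simp
qed (simp add: flat_def)

lemma flat_has_derivative:
  "(flat k has_real_derivative flat (k + 2) t - real k * flat (k + 1) t) (at t)"
proof -
  consider "t > 0" | "t < 0" | "t = 0" by linarith
  then show ?thesis
  proof cases
    case 1
    have "((\<lambda>t. exp (- inverse t) * inverse t ^ k) has_real_derivative
       flat (k + 2) t - real k * flat (k + 1) t) (at t)"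
    proof (cases k)
      case 0
      then show ?thesis using 1
        by (auto intro!: derivative_eq_intros simp: flat_def power2_eq_square)
    next
      case (Suc j)
      have "inverse t ^ i * inverse t = inverse t ^ Suc i" for i by simp
      then show ?thesis using 1 unfolding Suc
        by (auto intro!: derivative_eq_intros simp: flat_def power2_eq_square algebra_simps power_Suc[symmetric] simp del: power_Suc)
    qed
    then show ?thesis
      by (rule has_field_derivative_transform_within_open[where S="{0<..}"])
        (use 1 in \<open>auto simp: flat_def\<close>)
  next
    case 2
    have "((\<lambda>t. 0) has_real_derivative flat (k + 2) t - real k * flat (k + 1) t) (at t)"
      using 2 by (simp add: flat_def)
    then show ?thesis
      by (rule has_field_derivative_transform_within_open[where S="{..<0}"])
        (use 2 in \<open>auto simp: flat_def\<close>)
  next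
    \<comment> \<open>All members of the family vanish at 0, so the claimed derivative is 0 and the
      difference quotient is flat k h / h, which is O(|h|) by \<open>flat_bound\<close>.\<close>
    case 3
    have "((\<lambda>h. flat k h / h) \<longlongrightarrow> 0) (at 0)"
    proof (rule Lim_null_comparison)
      show "\<forall>\<^sub>F h in at 0. norm (flat k h / h) \<le> fact (k + 2) * \<bar>h\<bar>"
      proof (rule eventually_at_filter[THEN iffD2, OF always_eventually], intro allI impI)
        fix h :: real assume "h \<noteq> 0"
        then show "norm (flat k h / h) \<le> fact (k + 2) * \<bar>h\<bar>"
          using flat_bound[of k h] by (simp add: divide_le_eq power2_eq_square abs_mult_self_eq mult.assoc del: fact_Suc)
      qed
      show "((\<lambda>h. fact (k + 2) * \<bar>h\<bar>) \<longlongrightarrow> (0::real)) (at 0)"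
        by (auto intro!: tendsto_eq_intros)
    qed
    then show ?thesis
      using 3 by (simp add: DERIV_def flat_def)
  qed
qed

lemma smooth_on_flat: "smooth_on UNIV (flat k)"
  unfolding smooth_on_iff_diff_times
proof
  fix j show "diff_times j UNIV (flat k)"
  proof (induction j arbitrary: k)
    case (Suc j)
    have "diff_times j UNIV (\<lambda>t. flat (k + 2) t + (- real k) * flat (k + 1) t)"
      by (intro diff_times_add diff_times_linear[OF _ bounded_linear_mult_right] Suc.IH) auto
    then show ?case
      using flat_has_derivative[of k]
      by (intro diff_times_SucI[where D="\<lambda>t. (*) (flat (k + 2) t - real k * flat (k + 1) t)"])
        (auto simp: has_field_derivative_def)
  qed simp
qed

lemma flat_nonneg: "flat k t \<ge> 0"
  by (simp add: flat_def)

lemma flat_zero_le_one: "flat 0 t \<le> 1"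
  by (simp add: flat_def)

text \<open>Since exp (-1 / (m t)) tends to 1 for every t > 0, these smooth functions with values in
  [0, 1] that vanish off the box tend pointwise to its indicator as m grows.\<close>

definition box_bump :: "nat \<Rightarrow> real^'n \<Rightarrow> real^'n \<Rightarrow> real^'n \<Rightarrow> real" where
  "box_bump m a b x = (\<Prod>i\<in>UNIV. flat 0 (real m * (x $ i - a $ i)) * flat 0 (real m * (b $ i - x $ i)))"

lemma box_bump_bounds: "0 \<le> box_bump m a b x" "box_bump m a b x \<le> 1"
  unfolding box_bump_def
  by (auto intro!: prod_nonneg prod_le_1 mult_le_one simp: flat_nonneg flat_zero_le_one)

lemma box_bump_eq_0:
  assumes "x \<notin> box a b"
  shows "box_bump m a b x = 0"
proof -
  obtain i where "x $ i \<le> a $ i \<or> b $ i \<le> x $ i"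
    using assms by (auto simp: mem_box_cart not_less)
  then have "flat 0 (real m * (x $ i - a $ i)) * flat 0 (real m * (b $ i - x $ i)) = 0"
    by (auto simp: flat_def zero_less_mult_iff)
  then show ?thesis unfolding box_bump_def by (intro prod_zero) auto
qed

lemma box_bump_tendsto: "(\<lambda>m. box_bump m a b x) \<longlonglongrightarrow> indicator (box a b) x"
proof (cases "x \<in> box a b")
  case True
  have flat: "(\<lambda>m. flat 0 (real m * t)) \<longlonglongrightarrow> 1" if "t > 0" for t
  proof -
    have "(\<lambda>m. inverse (real m * t)) \<longlonglongrightarrow> 0"
      using that by (intro tendsto_inverse_0_at_top filterlim_tendsto_pos_mult_at_top[OF _ that] filterlim_real_sequentially
         filterlim_at_top_mult_tendsto_pos[OF tendsto_const that])
    then have "(\<lambda>m. exp (- inverse (real m * t))) \<longlonglongrightarrow> exp (- 0)"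
      by (intro tendsto_intros)
    then have "(\<lambda>m. exp (- inverse (real m * t))) \<longlonglongrightarrow> 1"
      by simp
    moreover have "\<forall>\<^sub>F m in sequentially. exp (- inverse (real m * t)) = flat 0 (real m * t)"
      using eventually_gt_at_top[of 0] by eventually_elim (use that in \<open>auto simp: flat_def\<close>)
    ultimately show ?thesis by (rule Lim_transform_eventually)
  qed
  have "(\<lambda>m. box_bump m a b x) \<longlonglongrightarrow> (\<Prod>i\<in>(UNIV::'a set). 1 * 1)"
    unfolding box_bump_def using True
    by (intro tendsto_prod tendsto_mult flat) (auto simp: mem_box_cart)
  then show ?thesis using True by simp
qed (simp add: box_bump_eq_0)

lemma smooth_on_vec_nth: "open S \<Longrightarrow> smooth_on S (\<lambda>x::real^'n. x $ i)"
  by (intro smooth_on_linear[OF _ bounded_linear_vec_nth] smooth_on_id)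

lemma smooth_on_box_bump: "smooth_on UNIV (box_bump m a b)"
proof -
  have "smooth_on UNIV (\<lambda>x. flat 0 (real m * (x $ i - a $ i)))" for i
    by (intro smooth_on_compose[OF _ _ _ smooth_on_flat] smooth_on_linear[OF _ bounded_linear_mult_right])
      (auto simp: diff_conv_add_uminus simp del: add_uminus_conv_diff
        intro!: smooth_on_add smooth_on_const smooth_on_vec_nth)
  moreover have "smooth_on UNIV (\<lambda>x. flat 0 (real m * (b $ i - x $ i)))" for i
    by (intro smooth_on_compose[OF _ _ _ smooth_on_flat] smooth_on_linear[OF _ bounded_linear_mult_right])
      (auto simp: diff_conv_add_uminus simp del: add_uminus_conv_diff
        intro!: smooth_on_add smooth_on_const smooth_on_linear[OF _ bounded_linear_minus[OF bounded_linear_ident]] smooth_on_vec_nth)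
  ultimately show ?thesis
    unfolding box_bump_def by (intro smooth_on_prod smooth_on_bilinear[OF _ bounded_bilinear_mult]) auto
qed

lemma box_bump_test_function: "(\<lambda>x. complex_of_real (box_bump m a b x)) \<in> test_functions"
proof -
  have "closure {x. complex_of_real (box_bump m a b x) \<noteq> 0} \<subseteq> cbox a b"
    using box_bump_eq_0[of _ a b m] box_subset_cbox[of a b] by (intro closure_minimal) auto
  then show ?thesis
    unfolding test_functions_def
    by (auto intro!: smooth_on_linear[OF _ bounded_linear_of_real] smooth_on_box_bump
        simp: compact_eq_bounded_closed bounded_subset[OF bounded_cbox])
qed

lemma box_bump_measurable [measurable]: "box_bump m a b \<in> borel_measurable borel"
  using smooth_on_imp_continuous_on[OF smooth_on_box_bump] by (rule borel_measurable_continuous_onI)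

section \<open>Locally integrable functions are determined by their integrals over boxes and against
  test functions\<close>

lemma borel_measurable_if_locally_integrable:
  assumes "locally_integrable (g :: real^'n \<Rightarrow> complex)"
  shows "g \<in> borel_measurable borel"
proof (rule borel_measurable_LIMSEQ_metric)
  fix i :: nat
  have "set_integrable lborel (cball 0 (real i)) g"
    using assms by (auto simp: locally_integrable_def)
  then show "(\<lambda>x. indicator (cball 0 (real i)) x *\<^sub>R g x) \<in> borel_measurable borel"
    unfolding set_integrable_def by (auto dest: borel_measurable_integrable)
next
  fix x :: "real^'n"
  obtain N where N: "norm x \<le> real N" using real_arch_simple by blast
  have "\<forall>\<^sub>F i in sequentially. g x = indicator (cball 0 (real i)) x *\<^sub>R g x"
    using eventually_ge_at_top[of N] by eventually_elim (use N in auto)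
  then show "(\<lambda>i. indicator (cball 0 (real i)) x *\<^sub>R g x) \<longlonglongrightarrow> g x"
    by (rule Lim_transform_eventually[OF tendsto_const])
qed

text \<open>A Dynkin argument. Restricted to one box the function is integrable, and the Borel sets
  over which the restriction integrates to zero contain the intersection-stable generator of boxes
  and are closed under complements and countable disjoint unions.\<close>

lemma AE_zero_if_box_integrals_zero:
  fixes d :: "real^'n \<Rightarrow> complex"
  assumes "locally_integrable d" and box0: "\<And>a b. (LINT x:box a b|lborel. d x) = 0"
  shows "AE x in lborel. d x = 0"
proof -
  have "AE x in lborel. indicator (box a b) x *\<^sub>R d x = 0" for a b
  proof (rule sigma_finite_measure.density_zero[OF sigma_finite_lborel])
    let ?f = "\<lambda>x. indicator (box a b) x *\<^sub>R d x"
    have "set_integrable lborel (box a b) d"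
      using set_integrable_subset[OF assms(1)[unfolded locally_integrable_def, rule_format, OF compact_cbox[of a b]]]
      by (simp add: box_subset_cbox)
    then show int: "integrable lborel ?f" unfolding set_integrable_def .
    fix A :: "(real^'n) set" assume "A \<in> sets lborel"
    then have "A \<in> sigma_sets UNIV (range (\<lambda>(a, b). box a b))"
      by (simp add: borel_eq_box)
    moreover have "Int_stable (range (\<lambda>(a, b). box a b :: (real^'n) set))"
      by (auto simp: Int_stable_def box_Int_box)
    moreover have "range (\<lambda>(a, b). box a b :: (real^'n) set) \<subseteq> Pow UNIV"
      by simp
    ultimately have "Int_stable (range (\<lambda>(a, b). box a b :: (real^'n) set))"
      "range (\<lambda>(a, b). box a b :: (real^'n) set) \<subseteq> Pow UNIV"
      "A \<in> sigma_sets UNIV (range (\<lambda>(a, b). box a b))"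
      by blast+
    then show "set_lebesgue_integral lborel A ?f = 0"
    proof (induction rule: sigma_sets_induct_disjoint)
      case (basic A)
      then obtain c e where "A = box c e" by auto
      then have "(\<lambda>x. indicat_real A x *\<^sub>R ?f x) = (\<lambda>x. indicator (box c e \<inter> box a b) x *\<^sub>R d x)"
        by (auto simp: fun_eq_iff indicator_def)
      then show ?case
        unfolding set_lebesgue_integral_def using box0
        by (simp add: box_Int_box set_lebesgue_integral_def)
    next
      case empty
      then show ?case by (simp add: set_lebesgue_integral_def)
    next
      case (compl A)
      then have [measurable]: "A \<in> sets borel" by (simp add: borel_eq_box)
      have "(\<lambda>x. indicat_real (UNIV - A) x *\<^sub>R ?f x) = (\<lambda>x. ?f x - indicat_real A x *\<^sub>R ?f x)"
        by (auto simp: fun_eq_iff indicator_def)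
      moreover have "integrable lborel (\<lambda>x. indicat_real A x *\<^sub>R ?f x)"
        by (intro integrable_mult_indicator int) simp
      ultimately show ?case
        using compl(2) box0[of a b] int
        unfolding set_lebesgue_integral_def by simp
    next
      case (union A)
      then have A: "A i \<in> sets borel" for i by (auto simp: borel_eq_box)
      have "set_lebesgue_integral lborel (\<Union>i. A i) ?f = (\<Sum>i. set_lebesgue_integral lborel (A i) ?f)"
        using A union(1) int
        by (intro lebesgue_integral_countable_add)
          (auto simp: disjoint_family_on_def set_integrable_def intro!: integrable_mult_indicator simp del: scaleR_scaleR)
      then show ?case using union by simp
    qed
  qed
  \<comment> \<open>Countably many centred boxes exhaust the space, so the exceptional null sets can
    be united.\<close>
  then have "AE x in lborel. \<forall>n::nat. indicator (box (- (real n *\<^sub>R One)) (real n *\<^sub>R One)) x *\<^sub>R d x = 0"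
    unfolding AE_all_countable by blast
  then show ?thesis
  proof eventually_elim
    case (elim x)
    have "x \<in> (\<Union>n::nat. box (- (real n *\<^sub>R One)) (real n *\<^sub>R One))"
      using UN_box_eq_UNIV by blast
    then show ?case using elim by (metis (no_types, lifting) UN_E indicator_simps(1) scaleR_one)
  qed
qed

text \<open>The lemma of du Bois-Reymond, reduced to integrals over boxes by bumps that converge to
  box indicators. It identifies the function selected in \<open>fourier_function\<close> almost
  everywhere with the transform given by the integral.\<close>

lemma test_functions_separate:
  fixes g h :: "real^'n \<Rightarrow> complex"
  assumes g: "locally_integrable g" and h: "locally_integrable h"
    and eq: "\<And>f. f \<in> test_functions \<Longrightarrow> (LINT x|lborel. g x * f x) = (LINT x|lborel. h x * f x)"
  shows "AE x in lborel. g x = h x"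
proof -
  have [measurable]: "g \<in> borel_measurable borel" "h \<in> borel_measurable borel"
    using borel_measurable_if_locally_integrable g h by auto
  define d where "d x = g x - h x" for x
  have [measurable]: "d \<in> borel_measurable borel" unfolding d_def by simp
  have d: "locally_integrable d"
    using g h unfolding locally_integrable_def d_def by (auto intro: set_integral_diff)
  have "(LINT x:box a b|lborel. d x) = 0" for a b
  proof -
    have bint: "integrable lborel (\<lambda>x. indicator (cbox a b) x *\<^sub>R u x)" if "locally_integrable u"
      for u :: "real^'n \<Rightarrow> complex"
      using that by (auto simp: locally_integrable_def set_integrable_def)
    have le: "norm (u x * complex_of_real (box_bump m a b x)) \<le> norm (indicat_real (cbox a b) x *\<^sub>R u x)"
      for u :: "real^'n \<Rightarrow> complex" and m x
      using box_bump_eq_0[of x a b m] box_bump_bounds[of m a b x] box_subset_cbox[of a b]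
      by (cases "x \<in> box a b") (auto simp: norm_mult mult_left_le)
    have prod: "integrable lborel (\<lambda>x. u x * complex_of_real (box_bump m a b x))"
      if "locally_integrable u" for u :: "real^'n \<Rightarrow> complex" and m
    proof (rule Bochner_Integration.integrable_bound[OF bint[OF that]])
      show "(\<lambda>x. u x * complex_of_real (box_bump m a b x)) \<in> borel_measurable lborel"
        using borel_measurable_if_locally_integrable[OF that] by simp
    qed (rule AE_I2[OF le])
    have zero: "(LINT x|lborel. d x * complex_of_real (box_bump m a b x)) = 0" for m
      using eq[OF box_bump_test_function, of m a b] prod[OF g, of m] prod[OF h, of m]
      by (simp add: d_def left_diff_distrib)
    have "(\<lambda>m. LINT x|lborel. d x * complex_of_real (box_bump m a b x))
       \<longlonglongrightarrow> (LINT x|lborel. d x * complex_of_real (indicator (box a b) x))"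
    proof (rule integral_dominated_convergence[where w="\<lambda>x. norm (indicat_real (cbox a b) x *\<^sub>R d x)"])
      show "integrable lborel (\<lambda>x. norm (indicat_real (cbox a b) x *\<^sub>R d x))"
        using bint[OF d] by (rule integrable_norm)
      show "AE x in lborel. (\<lambda>m. d x * complex_of_real (box_bump m a b x))
         \<longlonglongrightarrow> d x * complex_of_real (indicat_real (box a b) x)"
        by (intro AE_I2 tendsto_intros tendsto_of_real box_bump_tendsto)
      show "AE x in lborel. norm (d x * complex_of_real (box_bump m a b x))
          \<le> norm (indicat_real (cbox a b) x *\<^sub>R d x)" for m
        by (rule AE_I2[OF le])
    qed simp_all
    then have "(LINT x|lborel. d x * complex_of_real (indicator (box a b) x)) = 0"
      unfolding zero by (simp add: LIMSEQ_const_iff)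
    then show ?thesis
      unfolding set_lebesgue_integral_def by (simp add: scaleR_conv_of_real mult.commute)
  qed
  from AE_zero_if_box_integrals_zero[OF d this] show ?thesis by (simp add: d_def)
qed

section \<open>The Fourier transform of a test function\<close>

lemma cis_measurable [measurable]: "cis \<in> borel_measurable borel"
  by (intro borel_measurable_continuous_onI continuous_on_cis continuous_on_id)

lemma derivative_outside_support:
  fixes g :: "'a::real_normed_vector \<Rightarrow> 'b::real_normed_vector"
  assumes "(g has_derivative g') (at x)" "\<And>x. norm x > R \<Longrightarrow> g x = 0" "norm x > R"
  shows "g' v = 0"
proof -
  have "open {x::'a. norm x > R}"
    by (intro open_Collect_less continuous_intros)
  then have "((\<lambda>_. 0) has_derivative g') (at x)"
    using has_derivative_transform_within_open[OF assms(1), of "{x. norm x > R}" "\<lambda>_. 0"] assms(2,3)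
    by simp
  then have "g' = (\<lambda>_. 0)" by (metis has_derivative_const has_derivative_unique)
  then show ?thesis by simp
qed

text \<open>Supplies the hypothesis of Fubini's theorem for the oscillating factors below, which
  have modulus at most one.\<close>

lemma integrable_pair_bounded:
  fixes f :: "'a::euclidean_space \<Rightarrow> 'c::{real_normed_field, banach, second_countable_topology}"
    and h :: "'b::euclidean_space \<Rightarrow> 'c"
  assumes f: "integrable lborel f" and h: "integrable lborel h"
    and m[measurable]: "m \<in> borel_measurable (lborel \<Otimes>\<^sub>M lborel)"
    and bound: "\<And>z. norm (m z) \<le> 1"
  shows "integrable (lborel \<Otimes>\<^sub>M lborel) (\<lambda>z. m z * (f (fst z) * h (snd z)))"
proof -
  have [measurable]: "f \<in> borel_measurable borel" "h \<in> borel_measurable borel"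
    using f h by (auto dest: borel_measurable_integrable)
  have "integrable (lborel \<Otimes>\<^sub>M lborel) (\<lambda>z. f (fst z) * h (snd z))"
  proof (rule lborel_pair.Fubini_integrable)
    show "integrable lborel (\<lambda>x. LINT y|lborel. norm (f (fst (x, y)) * h (snd (x, y))))"
      using f by (auto simp: norm_mult)
    show "AE x in lborel. integrable lborel (\<lambda>y. f (fst (x, y)) * h (snd (x, y)))"
      using h by auto
  qed measurable
  then show ?thesis
    by (rule Bochner_Integration.integrable_bound)
      (auto simp: norm_mult intro!: AE_I2 mult_left_le_one_le bound)
qed

section \<open>The multiplication formula and the transform of a regular distribution\<close>

lemma fourier_measurable:
  assumes "integrable lborel f"
  shows "fourier f \<in> borel_measurable borel"
proof -
  have [measurable]: "f \<in> borel_measurable borel"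
    using assms by (auto dest: borel_measurable_integrable)
  have "(\<lambda>\<xi>. LINT x|lborel. cis (- (x \<bullet> \<xi>)) * f x) \<in> borel_measurable lborel"
    by measurable
  then show ?thesis by (simp add: fourier_def[abs_def])
qed

lemma norm_fourier_le: "cmod (fourier f \<xi>) \<le> (LINT x|lborel. cmod (f x))"
  unfolding fourier_def
  by (rule order_trans[OF integral_norm_bound]) (simp add: norm_mult)

lemma integrable_cis_mult:
  fixes f :: "real^'n \<Rightarrow> complex"
  assumes "integrable lborel f"
  shows "integrable lborel (\<lambda>x. cis (- (x \<bullet> \<xi>)) * f x)"
proof (rule Bochner_Integration.integrable_bound[OF assms])
  have [measurable]: "f \<in> borel_measurable borel"
    using assms by (auto dest: borel_measurable_integrable)
  show "(\<lambda>x. cis (- (x \<bullet> \<xi>)) * f x) \<in> borel_measurable lborel" by measurable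
qed (simp add: norm_mult)

text \<open>Fubini's theorem, since the exponential is symmetric in its two variables. With a test
  function as h this says that the distribution given by f has the function \<open>fourier f\<close>
  as its transform.\<close>

lemma fourier_exchange:
  fixes f h :: "real^'n \<Rightarrow> complex"
  assumes f: "integrable lborel f" and h: "integrable lborel h"
  shows "(LINT x|lborel. f x * fourier h x) = (LINT \<xi>|lborel. fourier f \<xi> * h \<xi>)"
proof -
  have "integrable (lborel \<Otimes>\<^sub>M lborel)
     (\<lambda>z::(real^'n) \<times> (real^'n). cis (- (snd z \<bullet> fst z)) * (f (fst z) * h (snd z)))"
    by (intro integrable_pair_bounded f h) (auto, measurable)
  then have int: "integrable (lborel \<Otimes>\<^sub>M lborel) (\<lambda>(x, y). cis (- (y \<bullet> x)) * (f x * h y))"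
    by (simp add: case_prod_unfold)
  have "(LINT x|lborel. f x * fourier h x) = (LINT x|lborel. LINT y|lborel. cis (- (y \<bullet> x)) * (f x * h y))"
    unfolding fourier_def by (simp flip: integral_mult_right_zero add: mult_ac)
  also have "\<dots> = (LINT y|lborel. LINT x|lborel. cis (- (y \<bullet> x)) * (f x * h y))"
    using lborel_pair.Fubini_integral[OF int] by simp
  also have "\<dots> = (LINT \<xi>|lborel. fourier f \<xi> * h \<xi>)"
    unfolding fourier_def by (simp flip: integral_mult_left_zero integral_mult_right_zero add: mult_ac inner_commute)
  finally show ?thesis .
qed

lemma integrable_if_continuous_support:
  fixes f :: "real^'n \<Rightarrow> 'b::{banach, second_countable_topology}"
  assumes "continuous_on UNIV f" "\<And>x. norm x > R \<Longrightarrow> f x = 0"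
  shows "integrable lborel f"
proof -
  have "integrable lborel (\<lambda>x. indicator (cball 0 R) x *\<^sub>R f x)"
    using assms(1) by (intro borel_integrable_compact) (auto intro: continuous_on_subset)
  moreover have "(\<lambda>x. indicator (cball 0 R) x *\<^sub>R f x) = f"
    using assms(2) by (auto simp: fun_eq_iff indicator_def not_le)
  ultimately show ?thesis by simp
qed

lemma test_functionD:
  assumes "f \<in> test_functions"
  shows "integrable lborel f"
proof -
  from assms have "bounded (closure {x. f x \<noteq> 0})"
    by (auto simp: test_functions_def compact_imp_bounded)
  then obtain R where R: "\<And>x. x \<in> closure {x. f x \<noteq> 0} \<Longrightarrow> norm x \<le> R"
    by (auto simp: bounded_iff)
  have "f x = 0" if "norm x > R" for x
    using R[of x] closure_subset[of "{x. f x \<noteq> 0}"] that by fastforce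
  moreover have "continuous_on UNIV f"
    using assms by (auto simp: test_functions_def intro: smooth_on_imp_continuous_on)
  ultimately show ?thesis by (intro integrable_if_continuous_support)
qed

lemma fourier_locally_integrable:
  fixes f :: "real^'n \<Rightarrow> complex"
  assumes "integrable lborel f"
  shows "locally_integrable (fourier f)"
  unfolding locally_integrable_def
proof (intro allI impI)
  fix K :: "(real^'n) set" assume "compact K"
  then have "emeasure lborel K < \<infinity>" "K \<in> sets borel"
    using emeasure_bounded_finite[OF compact_imp_bounded, of K]
    by (auto simp: compact_imp_closed borel_closed)
  then show "set_integrable lborel K (fourier f)"
    unfolding set_integrable_def using fourier_measurable[OF assms] norm_fourier_le[of f]
    by (intro integrableI_bounded_set_indicator[where B="LINT x|lborel. cmod (f x)"]) auto
qed

lemma fourier_is_function_regular: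
  fixes f :: "real^'n \<Rightarrow> complex"
  assumes "integrable lborel f"
  shows "fourier_is_function (regular_distribution f) (fourier f)"
  unfolding fourier_is_function_def fourier_distribution_def regular_distribution_def
  using fourier_locally_integrable fourier_exchange assms test_functionD by blast

lemma fourier_function_regular:
  fixes f :: "real^'n \<Rightarrow> complex"
  assumes f: "integrable lborel f"
  shows "AE \<xi> in lborel. fourier_function (regular_distribution f) \<xi> = fourier f \<xi>"
    and "fourier_function (regular_distribution f) \<in> borel_measurable borel"
proof -
  let ?g = "fourier_function (regular_distribution f)"
  have g: "fourier_is_function (regular_distribution f) ?g"
    unfolding fourier_function_def by (rule someI[of _ "fourier f"]) (rule fourier_is_function_regular[OF f])
  then show "?g \<in> borel_measurable borel"
    by (auto simp: fourier_is_function_def intro: borel_measurable_if_locally_integrable)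
  show "AE \<xi> in lborel. ?g \<xi> = fourier f \<xi>"
    using g fourier_is_function_regular[OF f] unfolding fourier_is_function_def
    by (intro test_functions_separate) (auto simp: regular_distribution_def)
qed

text \<open>By translation invariance of Lebesgue measure all difference quotients have integral
  zero, and they converge to the derivative under a common integrable bound.\<close>

lemma integral_directional_derivative:
  fixes g :: "real^'n \<Rightarrow> complex"
  assumes der: "\<And>x. (g has_derivative g' x) (at x)"
    and cont: "continuous_on UNIV (\<lambda>x. g' x v)"
    and supp: "\<And>x. norm x > R \<Longrightarrow> g x = 0"
  shows "(LINT x|lborel. g' x v) = 0"
proof -
  have supp': "g' x v = 0" if "norm x > R" for x
    using derivative_outside_support[OF der supp that] .
  have gc: "continuous_on UNIV g"
    by (intro continuous_at_imp_continuous_on ballI has_derivative_continuous[OF der])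
  have gint: "integrable lborel g"
    using gc supp by (rule integrable_if_continuous_support)
  have [measurable]: "g \<in> borel_measurable borel" "(\<lambda>x. g' x v) \<in> borel_measurable borel"
    using gc cont by (auto intro: borel_measurable_continuous_onI)
  obtain M where M: "\<And>x. norm (g' x v) \<le> M"
  proof -
    have "bounded ((\<lambda>x. g' x v) ` cball 0 R)"
      by (intro compact_imp_bounded compact_continuous_image continuous_on_subset[OF cont]) auto
    then obtain M where "\<forall>x\<in>cball 0 R. norm (g' x v) \<le> M"
      by (auto simp: bounded_iff)
    \<comment> \<open>Outside the ball the derivative is zero, whereas M may be negative when R is
      negative and the ball is empty.\<close>
    then have "norm (g' x v) \<le> max M 0" for x
      using supp'[of x] by (cases "norm x \<le> R") force+
    then show ?thesis using that by blast
  qed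
  define h where "h n = inverse (real (Suc n))" for n
  have h: "0 < h n" "h n \<le> 1" for n by (auto simp: h_def field_simps)
  have h0: "h \<longlonglongrightarrow> 0" unfolding h_def by (rule LIMSEQ_inverse_real_of_nat)
  define q where "q n x = (g (x + h n *\<^sub>R v) - g x) /\<^sub>R h n" for n x
  have line: "((\<lambda>t. g (x + t *\<^sub>R v)) has_vector_derivative g' (x + t *\<^sub>R v) v) (at t)" for x t
  proof -
    have "((\<lambda>t. x + t *\<^sub>R v) has_derivative (\<lambda>s. s *\<^sub>R v)) (at t)"
      by (auto intro!: derivative_eq_intros)
    from diff_chain_at[OF this der]
    have "((\<lambda>t. g (x + t *\<^sub>R v)) has_derivative (\<lambda>s. g' (x + t *\<^sub>R v) (s *\<^sub>R v))) (at t)"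
      by (simp add: o_def)
    then show ?thesis
      by (simp add: has_vector_derivative_def linear_cmul[OF has_derivative_linear[OF der]])
  qed
  have "(LINT x|lborel. q n x) = 0" for n
  proof -
    have "integrable (distr lborel borel ((+) (h n *\<^sub>R v))) g"
      using gint by (simp add: lborel_distr_plus)
    then have i: "integrable lborel (\<lambda>x. g (h n *\<^sub>R v + x))"
      by (subst (asm) integrable_distr_eq) simp_all
    have "(LINT x|lborel. g x) = (LINT x|distr lborel borel ((+) (h n *\<^sub>R v)). g x)"
      by (simp add: lborel_distr_plus)
    also have "\<dots> = (LINT x|lborel. g (h n *\<^sub>R v + x))"
      by (rule integral_distr) simp_all
    finally show ?thesis
      unfolding q_def using i gint by (simp add: add.commute)
  qed
  \<comment> \<open>The step lengths h n are at most one, so all quotients vanish outside the ball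
    of radius R + |v|; inside it the mean value inequality bounds them by M.\<close>
  moreover have "(\<lambda>n. LINT x|lborel. q n x) \<longlonglongrightarrow> (LINT x|lborel. g' x v)"
  proof (rule integral_dominated_convergence[where w="\<lambda>x. indicator (cball 0 (R + norm v)) x *\<^sub>R M"])
    show "integrable lborel (\<lambda>x::real^'n. indicat_real (cball 0 (R + norm v)) x *\<^sub>R M)"
      by (intro borel_integrable_compact) auto
    show "AE x in lborel. (\<lambda>n. q n x) \<longlonglongrightarrow> g' x v"
    proof (rule AE_I2)
      fix x
      have "((\<lambda>t. (g (x + t *\<^sub>R v) - g x) /\<^sub>R t) \<longlongrightarrow> g' x v) (at 0)"
      proof (rule LIM_zero_cancel[OF tendsto_norm_zero_cancel])
        have "((\<lambda>t. norm (g (x + t *\<^sub>R v) - g x - t *\<^sub>R g' x v) / \<bar>t\<bar>) \<longlongrightarrow> 0) (at 0)"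
          using line[of x 0] by (simp add: has_vector_derivative_def has_derivative_at)
        moreover have "\<forall>\<^sub>F t in at 0. norm (g (x + t *\<^sub>R v) - g x - t *\<^sub>R g' x v) / \<bar>t\<bar> =
            norm ((g (x + t *\<^sub>R v) - g x) /\<^sub>R t - g' x v)"
        proof (rule eventually_at_filter[THEN iffD2, OF always_eventually], intro allI impI)
          fix t :: real assume "t \<noteq> 0"
          then have "(g (x + t *\<^sub>R v) - g x) /\<^sub>R t - g' x v = (g (x + t *\<^sub>R v) - g x - t *\<^sub>R g' x v) /\<^sub>R t"
            by (simp add: scaleR_diff_right)
          then show "norm (g (x + t *\<^sub>R v) - g x - t *\<^sub>R g' x v) / \<bar>t\<bar> =
              norm ((g (x + t *\<^sub>R v) - g x) /\<^sub>R t - g' x v)"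
            by (simp add: divide_inverse mult.commute)
        qed
        ultimately show "((\<lambda>t. norm ((g (x + t *\<^sub>R v) - g x) /\<^sub>R t - g' x v)) \<longlongrightarrow> 0) (at 0)"
          by (rule Lim_transform_eventually)
      qed
      then show "(\<lambda>n. q n x) \<longlonglongrightarrow> g' x v"
        unfolding q_def
      proof (rule filterlim_compose[where g="\<lambda>t. (g (x + t *\<^sub>R v) - g x) /\<^sub>R t"])
        show "filterlim h (at 0) sequentially"
          using h0 h(1) by (auto simp: filterlim_at less_imp_neq[symmetric])
      qed
    qed
    show "AE x in lborel. norm (q n x) \<le> indicator (cball 0 (R + norm v)) x *\<^sub>R M" for n
    proof (rule AE_I2)
      fix x
      show "norm (q n x) \<le> indicator (cball 0 (R + norm v)) x *\<^sub>R M"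
      proof (cases "norm x \<le> R + norm v")
        case True
        have "norm (g (x + h n *\<^sub>R v) - g (x + 0 *\<^sub>R v)) \<le> M * h n - M * 0"
          using M h[of n] line
          by (intro differentiable_bound_general[where f'="\<lambda>t. g' (x + t *\<^sub>R v) v" and \<phi>'="\<lambda>_. M"])
            (auto intro!: continuous_intros derivative_eq_intros continuous_on_compose2[OF gc]
               simp: has_real_derivative_iff_has_vector_derivative[symmetric])
        then have "norm (q n x) \<le> M"
          unfolding q_def using h[of n] by (simp add: divide_simps mult.commute)
        then show ?thesis using True by simp
      next
        case False
        have "norm (h n *\<^sub>R v) \<le> norm v"
          using h[of n] by (simp add: mult_left_le_one_le)
        then have "R < norm (x + h n *\<^sub>R v)" "R < norm x"
          using False norm_diff_ineq[of x "h n *\<^sub>R v"] norm_ge_zero[of v] by linarith+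
        then show ?thesis using supp False by (simp add: q_def)
      qed
    qed
  qed (auto simp: q_def)
  ultimately show ?thesis by (simp add: LIMSEQ_const_iff)
qed

lemma fourier_directional_derivative:
  fixes f :: "real^'n \<Rightarrow> complex"
  assumes sm: "smooth_on UNIV f" and supp: "\<And>x. norm x > R \<Longrightarrow> f x = 0" and b: "b \<in> Basis"
  shows "fourier (\<lambda>x. frechet_derivative f (at x) b) \<xi> = \<i> * of_real (b \<bullet> \<xi>) * fourier f \<xi>"
proof -
  define f' where "f' x = frechet_derivative f (at x)" for x
  have der: "(f has_derivative f' x) (at x)" for x
    unfolding f'_def using sm smooth_on_has_derivative by blast
  have f'c: "continuous_on UNIV (\<lambda>x. f' x b)"
    unfolding f'_def using sm b by (intro smooth_on_imp_continuous_on smooth_on_derivative)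
  have fc: "continuous_on UNIV f"
    using sm by (rule smooth_on_imp_continuous_on)
  have fi: "integrable lborel f"
    using fc supp by (rule integrable_if_continuous_support)
  have f'0: "f' x b = 0" if "norm x > R" for x
    using derivative_outside_support[OF der supp that] .
  have f'i: "integrable lborel (\<lambda>x. f' x b)"
    using f'c f'0 by (rule integrable_if_continuous_support)
  \<comment> \<open>The product rule for cis (- (x . \<xi>)) f x. That its integral vanishes is the
    integration by parts.\<close>
  define g' where "g' x v = cis (- (x \<bullet> \<xi>)) * f' x v + (- (v \<bullet> \<xi>)) *\<^sub>R (\<i> * cis (- (x \<bullet> \<xi>))) * f x" for x v
  have "(LINT x|lborel. g' x b) = 0"
  proof (rule integral_directional_derivative[where R=R])
    show "((\<lambda>x. cis (- (x \<bullet> \<xi>)) * f x) has_derivative g' x) (at x)" for x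
      unfolding g'_def by (auto intro!: derivative_eq_intros der)
    show "continuous_on UNIV (\<lambda>x. g' x b)"
      unfolding g'_def by (intro continuous_intros f'c fc continuous_on_cis)
  qed (simp add: supp)
  moreover have "(LINT x|lborel. g' x b) =
     fourier (\<lambda>x. f' x b) \<xi> - \<i> * of_real (b \<bullet> \<xi>) * fourier f \<xi>"
  proof -
    have "(LINT x|lborel. g' x b) = (LINT x|lborel. cis (- (x \<bullet> \<xi>)) * f' x b -
        \<i> * of_real (b \<bullet> \<xi>) * (cis (- (x \<bullet> \<xi>)) * f x))"
      unfolding g'_def by (intro Bochner_Integration.integral_cong) (auto simp: scaleR_conv_of_real)
    also have "\<dots> = fourier (\<lambda>x. f' x b) \<xi> - \<i> * of_real (b \<bullet> \<xi>) * fourier f \<xi>"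
      unfolding fourier_def using integrable_cis_mult[OF fi] integrable_cis_mult[OF f'i] by simp
    finally show ?thesis .
  qed
  ultimately show ?thesis by (simp add: f'_def)
qed

text \<open>Each further factor |\<xi>| is at most the sum of the |\<xi> . b| over the basis, and
  each of these turns into a derivative of f, which is smooth with the same support bound.\<close>

lemma fourier_rapid_decay:
  fixes f :: "real^'n \<Rightarrow> complex"
  assumes "smooth_on UNIV f" "\<And>x. norm x > R \<Longrightarrow> f x = 0"
  shows "\<exists>C. \<forall>\<xi>. (1 + norm \<xi>) ^ k * cmod (fourier f \<xi>) \<le> C"
  using assms
proof (induction k arbitrary: f)
  case 0
  then show ?case using norm_fourier_le by auto
next
  case (Suc k)
  let ?D = "\<lambda>b x. frechet_derivative f (at x) b"
  have D0: "?D b x = 0" if "norm x > R" for b x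
    using derivative_outside_support[OF smooth_on_has_derivative[OF Suc.prems(1)] Suc.prems(2) that] by simp
  have "\<forall>b\<in>Basis. \<exists>C. \<forall>\<xi>. (1 + norm \<xi>) ^ k * cmod (fourier (?D b) \<xi>) \<le> C"
    using Suc.IH[OF smooth_on_derivative[OF Suc.prems(1)]] D0 by blast
  then obtain C where C: "\<And>b \<xi>. b \<in> Basis \<Longrightarrow> (1 + norm \<xi>) ^ k * cmod (fourier (?D b) \<xi>) \<le> C b"
    by metis
  obtain C0 where C0: "\<And>\<xi>. (1 + norm \<xi>) ^ k * cmod (fourier f \<xi>) \<le> C0"
    using Suc.IH[OF Suc.prems] by blast
  have "(1 + norm \<xi>) ^ Suc k * cmod (fourier f \<xi>) \<le> C0 + (\<Sum>b\<in>Basis. C b)" for \<xi>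
  proof -
    have "norm \<xi> * cmod (fourier f \<xi>) \<le> (\<Sum>b\<in>Basis. \<bar>\<xi> \<bullet> b\<bar>) * cmod (fourier f \<xi>)"
      by (intro mult_right_mono norm_le_l1) simp
    also have "\<dots> = (\<Sum>b\<in>Basis. cmod (fourier (?D b) \<xi>))"
      using fourier_directional_derivative[OF Suc.prems]
      by (simp add: sum_distrib_right norm_mult inner_commute)
    finally have *: "norm \<xi> * cmod (fourier f \<xi>) \<le> (\<Sum>b\<in>Basis. cmod (fourier (?D b) \<xi>))" .
    have "(1 + norm \<xi>) ^ Suc k * cmod (fourier f \<xi>) =
        (1 + norm \<xi>) ^ k * cmod (fourier f \<xi>) + (1 + norm \<xi>) ^ k * (norm \<xi> * cmod (fourier f \<xi>))"
      by (simp add: algebra_simps)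
    also have "\<dots> \<le> C0 + (1 + norm \<xi>) ^ k * (\<Sum>b\<in>Basis. cmod (fourier (?D b) \<xi>))"
      by (intro add_mono C0 mult_left_mono *) auto
    also have "\<dots> \<le> C0 + (\<Sum>b\<in>Basis. C b)"
      unfolding sum_distrib_left by (intro add_left_mono sum_mono C)
    finally show ?thesis .
  qed
  then show ?case by blast
qed

section \<open>A rapidly decreasing reproducing kernel for band-limited functions\<close>

lemma integrable_vec_prod:
  fixes f :: "'n::finite \<Rightarrow> real \<Rightarrow> 'c::{real_normed_field, banach, second_countable_topology}"
  assumes int: "\<And>i. integrable lborel (f i)"
  shows "integrable lborel (\<lambda>x::real^'n. \<Prod>i\<in>UNIV. f i (x $ i))"
    and "(LINT x|lborel. (\<Prod>i\<in>UNIV. f i ((x::real^'n) $ i))) = (\<Prod>i\<in>UNIV. integral\<^sup>L lborel (f i))"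
proof -
  interpret product_sigma_finite "\<lambda>_::real^'n. lborel :: real measure" ..
  have [measurable]: "f i \<in> borel_measurable borel" for i
    using borel_measurable_integrable[OF int] by simp
  let ?a = "\<lambda>i::'n. axis i 1 :: real^'n"
  \<comment> \<open>Reindexes the factors from coordinates to basis vectors, over which
    \<open>lborel\<close> is the image of a product measure.\<close>
  define h where "h b = f (inv ?a b)" for b
  have inj: "inj ?a" by (auto simp: inj_def axis_eq_axis)
  then have h: "h (?a i) = f i" for i by (simp add: h_def inv_f_f[OF inj])
  have B: "(Basis :: (real^'n) set) = range ?a" by (auto simp: Basis_vec_def)
  have eq: "(\<Prod>i\<in>UNIV. f i (x $ i)) = (\<Prod>b\<in>Basis. h b (x \<bullet> b))" for x
    unfolding B by (subst prod.reindex[OF inj]) (simp add: h inner_axis)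
  have coord: "(\<Sum>b\<in>Basis. y b *\<^sub>R b) \<bullet> c = y c" if "c \<in> Basis" for y and c :: "real^'n"
    using that by (simp add: inner_sum_left inner_Basis if_distrib sum.delta cong: if_cong)
  have hi: "integrable lborel (h b)" for b unfolding h_def by (rule int)
  have "integrable (\<Pi>\<^sub>M b\<in>Basis. lborel) (\<lambda>y. \<Prod>b\<in>Basis. h b (y (b::real^'n)))"
    by (intro product_integrable_prod finite_Basis hi)
  then have I: "integrable (\<Pi>\<^sub>M b\<in>Basis. lborel) (\<lambda>y. \<Prod>b\<in>Basis. h b ((\<Sum>b\<in>Basis. y b *\<^sub>R b) \<bullet> (b::real^'n)))"
    by (simp add: coord cong: prod.cong)
  have m: "(\<lambda>x::real^'n. \<Prod>i\<in>UNIV. f i (x $ i)) \<in> borel_measurable borel"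
    by measurable
  then have m': "(\<lambda>x::real^'n. \<Prod>b\<in>Basis. h b (x \<bullet> b)) \<in> borel_measurable borel"
    by (simp add: eq)
  show "integrable lborel (\<lambda>x::real^'n. \<Prod>i\<in>UNIV. f i (x $ i))"
    unfolding eq using I m' by (subst lborel_eq) (simp add: integrable_distr_eq)
  have "(LINT x|lborel. (\<Prod>i\<in>UNIV. f i ((x::real^'n) $ i))) =
      (LINT y|(\<Pi>\<^sub>M b\<in>Basis. lborel). (\<Prod>b\<in>Basis. h b ((\<Sum>b\<in>Basis. y b *\<^sub>R b) \<bullet> (b::real^'n))))"
    unfolding eq using m' by (subst lborel_eq) (simp add: integral_distr)
  also have "\<dots> = (LINT y|(\<Pi>\<^sub>M b\<in>Basis. lborel). (\<Prod>b\<in>Basis. h b (y (b::real^'n))))"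
    by (simp add: coord cong: prod.cong)
  also have "\<dots> = (\<Prod>b\<in>Basis. integral\<^sup>L lborel (h (b::real^'n)))"
    by (intro product_integral_prod finite_Basis hi)
  also have "\<dots> = (\<Prod>i\<in>UNIV. integral\<^sup>L lborel (f i))"
    unfolding B by (subst prod.reindex[OF inj]) (simp add: h)
  finally show "(LINT x|lborel. (\<Prod>i\<in>UNIV. f i ((x::real^'n) $ i))) = (\<Prod>i\<in>UNIV. integral\<^sup>L lborel (f i))" .
qed

lemma integrable_inverse_one_plus_square: "integrable lborel (\<lambda>t::real. inverse (1 + t\<^sup>2))"
  using integrable_inverse_1_plus_square by (simp add: set_integrable_def einterval_iff)

text \<open>Every coordinate satisfies 1 + x_i^2 <= (1 + |x|)^2. From the exponent 2 n on, the
  function therefore lies below the product of the one-dimensional functions 1 / (1 +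
  x_i^2).\<close>

lemma integrable_inverse_power:
  assumes "2 * CARD('n) \<le> k"
  shows "integrable lborel (\<lambda>x::real^'n. inverse ((1 + norm x) ^ k))"
proof (rule Bochner_Integration.integrable_bound)
  show "integrable lborel (\<lambda>x::real^'n. \<Prod>i\<in>UNIV. inverse (1 + (x $ i)\<^sup>2))"
    by (intro integrable_vec_prod integrable_inverse_one_plus_square)
  show "AE x in lborel. norm (inverse ((1 + norm x) ^ k)) \<le> norm (\<Prod>i\<in>UNIV. inverse (1 + ((x::real^'n) $ i)\<^sup>2))"
  proof (rule AE_I2)
    fix x :: "real^'n"
    have "(\<Prod>i\<in>UNIV. 1 + (x $ i)\<^sup>2) \<le> (\<Prod>i\<in>(UNIV::'n set). (1 + norm x)\<^sup>2)"
    proof (intro prod_mono conjI)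
      fix i
      have "(x $ i)\<^sup>2 \<le> (norm x)\<^sup>2"
        using component_le_norm_cart[of x i] by (simp add: power2_le_iff_abs_le)
      then show "1 + (x $ i)\<^sup>2 \<le> (1 + norm x)\<^sup>2"
        using norm_ge_zero[of x] unfolding power2_sum one_power2 by linarith
    qed simp
    also have "\<dots> = (1 + norm x) ^ (2 * CARD('n))"
      by (simp add: power_mult)
    also have "\<dots> \<le> (1 + norm x) ^ k"
      using assms by (intro power_increasing) auto
    finally have "inverse ((1 + norm x) ^ k) \<le> inverse (\<Prod>i\<in>UNIV. 1 + (x $ i)\<^sup>2)"
      by (intro le_imp_inverse_le) (auto intro!: prod_pos simp: add_pos_nonneg)
    moreover have "0 \<le> inverse ((1 + norm x) ^ k)" by simp
    moreover have "(\<Prod>i\<in>UNIV. inverse (1 + (x $ i)\<^sup>2)) = inverse (\<Prod>i\<in>UNIV. 1 + (x $ i)\<^sup>2)"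
      using prod_inversef[of "\<lambda>i. 1 + (x $ i)\<^sup>2" UNIV] by (simp add: o_def)
    ultimately show "norm (inverse ((1 + norm x) ^ k)) \<le> norm (\<Prod>i\<in>UNIV. inverse (1 + (x $ i)\<^sup>2))"
      unfolding real_norm_def by linarith
  qed
qed measurable

text \<open>This is (1 - cos t) / t^2 written as a square, with the limit 1/2 at t = 0 because
  \<open>sinc 0\<close> is 1.\<close>

definition fejer :: "real \<Rightarrow> real" where
  "fejer t = (sinc (t / 2))\<^sup>2 / 2"

lemma fejer_mult_square: "t\<^sup>2 * fejer t = 1 - cos t"
proof (cases "t = 0")
  case False
  then have "t\<^sup>2 * fejer t = 2 * (sin (t / 2))\<^sup>2"
    by (simp add: fejer_def power_divide)
  then show ?thesis using cos_double_sin[of "t / 2"] by simp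
qed simp

lemma abs_sinc_le: "\<bar>sinc t\<bar> \<le> 1"
  using abs_sin_x_le_abs_x[of t] by (auto simp: divide_le_eq abs_divide)

lemma fejer_nonneg: "0 \<le> fejer t"
  by (simp only: fejer_def) simp

lemma fejer_le_one: "fejer t \<le> 1"
proof -
  have "(sinc (t / 2))\<^sup>2 \<le> 1"
    using abs_sinc_le[of "t / 2"] by (simp only: abs_square_le_1)
  then show ?thesis unfolding fejer_def by linarith
qed

lemma fejer_le: "fejer t \<le> 3 * inverse (1 + t\<^sup>2)"
proof -
  have "fejer t \<le> 1" by (rule fejer_le_one)
  moreover have "t\<^sup>2 * fejer t \<le> 2"
    unfolding fejer_mult_square using cos_ge_minus_one[of t] by linarith
  ultimately have "(1 + t\<^sup>2) * fejer t \<le> 3" by (simp add: algebra_simps)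
  then show ?thesis by (simp add: field_simps add_pos_nonneg)
qed

lemma continuous_on_fejer [continuous_intros]:
  "continuous_on S f \<Longrightarrow> continuous_on S (\<lambda>x. fejer (f x))"
  unfolding fejer_def by (intro continuous_intros continuous_on_sinc) auto

lemma fejer_measurable [measurable]: "fejer \<in> borel_measurable borel"
  by (intro borel_measurable_continuous_onI continuous_intros)

lemma integrable_fejer: "integrable lborel fejer"
proof (rule Bochner_Integration.integrable_bound)
  show "integrable lborel (\<lambda>t::real. 3 * inverse (1 + t\<^sup>2))"
    by (intro integrable_mult_right integrable_inverse_one_plus_square)
qed (use fejer_le fejer_nonneg in \<open>auto simp: abs_le_iff intro: order_trans[OF _ abs_ge_self]\<close>)

definition fejer_mass :: real where
  "fejer_mass = integral\<^sup>L lborel fejer"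

text \<open>The kernels below are divided by this mass. Were it zero, the nonnegative integrand
  would vanish almost everywhere, but it is positive on the interval (0, 1).\<close>

lemma fejer_mass_pos: "fejer_mass > 0"
proof (rule ccontr)
  assume "\<not> fejer_mass > 0"
  moreover have "fejer_mass \<ge> 0"
    unfolding fejer_mass_def by (intro integral_nonneg_AE) (simp add: fejer_nonneg)
  ultimately have "integral\<^sup>L lborel fejer = 0" by (simp add: fejer_mass_def)
  then have "AE t in lborel. fejer t = 0"
    using integral_nonneg_eq_0_iff_AE[OF integrable_fejer] fejer_nonneg by auto
  then have "AE t in lborel. t \<notin> {0<..<1::real}"
  proof eventually_elim
    case (elim t)
    show ?case
    proof
      assume "t \<in> {0<..<1}"
      then have "sin (t / 2) > 0" using pi_gt3 by (intro sin_gt_zero) auto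
      then show False using elim \<open>t \<in> {0<..<1}\<close> by (simp add: fejer_def)
    qed
  qed
  moreover have "{t \<in> space lborel. \<not> t \<notin> {0<..<1::real}} = {0<..<1}"
    by auto
  moreover have "{0<..<1::real} \<in> sets lborel" by simp
  ultimately have "emeasure lborel {0<..<1::real} = 0"
    using AE_iff_measurable[of "{0<..<1::real}" lborel "\<lambda>t. t \<notin> {0<..<1}"] by blast
  then show False by simp
qed

text \<open>The scaled kernel is (1 - cos (c t)) / t^2, to which the product-to-sum formula applies
  linearly. The factor \<open>c\<^sup>2\<close> also makes c = 0 a regular case, with both sides
  zero.\<close>

lemma integral_fejer_scaled:
  "integrable lborel (\<lambda>t. c\<^sup>2 * fejer (c * t))"
  "(LINT t|lborel. c\<^sup>2 * fejer (c * t)) = \<bar>c\<bar> * fejer_mass"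
proof -
  show "integrable lborel (\<lambda>t. c\<^sup>2 * fejer (c * t))"
    using lborel_integrable_real_affine[OF integrable_fejer, of c 0] by (cases "c = 0") auto
  show "(LINT t|lborel. c\<^sup>2 * fejer (c * t)) = \<bar>c\<bar> * fejer_mass"
  proof (cases "c = 0")
    case False
    then have fm: "fejer_mass = \<bar>c\<bar> * (LINT t|lborel. fejer (c * t))"
      using lborel_integral_real_affine[of c fejer 0] by (simp add: fejer_mass_def)
    have "c\<^sup>2 = \<bar>c\<bar> * \<bar>c\<bar>" by (simp add: power2_eq_square)
    then show ?thesis by (simp only: integral_mult_right_zero mult.assoc fm)
  qed simp
qed

text \<open>The product-to-sum formula turns the cosine transform of the Fejer kernel into a combination of
  its masses at different scales, which is the tent function.\<close>

lemma integral_fejer_cos: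
  "(LINT t|lborel. c\<^sup>2 * fejer (c * t) * cos (x * t)) =
     (\<bar>c + x\<bar> / 2 + \<bar>c - x\<bar> / 2 - \<bar>x\<bar>) * fejer_mass"
proof -
  have "c\<^sup>2 * fejer (c * t) * cos (x * t) =
      ((c + x)\<^sup>2 * fejer ((c + x) * t)) / 2 + ((c - x)\<^sup>2 * fejer ((c - x) * t)) / 2 - x\<^sup>2 * fejer (x * t)" for t
  proof (cases "t = 0")
    case True
    then show ?thesis by (simp add: fejer_def power2_eq_square field_simps)
  next
    case False
    have D: "y\<^sup>2 * fejer (y * t) = (1 - cos (y * t)) / t\<^sup>2" for y
      using fejer_mult_square[of "y * t"] False by (simp add: field_simps power_mult_distrib)
    have "(1 - cos (c * t)) * cos (x * t) =
        (1 - cos ((c + x) * t)) / 2 + (1 - cos ((c - x) * t)) / 2 - (1 - cos (x * t))"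
      by (simp add: algebra_simps cos_add cos_diff) (simp add: field_simps)
    moreover have "u / T * w = (p / T) / 2 + (q / T) / 2 - r / T" if "u * w = p / 2 + q / 2 - r"
      for u w p q r T :: real
      using that by (simp add: add_divide_distrib diff_divide_distrib mult.commute)
    ultimately show ?thesis unfolding D by blast
  qed
  then have "(LINT t|lborel. c\<^sup>2 * fejer (c * t) * cos (x * t)) = (LINT t|lborel.
      ((c + x)\<^sup>2 * fejer ((c + x) * t)) / 2 + ((c - x)\<^sup>2 * fejer ((c - x) * t)) / 2 - x\<^sup>2 * fejer (x * t))"
    by simp
  also have "\<dots> = (LINT t|lborel. ((c + x)\<^sup>2 * fejer ((c + x) * t)) / 2) +
      (LINT t|lborel. ((c - x)\<^sup>2 * fejer ((c - x) * t)) / 2) - (LINT t|lborel. x\<^sup>2 * fejer (x * t))"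
    by (intro Bochner_Integration.integral_diff[THEN trans] arg_cong2[of _ _ _ _ "(-)"] refl
        Bochner_Integration.integral_add Bochner_Integration.integrable_add
        integrable_divide integral_fejer_scaled(1))
  finally show ?thesis
    unfolding integral_divide_zero integral_fejer_scaled(2) by (simp add: algebra_simps)
qed

text \<open>An average of cosines over [0, 1], so that multiplication by \<open>sinc\<close>
  averages a cosine transform over shifts.\<close>

lemma sinc_eq_integral: "sinc t = (LINT y|lborel. indicator {0..1} y * cos (y * t))"
proof (cases "t = 0")
  case False
  have "(LINT y|lborel. cos (y * t) * indicator {0..1} y) = sin (1 * t) / t - sin (0 * t) / t"
    using False by (intro integral_FTC_Icc_real) (auto intro!: derivative_eq_intros)
  then show ?thesis using False by (simp add: mult.commute)
qed simp

text \<open>The Fourier transform of g is to be identically one on [-a, a]; evenness takes care of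
  its sine part. The factor \<open>1 + t\<^sup>2\<close> in the decay keeps g integrable already for
  N = 0.\<close>

definition band_kernel :: "real \<Rightarrow> nat \<Rightarrow> (real \<Rightarrow> real) \<Rightarrow> bool" where
  "band_kernel a N g \<longleftrightarrow> continuous_on UNIV g \<and> (\<forall>t. g (- t) = g t) \<and>
     (\<exists>C. \<forall>t. \<bar>g t\<bar> * ((1 + \<bar>t\<bar>) ^ N * (1 + t\<^sup>2)) \<le> C) \<and>
     (\<forall>x. \<bar>x\<bar> \<le> a \<longrightarrow> (LINT t|lborel. g t * cos (x * t)) = 1)"

lemma band_kernel_integrable:
  assumes "band_kernel a N g"
  shows "integrable lborel g"
proof -
  obtain C where C: "\<And>t. \<bar>g t\<bar> * ((1 + \<bar>t\<bar>) ^ N * (1 + t\<^sup>2)) \<le> C"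
    using assms by (auto simp: band_kernel_def)
  show ?thesis
  proof (rule Bochner_Integration.integrable_bound)
    show "integrable lborel (\<lambda>t. C * inverse (1 + t\<^sup>2))"
      by (intro integrable_mult_right integrable_inverse_one_plus_square)
    show "g \<in> borel_measurable lborel"
      using assms by (auto simp: band_kernel_def intro: borel_measurable_continuous_onI)
    show "AE t in lborel. norm (g t) \<le> norm (C * inverse (1 + t\<^sup>2))"
    proof (rule AE_I2)
      fix t
      have "\<bar>g t\<bar> * (1 * (1 + t\<^sup>2)) \<le> \<bar>g t\<bar> * ((1 + \<bar>t\<bar>) ^ N * (1 + t\<^sup>2))"
        by (intro mult_left_mono mult_right_mono one_le_power) auto
      also note C[of t]
      finally have "\<bar>g t\<bar> \<le> C * inverse (1 + t\<^sup>2)"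
        by (simp add: divide_inverse[symmetric] pos_le_divide_eq add_pos_nonneg)
      then show "norm (g t) \<le> norm (C * inverse (1 + t\<^sup>2))" by simp
    qed
  qed
qed

text \<open>Divided by the mass, the cosine transform of the Fejer kernel at scale c is the tent c -
  |x| on [-c, c]. The difference of the tents for a + 1 and a is a trapezoid with value one on
  [-a, a], so the kernel is of de la Vallee-Poussin type.\<close>

lemma band_kernel_0:
  assumes "a \<ge> 0"
  shows "\<exists>g. band_kernel a 0 g"
proof
  let ?g = "\<lambda>t. ((a + 1)\<^sup>2 * fejer ((a + 1) * t) - a\<^sup>2 * fejer (a * t)) / fejer_mass"
  have bound: "c\<^sup>2 * fejer (c * t) * (1 + t\<^sup>2) \<le> c\<^sup>2 + 2" for c t
  proof -
    have "fejer (c * t) \<le> 1" by (rule fejer_le_one)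
    then have "c\<^sup>2 * fejer (c * t) \<le> c\<^sup>2" by (simp add: mult_left_le)
    moreover have "c\<^sup>2 * fejer (c * t) * t\<^sup>2 \<le> 2"
      using fejer_mult_square[of "c * t"] cos_ge_minus_one[of "c * t"]
      by (simp add: power_mult_distrib mult_ac)
    ultimately show ?thesis by (simp add: algebra_simps)
  qed
  have "\<bar>?g t\<bar> * (1 + t\<^sup>2) \<le> ((a + 1)\<^sup>2 + 2 + (a\<^sup>2 + 2)) / fejer_mass" for t
  proof -
    have "\<bar>(a + 1)\<^sup>2 * fejer ((a + 1) * t) - a\<^sup>2 * fejer (a * t)\<bar> * (1 + t\<^sup>2) \<le>
       ((a + 1)\<^sup>2 * fejer ((a + 1) * t) + a\<^sup>2 * fejer (a * t)) * (1 + t\<^sup>2)"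
      using fejer_nonneg by (intro mult_right_mono) (auto simp: abs_le_iff)
    also have "\<dots> \<le> (a + 1)\<^sup>2 + 2 + (a\<^sup>2 + 2)"
      using bound[of "a + 1" t] bound[of a t] by (simp only: distrib_right)
    finally show ?thesis
      using fejer_mass_pos by (simp add: abs_divide divide_right_mono)
  qed
  moreover have "(LINT t|lborel. ?g t * cos (x * t)) = 1" if "\<bar>x\<bar> \<le> a" for x
  proof -
    have int: "integrable lborel (\<lambda>t. c\<^sup>2 * fejer (c * t) * cos (x * t))" for c
      by (rule Bochner_Integration.integrable_bound[OF integral_fejer_scaled(1)[of c]])
        (auto simp: abs_mult intro!: mult_left_le AE_I2)
    have "(LINT t|lborel. ?g t * cos (x * t)) = (LINT t|lborel.
        ((a + 1)\<^sup>2 * fejer ((a + 1) * t) * cos (x * t) - a\<^sup>2 * fejer (a * t) * cos (x * t)) / fejer_mass)"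
      by (intro Bochner_Integration.integral_cong) (auto simp: algebra_simps diff_divide_distrib)
    also have "\<dots> = (\<bar>a + 1 + x\<bar> / 2 + \<bar>a + 1 - x\<bar> / 2 - \<bar>x\<bar>) - (\<bar>a + x\<bar> / 2 + \<bar>a - x\<bar> / 2 - \<bar>x\<bar>)"
      using int integral_fejer_cos fejer_mass_pos by (simp add: diff_divide_distrib)
    also have "\<dots> = 1"
    proof -
      have "\<bar>a + 1 + x\<bar> = a + 1 + x" "\<bar>a + 1 - x\<bar> = a + 1 - x" "\<bar>a + x\<bar> = a + x" "\<bar>a - x\<bar> = a - x"
        using that by linarith+
      then show ?thesis by (simp add: field_simps)
    qed
    finally show ?thesis .
  qed
  moreover have "?g (- t) = ?g t" for t
    by (simp add: fejer_def)
  ultimately show "band_kernel a 0 ?g"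
    unfolding band_kernel_def using fejer_mass_pos by (auto intro!: continuous_intros)
qed

text \<open>Multiplying by \<open>sinc\<close> gains one power of decay and averages the cosine transform over shifts of
  length at most one, which preserves the value one on a band that is narrower by one.\<close>

lemma band_kernel_Suc:
  assumes "band_kernel (a + 1) N g"
  shows "band_kernel a (Suc N) (\<lambda>t. g t * sinc t)"
proof -
  from assms have gc: "continuous_on UNIV g" and even: "\<And>t. g (- t) = g t"
    and g1: "\<And>x. \<bar>x\<bar> \<le> a + 1 \<Longrightarrow> (LINT t|lborel. g t * cos (x * t)) = 1"
    by (auto simp: band_kernel_def)
  obtain C where C: "\<And>t. \<bar>g t\<bar> * ((1 + \<bar>t\<bar>) ^ N * (1 + t\<^sup>2)) \<le> C"
    using assms by (auto simp: band_kernel_def)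
  have gi: "integrable lborel g" using band_kernel_integrable[OF assms] .
  have [measurable]: "g \<in> borel_measurable borel" using gc by (rule borel_measurable_continuous_onI)
  have "\<bar>g t * sinc t\<bar> * ((1 + \<bar>t\<bar>) ^ Suc N * (1 + t\<^sup>2)) \<le> C * 2" for t
  proof -
    have "\<bar>sinc t\<bar> * \<bar>t\<bar> \<le> 1" by (simp add: abs_divide)
    then have "\<bar>sinc t\<bar> * (1 + \<bar>t\<bar>) \<le> 2" using abs_sinc_le[of t] by (simp only: distrib_left)
    then have "(\<bar>g t\<bar> * ((1 + \<bar>t\<bar>) ^ N * (1 + t\<^sup>2))) * (\<bar>sinc t\<bar> * (1 + \<bar>t\<bar>)) \<le> C * 2"
      using order_trans[OF _ C[of t]] by (intro mult_mono C) auto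
    then show ?thesis by (simp only: abs_mult power_Suc mult_ac)
  qed
  moreover have "(LINT t|lborel. g t * sinc t * cos (x * t)) = 1" if x: "\<bar>x\<bar> \<le> a" for x
  proof -
    have bd: "integrable lborel (\<lambda>t. g t * cos (y * t))" for y
      by (rule Bochner_Integration.integrable_bound[OF gi])
        (auto simp: abs_mult intro!: mult_left_le AE_I2)
    have "integrable (lborel \<Otimes>\<^sub>M lborel)
       (\<lambda>z::real \<times> real. cos (snd z * fst z) * cos (x * fst z) * (g (fst z) * indicat_real {0..1} (snd z)))"
      by (intro integrable_pair_bounded gi) (auto simp: abs_mult intro!: mult_le_one)
    then have int: "integrable (lborel \<Otimes>\<^sub>M lborel)
       (\<lambda>(t, y). g t * (indicator {0..1} y * cos (y * t)) * cos (x * t))"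
      by (simp add: case_prod_unfold mult_ac)
    have "(LINT t|lborel. g t * sinc t * cos (x * t)) =
        (LINT t|lborel. LINT y|lborel. g t * (indicator {0..1} y * cos (y * t)) * cos (x * t))"
      unfolding sinc_eq_integral by (simp only: integral_mult_left_zero integral_mult_right_zero)
    also have "\<dots> = (LINT y|lborel. LINT t|lborel. g t * (indicator {0..1} y * cos (y * t)) * cos (x * t))"
      using lborel_pair.Fubini_integral[OF int] by simp
    also have "\<dots> = (LINT y|lborel. indicator {0..1::real} y)"
    proof (rule Bochner_Integration.integral_cong[OF refl])
      fix y :: real
      have "(LINT t|lborel. g t * (indicator {0..1} y * cos (y * t)) * cos (x * t)) =
          (LINT t|lborel. indicator {0..1} y * ((g t * cos ((x + y) * t) + g t * cos ((x - y) * t)) / 2))"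
        by (intro Bochner_Integration.integral_cong)
          (auto simp: cos_add cos_diff algebra_simps)
      also have "\<dots> = indicator {0..1} y *
          (((LINT t|lborel. g t * cos ((x + y) * t)) + (LINT t|lborel. g t * cos ((x - y) * t))) / 2)"
        using bd by simp
      also have "\<dots> = indicator {0..1} y"
        using x by (auto simp: indicator_def g1)
      finally show "(LINT t|lborel. g t * (indicator {0..1} y * cos (y * t)) * cos (x * t)) = indicator {0..1} y" .
    qed
    finally show ?thesis by simp
  qed
  ultimately show ?thesis
    unfolding band_kernel_def using even
    by (intro conjI continuous_on_mult gc continuous_on_sinc continuous_on_id allI impI exI[of _ "C * 2"]) auto
qed

text \<open>Each multiplication by \<open>sinc\<close> narrows the band by one, so order N starts
  from the band a + N; hence the induction generalises over a.\<close>

lemma band_kernel_exists: "a \<ge> 0 \<Longrightarrow> \<exists>g. band_kernel a N g"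
proof (induction N arbitrary: a)
  case 0
  then show ?case by (rule band_kernel_0)
next
  case (Suc N)
  then show ?case using Suc.IH[of "a + 1"] band_kernel_Suc by (metis add_increasing zero_le_one)
qed

text \<open>The real part is the cosine transform prescribed on the band; the imaginary part changes
  sign under t -> -t because g is even, and so vanishes.\<close>

lemma band_kernel_cis:
  assumes "band_kernel a N g" "\<bar>x\<bar> \<le> a"
  shows "integrable lborel (\<lambda>t. cis (- (x * t)) * of_real (g t))"
    and "(LINT t|lborel. cis (- (x * t)) * of_real (g t)) = 1"
proof -
  have gi: "integrable lborel g" by (rule band_kernel_integrable[OF assms(1)])
  then have [measurable]: "g \<in> borel_measurable borel" by (auto dest: borel_measurable_integrable)
  show int: "integrable lborel (\<lambda>t. cis (- (x * t)) * of_real (g t))"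
    by (rule Bochner_Integration.integrable_bound[OF gi]) (auto simp: norm_mult)
  have "Re (LINT t|lborel. cis (- (x * t)) * of_real (g t)) = (LINT t|lborel. g t * cos (x * t))"
    using integral_Re[OF int] by (simp add: mult.commute)
  also have "\<dots> = 1" using assms by (simp add: band_kernel_def)
  finally have Re: "Re (LINT t|lborel. cis (- (x * t)) * of_real (g t)) = 1" .
  have "(LINT t|lborel. g t * sin (x * t)) = (LINT t|lborel. g (- t) * sin (x * (- t)))"
    using lborel_integral_real_affine[of "-1" "\<lambda>t. g t * sin (x * t)" 0] by simp
  also have "\<dots> = - (LINT t|lborel. g t * sin (x * t))"
    using assms(1) by (simp add: band_kernel_def)
  finally have "(LINT t|lborel. g t * sin (x * t)) = 0" by simp
  then have "Im (LINT t|lborel. cis (- (x * t)) * of_real (g t)) = 0"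
    using integral_Im[OF int] by (simp add: mult.commute)
  then show "(LINT t|lborel. cis (- (x * t)) * of_real (g t)) = 1"
    using Re by (simp add: complex_eq_iff)
qed

section \<open>Passage from one to n dimensions by tensor products\<close>

lemma one_plus_norm_le_prod: "1 + norm (x::real^'n) \<le> (\<Prod>i\<in>UNIV. 1 + \<bar>x $ i\<bar>)"
proof -
  have "1 + (\<Sum>i\<in>I. \<bar>x $ i\<bar>) \<le> (\<Prod>i\<in>I. 1 + \<bar>x $ i\<bar>)" if "finite I" for I
    using that
  proof (induction I)
    case (insert i I)
    have "1 + (\<bar>x $ i\<bar> + (\<Sum>i\<in>I. \<bar>x $ i\<bar>)) \<le> (1 + \<bar>x $ i\<bar>) * (1 + (\<Sum>i\<in>I. \<bar>x $ i\<bar>))"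
      by (simp add: algebra_simps sum_nonneg)
    also have "\<dots> \<le> (1 + \<bar>x $ i\<bar>) * (\<Prod>i\<in>I. 1 + \<bar>x $ i\<bar>)"
      using insert by (intro mult_left_mono) auto
    finally show ?case using insert by simp
  qed simp
  from this[of UNIV] show ?thesis using norm_le_l1_cart[of x] by simp
qed

lemma cis_sum: "cis (\<Sum>i\<in>I. f i) = (\<Prod>i\<in>I. cis (f i))"
  by (induction I rule: infinite_finite_induct) (auto simp: cis_mult[symmetric])

text \<open>If the transform of G is a function chi equal to one on the ball, then f = chi f, and
  multiplication by chi becomes convolution with G on the Fourier side. The formula expresses this
  without chi.\<close>

definition reproduces :: "real \<Rightarrow> (real^'n \<Rightarrow> real) \<Rightarrow> bool" where
  "reproduces R G \<longleftrightarrow> (\<forall>f \<xi>. integrable lborel f \<longrightarrow> (\<forall>x. norm x > R \<longrightarrow> f x = 0) \<longrightarrow>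
     fourier f \<xi> = (LINT \<eta>|lborel. of_real (G (\<eta> - \<xi>)) * fourier f \<eta>))"

text \<open>G is a tensor product of band kernels, so its transform is one on the cube of half-side
  R, which contains the ball of radius R. Inserting the definition of \<open>fourier f\<close> and
  exchanging the integrals brings out this transform as a factor of f.\<close>

lemma reproducing_kernel:
  fixes R :: real
  assumes "R \<ge> 0"
  obtains G :: "real^'n \<Rightarrow> real" and C where "continuous_on UNIV G"
    and "\<And>\<tau>. \<bar>G \<tau>\<bar> \<le> C * inverse ((1 + norm \<tau>) ^ N)"
    and "reproduces R G"
proof -
  obtain g where g: "band_kernel R N g" using band_kernel_exists[OF assms] by blast
  then obtain c where c: "\<And>t. \<bar>g t\<bar> * ((1 + \<bar>t\<bar>) ^ N * (1 + t\<^sup>2)) \<le> c"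
    by (auto simp: band_kernel_def)
  have gc: "continuous_on UNIV g" using g by (simp add: band_kernel_def)
  define G :: "real^'n \<Rightarrow> real" where "G \<tau> = (\<Prod>i\<in>UNIV. g (\<tau> $ i))" for \<tau>
  have Gc: "continuous_on UNIV G"
    unfolding G_def by (intro continuous_intros continuous_on_compose2[OF gc]) auto
  have Gi: "integrable lborel G"
    unfolding G_def by (intro integrable_vec_prod band_kernel_integrable[OF g])
  have [measurable]: "G \<in> borel_measurable borel" using Gc by (rule borel_measurable_continuous_onI)
  have bound: "\<bar>G \<tau>\<bar> \<le> c ^ CARD('n) * inverse ((1 + norm \<tau>) ^ N)" for \<tau>
  proof -
    have g_le: "\<bar>g t\<bar> * (1 + \<bar>t\<bar>) ^ N \<le> c" for t
    proof -
      have "\<bar>g t\<bar> * ((1 + \<bar>t\<bar>) ^ N * 1) \<le> \<bar>g t\<bar> * ((1 + \<bar>t\<bar>) ^ N * (1 + t\<^sup>2))"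
        by (intro mult_left_mono) auto
      then show ?thesis using c[of t] by simp
    qed
    have "\<bar>G \<tau>\<bar> * (1 + norm \<tau>) ^ N \<le> \<bar>G \<tau>\<bar> * (\<Prod>i\<in>UNIV. 1 + \<bar>\<tau> $ i\<bar>) ^ N"
      by (intro mult_left_mono power_mono one_plus_norm_le_prod) auto
    also have "\<dots> = (\<Prod>i\<in>UNIV. \<bar>g (\<tau> $ i)\<bar> * (1 + \<bar>\<tau> $ i\<bar>) ^ N)"
      by (simp add: G_def abs_prod prod.distrib prod_power_distrib)
    also have "\<dots> \<le> (\<Prod>i\<in>(UNIV::'n set). c)"
      by (intro prod_mono conjI g_le) auto
    finally show ?thesis
      by (simp add: divide_inverse[symmetric] pos_le_divide_eq zero_less_power add_pos_nonneg)
  qed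
  have cis1: "(LINT \<tau>|lborel. cis (- (x \<bullet> \<tau>)) * of_real (G \<tau>)) = 1" if "norm x \<le> R" for x
  proof -
    have x: "\<bar>x $ i\<bar> \<le> R" for i using component_le_norm_cart[of x i] that by linarith
    have "(LINT \<tau>|lborel. cis (- (x \<bullet> \<tau>)) * of_real (G \<tau>)) =
        (LINT \<tau>|lborel. (\<Prod>i\<in>UNIV. cis (- (x $ i * \<tau> $ i)) * of_real (g (\<tau> $ i))))"
      by (simp add: G_def inner_vec_def cis_sum prod.distrib flip: sum_negf)
    also have "\<dots> = (\<Prod>i\<in>UNIV. (LINT t|lborel. cis (- (x $ i * t)) * of_real (g t)))"
      by (intro integrable_vec_prod(2) band_kernel_cis(1)[OF g x])
    finally show ?thesis by (simp add: band_kernel_cis(2)[OF g x])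
  qed
  have "fourier f \<xi> = (LINT \<eta>|lborel. of_real (G (\<eta> - \<xi>)) * fourier f \<eta>)"
    if f: "integrable lborel f" and supp: "\<And>x. norm x > R \<Longrightarrow> f x = 0" for f \<xi>
  proof -
    have "integrable (distr lborel borel ((+) (- \<xi>))) G"
      using Gi by (simp add: lborel_distr_plus)
    then have Gi': "integrable lborel (\<lambda>\<eta>. G (\<eta> - \<xi>))"
      by (subst (asm) integrable_distr_eq) simp_all
    have "integrable (lborel \<Otimes>\<^sub>M lborel) (\<lambda>z::(real^'n) \<times> (real^'n).
        cis (- (fst z \<bullet> snd z)) * (f (fst z) * of_real (G (snd z - \<xi>))))"
      by (intro integrable_pair_bounded f integrable_of_real Gi') auto
    then have int: "integrable (lborel \<Otimes>\<^sub>M lborel)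
        (\<lambda>(x, \<eta>). of_real (G (\<eta> - \<xi>)) * (cis (- (x \<bullet> \<eta>)) * f x))"
      by (simp add: case_prod_unfold mult_ac)
    have "(LINT \<eta>|lborel. of_real (G (\<eta> - \<xi>)) * fourier f \<eta>) =
        (LINT \<eta>|lborel. LINT x|lborel. of_real (G (\<eta> - \<xi>)) * (cis (- (x \<bullet> \<eta>)) * f x))"
      unfolding fourier_def by simp
    also have "\<dots> = (LINT x|lborel. LINT \<eta>|lborel. of_real (G (\<eta> - \<xi>)) * (cis (- (x \<bullet> \<eta>)) * f x))"
      using lborel_pair.Fubini_integral[OF int] by simp
    \<comment> \<open>The substitution \<eta> = \<xi> + \<tau> splits off the exponential at \<xi>
      and leaves the transform of G at x, which is one on the ball; off the ball f vanishes.\<close>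
    also have "\<dots> = (LINT x|lborel. cis (- (x \<bullet> \<xi>)) * f x)"
    proof (rule Bochner_Integration.integral_cong[OF refl])
      fix x
      show "(LINT \<eta>|lborel. of_real (G (\<eta> - \<xi>)) * (cis (- (x \<bullet> \<eta>)) * f x)) = cis (- (x \<bullet> \<xi>)) * f x"
      proof (cases "norm x \<le> R")
        case True
        have "(LINT \<eta>|lborel. of_real (G (\<eta> - \<xi>)) * (cis (- (x \<bullet> \<eta>)) * f x)) =
          (LINT \<eta>|distr lborel borel ((+) \<xi>). of_real (G (\<eta> - \<xi>)) * (cis (- (x \<bullet> \<eta>)) * f x))"
          by (simp add: lborel_distr_plus)
        also have "\<dots> = (LINT \<tau>|lborel. of_real (G \<tau>) * (cis (- (x \<bullet> (\<xi> + \<tau>))) * f x))"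
          by (subst integral_distr) simp_all
        also have "\<dots> = (LINT \<tau>|lborel. cis (- (x \<bullet> \<xi>)) * f x * (cis (- (x \<bullet> \<tau>)) * of_real (G \<tau>)))"
        proof (intro Bochner_Integration.integral_cong refl)
          fix \<tau>
          have "cis (- (x \<bullet> (\<xi> + \<tau>))) = cis (- (x \<bullet> \<xi>)) * cis (- (x \<bullet> \<tau>))"
            by (simp add: cis_mult inner_add_right)
          then show "of_real (G \<tau>) * (cis (- (x \<bullet> (\<xi> + \<tau>))) * f x) =
              cis (- (x \<bullet> \<xi>)) * f x * (cis (- (x \<bullet> \<tau>)) * of_real (G \<tau>))"
            by simp
        qed
        finally show ?thesis by (simp add: cis1[OF True])
      qed (simp add: supp)
    qed
    finally show ?thesis by (simp add: fourier_def)
  qed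
  then have "reproduces R G" unfolding reproduces_def by blast
  with Gc bound that show ?thesis by blast
qed

section \<open>Slowly varying weights\<close>

lemma class_M_inverse:
  assumes "\<phi> \<in> class_M"
  shows "(\<lambda>t. 1 / \<phi> t) \<in> class_M"
proof -
  have "((\<lambda>t. (1 / \<phi> (c * t)) / (1 / \<phi> t)) \<longlongrightarrow> 1) at_top" if "c > 0" for c
  proof -
    have "((\<lambda>t. inverse (\<phi> (c * t) / \<phi> t)) \<longlongrightarrow> inverse 1) at_top"
      using assms that by (intro tendsto_inverse) (auto simp: class_M_def)
    then show ?thesis by (simp add: field_simps)
  qed
  then show ?thesis using assms by (auto simp: class_M_def)
qed

text \<open>Beyond some t0 doubling the argument multiplies \<open>\<phi>\<close> by at most 2^e,
  which is exactly the growth of t^e; boundedness on [1, 2 t0] provides the constant.\<close>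

lemma class_M_le_powr:
  assumes "\<phi> \<in> class_M" "e > 0"
  obtains C where "C > 0" "\<And>t. t \<ge> 1 \<Longrightarrow> \<phi> t \<le> C * t powr e"
proof -
  have pos: "\<phi> t > 0" if "t \<ge> 1" for t using assms(1) that by (auto simp: class_M_def)
  have "((\<lambda>t. \<phi> (2 * t) / \<phi> t) \<longlongrightarrow> 1) at_top"
    using assms(1) by (auto simp: class_M_def)
  then have "\<forall>\<^sub>F t in at_top. \<phi> (2 * t) / \<phi> t < 2 powr e"
    by (rule order_tendstoD) (use assms(2) in simp)
  then obtain t1 where t1: "\<And>t. t \<ge> t1 \<Longrightarrow> \<phi> (2 * t) / \<phi> t < 2 powr e"
    by (auto simp: eventually_at_top_linorder)
  define t0 where "t0 = max t1 1"
  have t0: "t0 \<ge> 1" and dbl: "\<phi> (2 * t) \<le> 2 powr e * \<phi> t" if "t \<ge> t0" for t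
    using t1[of t] pos[of t] that by (auto simp: t0_def pos_divide_less_eq)
  have t01: "t0 \<ge> 1" by (simp add: t0_def)
  have "bounded (\<phi> ` {1..2 * t0})"
    using assms(1) t01 by (auto simp: class_M_def)
  then obtain B where "\<forall>t\<in>{1..2 * t0}. \<bar>\<phi> t\<bar> \<le> B"
    by (auto simp: bounded_iff)
  then have B: "\<And>t. 1 \<le> t \<Longrightarrow> t \<le> 2 * t0 \<Longrightarrow> \<bar>\<phi> t\<bar> \<le> B"
    by simp
  have "B > 0" using B[of 1] pos[of 1] t01 by auto
  \<comment> \<open>Induction on the number of doublings. The base case reaches up to 2 t0, so that
    any later t satisfies t / 2 >= t0 and the doubling estimate applies at t / 2.\<close>
  have "\<phi> t \<le> B * t powr e" if "1 \<le> t" "t \<le> 2 ^ Suc n * t0" for t n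
    using that
  proof (induction n arbitrary: t)
    case 0
    have "B * 1 \<le> B * t powr e"
      using \<open>B > 0\<close> 0 assms(2) by (intro mult_left_mono ge_one_powr_ge_zero) auto
    then show ?case using B[of t] 0 by auto
  next
    case (Suc n)
    show ?case
    proof (cases "t \<le> 2 ^ Suc n * t0")
      case False
      have "1 * t0 \<le> 2 ^ n * t0" using t01 by (intro mult_right_mono) auto
      then have t: "t / 2 \<ge> t0" using False by simp
      then have "\<phi> t \<le> 2 powr e * \<phi> (t / 2)" using dbl[of "t / 2"] by simp
      also have "\<dots> \<le> 2 powr e * (B * (t / 2) powr e)"
        using Suc.prems t t01 by (intro mult_left_mono Suc.IH) auto
      also have "\<dots> = B * t powr e"
        using Suc.prems by (simp add: powr_divide)
      finally show ?thesis .
    qed (use Suc in auto)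
  qed
  moreover have "\<exists>n. t \<le> 2 ^ Suc n * t0" for t
  proof -
    obtain n where "t < 2 ^ n" using real_arch_pow[of 2 t] by auto
    moreover have "(2::real) ^ n * 1 \<le> 2 ^ Suc n * t0"
      using t01 by (intro mult_mono) auto
    ultimately show ?thesis by (metis less_eq_real_def mult.right_neutral order_trans)
  qed
  ultimately show ?thesis using that \<open>B > 0\<close> by blast
qed

section \<open>The weight on the frequency side and its polynomial bounds\<close>

definition weight :: "real \<Rightarrow> (real \<Rightarrow> real) \<Rightarrow> real^'n \<Rightarrow> real" where
  "weight s \<phi> \<xi> = japanese_bracket \<xi> powr (2 * s) * (\<phi> (japanese_bracket \<xi>))\<^sup>2"

lemma weighted_square_eq: "weighted_square s \<phi> g \<xi> = weight s \<phi> \<xi> * (cmod (g \<xi>))\<^sup>2"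
  by (simp add: weighted_square_def weight_def)

lemma japanese_bracket_ge_1: "japanese_bracket \<xi> \<ge> 1"
  by (simp add: japanese_bracket_def)

lemma norm_le_japanese_bracket: "norm \<xi> \<le> japanese_bracket \<xi>"
  unfolding japanese_bracket_def by (rule real_le_rsqrt) simp

lemma japanese_bracket_le: "japanese_bracket \<xi> \<le> 1 + norm \<xi>"
  unfolding japanese_bracket_def by (rule real_le_lsqrt) (auto simp: power2_sum)

lemma japanese_bracket_measurable [measurable]:
  "japanese_bracket \<in> borel_measurable (borel :: 'a::{real_normed_vector, second_countable_topology} measure)"
  unfolding japanese_bracket_def[abs_def] by measurable

lemma weight_pos: "\<phi> \<in> class_M \<Longrightarrow> weight s \<phi> \<xi> > 0"
  using japanese_bracket_ge_1[of \<xi>] by (auto simp: weight_def class_M_def)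

lemma weight_measurable:
  assumes "\<phi> \<in> class_M"
  shows "(weight s \<phi> :: real^'n \<Rightarrow> real) \<in> borel_measurable borel"
proof -
  have "\<phi> \<in> borel_measurable (restrict_space borel {1..})"
    using assms by (simp add: class_M_def)
  moreover have "(japanese_bracket :: real^'n \<Rightarrow> real) \<in> borel \<rightarrow>\<^sub>M restrict_space borel {1..}"
    by (rule measurable_restrict_space2) (auto simp: japanese_bracket_ge_1)
  ultimately have [measurable]: "(\<lambda>\<xi>::real^'n. \<phi> (japanese_bracket \<xi>)) \<in> borel_measurable borel"
    using measurable_compose by blast
  show ?thesis unfolding weight_def[abs_def] by measurable
qed

text \<open>The reciprocal of a weight belongs to the same family, so that upper bounds for weights
  also yield lower bounds.\<close>

lemma weight_inverse: "inverse (weight s \<phi> \<xi>) = weight (- s) (\<lambda>t. 1 / \<phi> t) \<xi>"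
  by (simp add: weight_def powr_minus power_divide divide_inverse power_inverse)

lemma weight_le_power:
  assumes "\<phi> \<in> class_M"
  obtains C N where "C > 0" "\<And>\<xi>::real^'n. weight s \<phi> \<xi> \<le> C * (1 + norm \<xi>) ^ N"
proof -
  obtain C where C: "C > 0" "\<And>t. t \<ge> 1 \<Longrightarrow> \<phi> t \<le> C * t powr 1"
    using class_M_le_powr[OF assms, of 1] by auto
  \<comment> \<open>Squaring the bound \<phi> <= C t adds 2 to the exponent 2 s.\<close>
  obtain N where N: "2 * s + 2 \<le> real N" using real_arch_simple by blast
  have "weight s \<phi> \<xi> \<le> C\<^sup>2 * (1 + norm \<xi>) ^ N" for \<xi> :: "real^'n"
  proof -
    define t where "t = japanese_bracket \<xi>"
    have t: "t \<ge> 1" "t \<le> 1 + norm \<xi>"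
      using japanese_bracket_ge_1 japanese_bracket_le by (auto simp: t_def)
    have "\<phi> t \<ge> 0" using assms t by (auto simp: class_M_def intro: less_imp_le)
    then have "(\<phi> t)\<^sup>2 \<le> (C * t powr 1)\<^sup>2" using C(2) t by (intro power_mono) auto
    then have "weight s \<phi> \<xi> \<le> t powr (2 * s) * (C * t powr 1)\<^sup>2"
      unfolding weight_def t_def[symmetric] by (intro mult_left_mono) auto
    also have "\<dots> = C\<^sup>2 * t powr (2 * s + 2)"
      using t by (simp add: power_mult_distrib powr_add)
    also have "\<dots> \<le> C\<^sup>2 * t powr real N"
      using t N by (intro mult_left_mono powr_mono) auto
    also have "\<dots> = C\<^sup>2 * t ^ N" using t by (simp add: powr_realpow)
    also have "\<dots> \<le> C\<^sup>2 * (1 + norm \<xi>) ^ N"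
      using t by (intro mult_left_mono power_mono) auto
    finally show ?thesis .
  qed
  then show ?thesis using that C(1) by (metis zero_less_power)
qed

text \<open>The factors \<open>\<phi>\<close> and 1 / \<open>\<psi>\<close> cost t^(\<epsilon>/4)
  each, which is t^\<epsilon> after squaring, while raising s by \<epsilon> gains t^(2 \<epsilon>).
  The factor t^(-\<epsilon>) remains.\<close>

lemma weight_gain:
  assumes "\<phi> \<in> class_M" "\<psi> \<in> class_M" "\<epsilon> > 0"
  obtains K where "K > 0"
    "\<And>\<xi>::real^'n. weight s \<phi> \<xi> \<le> K * japanese_bracket \<xi> powr (- \<epsilon>) * weight (s + \<epsilon>) \<psi> \<xi>"
proof -
  obtain C where C: "C > 0" "\<And>t. t \<ge> 1 \<Longrightarrow> \<phi> t \<le> C * t powr (\<epsilon> / 4)"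
    using class_M_le_powr[OF assms(1), of "\<epsilon> / 4"] assms(3) by auto
  obtain D where D: "D > 0" "\<And>t. t \<ge> 1 \<Longrightarrow> 1 / \<psi> t \<le> D * t powr (\<epsilon> / 4)"
    using class_M_le_powr[OF class_M_inverse[OF assms(2)], of "\<epsilon> / 4"] assms(3) by auto
  have "weight s \<phi> \<xi> \<le> (C * D)\<^sup>2 * japanese_bracket \<xi> powr (- \<epsilon>) * weight (s + \<epsilon>) \<psi> \<xi>" for \<xi> :: "real^'n"
  proof -
    define t where "t = japanese_bracket \<xi>"
    have t: "t \<ge> 1" using japanese_bracket_ge_1 by (auto simp: t_def)
    have pos: "\<phi> t > 0" "\<psi> t > 0" using assms t by (auto simp: class_M_def)
    have "\<phi> t * (1 / \<psi> t) \<le> (C * t powr (\<epsilon> / 4)) * (D * t powr (\<epsilon> / 4))"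
      using C D t pos by (intro mult_mono) (auto intro: less_imp_le)
    also have "\<dots> = C * D * t powr (\<epsilon> / 2)"
      using t by (simp add: powr_add[symmetric])
    finally have "\<phi> t \<le> C * D * t powr (\<epsilon> / 2) * \<psi> t"
      using pos by (simp add: field_simps)
    then have "(\<phi> t)\<^sup>2 \<le> (C * D * t powr (\<epsilon> / 2) * \<psi> t)\<^sup>2"
      using pos by (intro power_mono) auto
    also have "\<dots> = (C * D)\<^sup>2 * t powr \<epsilon> * (\<psi> t)\<^sup>2"
      by (simp add: power_mult_distrib powr_add[symmetric] power2_eq_square[of "t powr _"])
    finally have "t powr (2 * s) * (\<phi> t)\<^sup>2 \<le> t powr (2 * s) * ((C * D)\<^sup>2 * t powr \<epsilon> * (\<psi> t)\<^sup>2)"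
      by (intro mult_left_mono) auto
    also have "\<dots> = (C * D)\<^sup>2 * t powr (- \<epsilon>) * (t powr (2 * (s + \<epsilon>)) * (\<psi> t)\<^sup>2)"
    proof -
      have "t powr (2 * s) * t powr \<epsilon> = t powr (- \<epsilon>) * t powr (2 * (s + \<epsilon>))"
        by (simp add: powr_add[symmetric] add.commute)
      then show ?thesis by (simp add: mult_ac)
    qed
    finally show ?thesis unfolding weight_def t_def .
  qed
  then show ?thesis using that C(1) D(1) by (metis mult_pos_pos zero_less_power)
qed

section \<open>The energy of a compactly supported smooth function\<close>

text \<open>The support bound R is a parameter because the reproducing kernel depends on it: all
  members of a sequence have to share it.\<close>

definition bump_on :: "real \<Rightarrow> (real^'n \<Rightarrow> complex) \<Rightarrow> bool" where
  "bump_on R f \<longleftrightarrow> smooth_on UNIV f \<and> (\<forall>x. norm x > R \<longrightarrow> f x = 0)"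

abbreviation energy_density ::
    "real \<Rightarrow> (real \<Rightarrow> real) \<Rightarrow> (real^'n \<Rightarrow> complex) \<Rightarrow> real^'n \<Rightarrow> real" where
  "energy_density s \<phi> f \<xi> \<equiv> weight s \<phi> \<xi> * (cmod (fourier f \<xi>))\<^sup>2"

definition energy :: "real \<Rightarrow> (real \<Rightarrow> real) \<Rightarrow> (real^'n \<Rightarrow> complex) \<Rightarrow> real" where
  "energy s \<phi> f = (LINT \<xi>|lborel. energy_density s \<phi> f \<xi>)"

lemma bump_on_integrable: "bump_on R f \<Longrightarrow> integrable lborel f"
  by (rule integrable_if_continuous_support[of f R]) (auto simp: bump_on_def intro: smooth_on_imp_continuous_on)

lemma bump_on_diff:
  assumes "bump_on R f" "bump_on R g"
  shows "bump_on R (\<lambda>x. f x - g x)"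
proof -
  have "smooth_on UNIV (\<lambda>x. f x + (- 1) * g x)"
    using assms by (intro smooth_on_add smooth_on_linear[OF _ bounded_linear_mult_right]) (auto simp: bump_on_def)
  then show ?thesis using assms by (simp add: bump_on_def)
qed

lemma fourier_diff:
  assumes "integrable lborel f" "integrable lborel g"
  shows "fourier (\<lambda>x. f x - g x) \<xi> = fourier f \<xi> - fourier g \<xi>"
  unfolding fourier_def using integrable_cis_mult[OF assms(1)] integrable_cis_mult[OF assms(2)]
  by (simp add: right_diff_distrib)

lemma energy_integrable:
  fixes f :: "real^'n \<Rightarrow> complex"
  assumes "\<phi> \<in> class_M" "bump_on R f"
  shows "integrable lborel (\<lambda>\<xi>. energy_density s \<phi> f \<xi>)"
proof -
  obtain C N where C: "C > 0" "\<And>\<xi>::real^'n. weight s \<phi> \<xi> \<le> C * (1 + norm \<xi>) ^ N"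
    using weight_le_power[OF assms(1)] by metis
  \<comment> \<open>N powers absorb the growth of the weight, the remaining 2 n make the majorant
    integrable.\<close>
  define k where "k = N + 2 * CARD('n)"
  obtain D where D: "\<And>\<xi>. (1 + norm \<xi>) ^ k * cmod (fourier f \<xi>) \<le> D"
    using fourier_rapid_decay[of f R k] assms(2) by (auto simp: bump_on_def)
  have [measurable]: "fourier f \<in> borel_measurable borel" "(weight s \<phi> :: real^'n \<Rightarrow> real) \<in> borel_measurable borel"
    using fourier_measurable bump_on_integrable assms weight_measurable by auto
  show ?thesis
  proof (rule Bochner_Integration.integrable_bound)
    show "integrable lborel (\<lambda>\<xi>::real^'n. C * D\<^sup>2 * inverse ((1 + norm \<xi>) ^ (2 * CARD('n))))"
      by (intro integrable_mult_right integrable_inverse_power) auto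
    show "AE \<xi> in lborel. norm (energy_density s \<phi> f \<xi>)
        \<le> norm (C * D\<^sup>2 * inverse ((1 + norm \<xi>) ^ (2 * CARD('n))))"
    proof (rule AE_I2)
      fix \<xi> :: "real^'n"
      define t where "t = 1 + norm \<xi>"
      have t: "t \<ge> 1" by (simp add: t_def)
      have "t ^ N * t ^ (2 * CARD('n)) * (cmod (fourier f \<xi>))\<^sup>2 = t ^ k * (cmod (fourier f \<xi>))\<^sup>2"
        by (simp add: k_def power_add)
      also have "\<dots> \<le> (t ^ k)\<^sup>2 * (cmod (fourier f \<xi>))\<^sup>2"
        using t by (intro mult_right_mono self_le_power one_le_power) auto
      also have "\<dots> \<le> D\<^sup>2"
        unfolding power_mult_distrib[symmetric] using D[of \<xi>] t by (intro power_mono) (auto simp: t_def)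
      finally have *: "t ^ N * (cmod (fourier f \<xi>))\<^sup>2 \<le> D\<^sup>2 * inverse (t ^ (2 * CARD('n)))"
        using t by (simp add: field_simps)
      have "energy_density s \<phi> f \<xi> \<le> C * t ^ N * (cmod (fourier f \<xi>))\<^sup>2"
        using C by (intro mult_right_mono) (auto simp: t_def)
      also have "\<dots> \<le> C * (D\<^sup>2 * inverse (t ^ (2 * CARD('n))))"
        unfolding mult.assoc using C * by (intro mult_left_mono) auto
      finally have "energy_density s \<phi> f \<xi> \<le> C * D\<^sup>2 * inverse (t ^ (2 * CARD('n)))"
        by (simp add: mult.assoc)
      moreover have "weight s \<phi> \<xi> \<ge> 0" using weight_pos[OF assms(1)] less_imp_le by blast
      ultimately show "norm (energy_density s \<phi> f \<xi>)
        \<le> norm (C * D\<^sup>2 * inverse ((1 + norm \<xi>) ^ (2 * CARD('n))))"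
        unfolding t_def using C(1) by (simp add: abs_mult)
    qed
  qed measurable
qed

lemma energy_nonneg: "\<phi> \<in> class_M \<Longrightarrow> energy s \<phi> f \<ge> 0"
  unfolding energy_def
  by (intro integral_nonneg_AE AE_I2 mult_nonneg_nonneg less_imp_le[OF weight_pos]) auto

text \<open>The selected representative of the transform agrees almost everywhere with the explicit
  integral, so from here on the norm is an energy.\<close>

lemma H_norm_regular_square:
  assumes "\<phi> \<in> class_M" "bump_on R f"
  shows "(H_norm s \<phi> (regular_distribution f))\<^sup>2 = energy s \<phi> f"
proof -
  let ?g = "fourier_function (regular_distribution f)"
  have fi: "integrable lborel f" using assms by (rule_tac bump_on_integrable)
  have [measurable]: "fourier f \<in> borel_measurable borel" "?g \<in> borel_measurable borel"
      "(weight s \<phi> :: real^'a \<Rightarrow> real) \<in> borel_measurable borel"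
    using fourier_measurable[OF fi] fourier_function_regular(2)[OF fi] weight_measurable[OF assms(1)] by auto
  have "(LINT \<xi>|lborel. weighted_square s \<phi> ?g \<xi>) = energy s \<phi> f"
    unfolding energy_def weighted_square_eq
    by (rule integral_cong_AE) (use fourier_function_regular(1)[OF fi] in auto)
  then show ?thesis
    unfolding H_norm_def using energy_nonneg[OF assms(1), of s f] by simp
qed

lemma energy_diff_le:
  assumes \<phi>: "\<phi> \<in> class_M" and f: "bump_on R f" and g: "bump_on R g"
  shows "energy s \<phi> (\<lambda>x. f x - g x) \<le> 2 * energy s \<phi> f + 2 * energy s \<phi> g"
proof -
  have "energy s \<phi> (\<lambda>x. f x - g x) \<le> (LINT \<xi>|lborel.
      2 * energy_density s \<phi> f \<xi> + 2 * energy_density s \<phi> g \<xi>)"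
    unfolding energy_def
  proof (intro integral_mono)
    show "integrable lborel (\<lambda>\<xi>. energy_density s \<phi> (\<lambda>x. f x - g x) \<xi>)"
      by (rule energy_integrable[OF \<phi> bump_on_diff[OF f g]])
    fix \<xi>
    have "(cmod (fourier f \<xi> - fourier g \<xi>))\<^sup>2 \<le> (cmod (fourier f \<xi>) + cmod (fourier g \<xi>))\<^sup>2"
      by (intro power_mono norm_triangle_ineq4) auto
    also have "\<dots> \<le> 2 * (cmod (fourier f \<xi>))\<^sup>2 + 2 * (cmod (fourier g \<xi>))\<^sup>2"
      using sum_squares_bound[of "cmod (fourier f \<xi>)" "cmod (fourier g \<xi>)"] by (simp add: power2_sum)
    finally have "weight s \<phi> \<xi> * (cmod (fourier f \<xi> - fourier g \<xi>))\<^sup>2 \<le>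
        weight s \<phi> \<xi> * (2 * (cmod (fourier f \<xi>))\<^sup>2 + 2 * (cmod (fourier g \<xi>))\<^sup>2)"
      using weight_pos[OF \<phi>, of s \<xi>] by (intro mult_left_mono) auto
    then show "energy_density s \<phi> (\<lambda>x. f x - g x) \<xi> \<le>
      2 * energy_density s \<phi> f \<xi> + 2 * energy_density s \<phi> g \<xi>"
      unfolding fourier_diff[OF bump_on_integrable[OF f] bump_on_integrable[OF g]]
      by (simp add: algebra_simps)
  qed (intro Bochner_Integration.integrable_add integrable_mult_right energy_integrable[OF \<phi> f] energy_integrable[OF \<phi> g])
  also have "\<dots> = 2 * energy s \<phi> f + 2 * energy s \<phi> g"
    unfolding energy_def using energy_integrable[OF \<phi> f] energy_integrable[OF \<phi> g] by simp
  finally show ?thesis .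
qed

lemma energy_embedding:
  assumes "\<phi> \<in> class_M" "\<psi> \<in> class_M" "\<epsilon> > 0"
  obtains K where "K > 0"
    "\<And>R f::real^'n \<Rightarrow> complex. bump_on R f \<Longrightarrow> energy s \<phi> f \<le> K * energy (s + \<epsilon>) \<psi> f"
proof -
  obtain K where K: "K > 0" "\<And>\<xi>::real^'n. weight s \<phi> \<xi> \<le> K * japanese_bracket \<xi> powr (- \<epsilon>) * weight (s + \<epsilon>) \<psi> \<xi>"
    using weight_gain[OF assms] by metis
  have K': "weight s \<phi> \<xi> \<le> K * weight (s + \<epsilon>) \<psi> \<xi>" for \<xi> :: "real^'n"
  proof -
    have "japanese_bracket \<xi> powr (- \<epsilon>) \<le> 1"
      using powr_mono[of "- \<epsilon>" 0 "japanese_bracket \<xi>"] japanese_bracket_ge_1[of \<xi>] assms(3) by simp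
    then have "K * japanese_bracket \<xi> powr (- \<epsilon>) * weight (s + \<epsilon>) \<psi> \<xi> \<le> K * 1 * weight (s + \<epsilon>) \<psi> \<xi>"
      using K(1) weight_pos[OF assms(2), of "s + \<epsilon>" \<xi>] by (intro mult_right_mono mult_left_mono) auto
    then show ?thesis using K(2)[of \<xi>] by simp
  qed
  have "energy s \<phi> f \<le> K * energy (s + \<epsilon>) \<psi> f" if f: "bump_on R f" for R and f :: "real^'n \<Rightarrow> complex"
  proof -
    have "energy s \<phi> f \<le> (LINT \<xi>|lborel. K * energy_density (s + \<epsilon>) \<psi> f \<xi>)"
      unfolding energy_def
      using K' by (intro integral_mono integrable_mult_right energy_integrable[OF _ f] assms)
        (auto simp: mult.assoc[symmetric] intro!: mult_right_mono)
    then show ?thesis by (simp add: energy_def)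
  qed
  then show ?thesis using that K(1) by blast
qed

section \<open>Pointwise control of the transform and compactness on the Fourier side\<close>

lemma weight_inverse_le_power:
  assumes "\<phi> \<in> class_M"
  obtains C N where "C > 0" "\<And>\<xi>::real^'n. inverse (weight s \<phi> \<xi>) \<le> C * (1 + norm \<xi>) ^ N"
  using weight_le_power[OF class_M_inverse[OF assms], of "- s"] unfolding weight_inverse[symmetric]
  by blast

text \<open>The reproducing formula and the inequality of the arithmetic and geometric means, applied as
  \<open>2 |G| |F| \<le> G\<^sup>2 / (c w) + c w |F|\<^sup>2\<close> with the weight \<open>w\<close>, bound the Fourier transform pointwise by the energy.\<close>

lemma weighted_AM_GM:
  fixes G F w c :: real
  assumes "w > 0" "c > 0"
  shows "\<bar>G\<bar> * \<bar>F\<bar> \<le> (G\<^sup>2 * inverse w / c + c * (w * F\<^sup>2)) / 2"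
proof -
  have "0 \<le> (\<bar>G\<bar> - c * w * \<bar>F\<bar>)\<^sup>2 * inverse (c * w)"
    using assms by simp
  also have "\<dots> = G\<^sup>2 * inverse w / c + c * (w * F\<^sup>2) - 2 * (\<bar>G\<bar> * \<bar>F\<bar>)"
    using assms by (simp add: power2_diff power_mult_distrib field_simps power2_eq_square)
  finally show ?thesis by simp
qed

text \<open>Both parts estimate the reproducing integral by \<open>weighted_AM_GM\<close>, the first
  with the kernel shifted to \<xi>, the second with the difference of two shifts. The bounds are
  linear in the energy and not in its square root, which is enough for sequences of bounded
  energy.\<close>

lemma fourier_controlled_by_energy:
  fixes R :: real
  assumes \<phi>: "\<phi> \<in> class_M" and "R \<ge> 0"
  shows "\<exists>K. \<forall>f::real^'n \<Rightarrow> complex. bump_on R f \<longrightarrow>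
      (\<forall>\<xi>. norm \<xi> \<le> r \<longrightarrow> cmod (fourier f \<xi>) \<le> K + energy s \<phi> f)"
    and "\<And>\<xi> e. e > 0 \<Longrightarrow> \<exists>d>0. \<forall>f::real^'n \<Rightarrow> complex. bump_on R f \<longrightarrow>
      (\<forall>\<zeta>. norm (\<xi> - \<zeta>) < d \<longrightarrow> cmod (fourier f \<xi> - fourier f \<zeta>) \<le> e * (1 + energy s \<phi> f))"
proof -
  obtain C N where C: "C > 0" "\<And>\<xi>::real^'n. inverse (weight s \<phi> \<xi>) \<le> C * (1 + norm \<xi>) ^ N"
    using weight_inverse_le_power[OF \<phi>] by metis
  \<comment> \<open>In G^2 / w one factor (1 + |\<eta>|)^(-M) offsets the growth of order N of 1/w
    and leaves the integrable power 2 n; the other factor is bounded by 1.\<close>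
  define M where "M = N + 2 * CARD('n)"
  obtain G :: "real^'n \<Rightarrow> real" and D where Gc: "continuous_on UNIV G"
    and D: "\<And>\<tau>. \<bar>G \<tau>\<bar> \<le> D * inverse ((1 + norm \<tau>) ^ M)"
    and G: "reproduces R G"
    using reproducing_kernel[OF \<open>R \<ge> 0\<close>, where N=M] by metis
  have rep: "fourier f \<xi> = (LINT \<eta>|lborel. of_real (G (\<eta> - \<xi>)) * fourier f \<eta>)"
    if "bump_on R f" for f \<xi>
    using G that bump_on_integrable unfolding reproduces_def bump_on_def by blast
  have [measurable]: "G \<in> borel_measurable borel" "(weight s \<phi> :: real^'n \<Rightarrow> real) \<in> borel_measurable borel"
    using Gc weight_measurable[OF \<phi>] by (auto intro: borel_measurable_continuous_onI)
  have w: "weight s \<phi> \<xi> > 0" for \<xi> :: "real^'n" using weight_pos[OF \<phi>] .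
  define A where "A \<rho> = C * D\<^sup>2 * ((1 + \<rho>) ^ M)\<^sup>2" for \<rho>
  define B where "B \<eta> = inverse ((1 + norm \<eta>) ^ (2 * CARD('n)))" for \<eta> :: "real^'n"
  have Bint: "integrable lborel B" unfolding B_def by (intro integrable_inverse_power) simp
  have A0: "A \<rho> \<ge> 0" for \<rho> using C(1) by (simp add: A_def)
  have B0: "B \<eta> \<ge> 0" for \<eta> by (simp add: B_def)
  have GB: "(G (\<eta> - \<xi>))\<^sup>2 * inverse (weight s \<phi> \<eta>) \<le> A \<rho> * B \<eta>" if "norm \<xi> \<le> \<rho>" for \<xi> \<eta> \<rho>
  proof -
    \<comment> \<open>Peetre's inequality moves the decay of G from \<eta> - \<xi> to \<eta>, at the
      cost of a power of 1 + \<rho>. The bound is thus uniform for \<xi> in a ball.\<close>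
    have "1 + norm \<eta> \<le> (1 + norm (\<eta> - \<xi>)) * (1 + norm \<xi>)"
      using norm_triangle_sub[of \<eta> \<xi>] mult_nonneg_nonneg[OF norm_ge_zero[of "\<eta> - \<xi>"] norm_ge_zero[of \<xi>]]
      unfolding distrib_left distrib_right mult_1 mult_1_right by linarith
    also have "\<dots> \<le> (1 + norm (\<eta> - \<xi>)) * (1 + \<rho>)"
      using that by (intro mult_left_mono) auto
    finally have "(1 + norm \<eta>) ^ M \<le> ((1 + norm (\<eta> - \<xi>)) * (1 + \<rho>)) ^ M"
      by (intro power_mono) auto
    moreover have "inverse p \<le> q * inverse r" if "r \<le> p * q" "p > 0" "r > 0" for p q r :: real
      using that by (simp add: field_simps)
    ultimately have "inverse ((1 + norm (\<eta> - \<xi>)) ^ M) \<le> (1 + \<rho>) ^ M * inverse ((1 + norm \<eta>) ^ M)"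
      unfolding power_mult_distrib by (simp add: zero_less_power add_pos_nonneg)
    moreover have "D \<ge> 0" using D[of 0] by simp
    ultimately have "\<bar>G (\<eta> - \<xi>)\<bar> \<le> D * ((1 + \<rho>) ^ M * inverse ((1 + norm \<eta>) ^ M))"
      using D[of "\<eta> - \<xi>"] mult_left_mono by (blast intro: order_trans)
    then have "\<bar>G (\<eta> - \<xi>)\<bar>\<^sup>2 \<le> (D * ((1 + \<rho>) ^ M * inverse ((1 + norm \<eta>) ^ M)))\<^sup>2"
      by (intro power_mono) auto
    then have "(G (\<eta> - \<xi>))\<^sup>2 * inverse (weight s \<phi> \<eta>) \<le>
        (D * ((1 + \<rho>) ^ M * inverse ((1 + norm \<eta>) ^ M)))\<^sup>2 * (C * (1 + norm \<eta>) ^ N)"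
      using C w[of \<eta>] by (intro mult_mono) (auto intro: less_imp_le)
    also have "\<dots> = A \<rho> * (((inverse ((1 + norm \<eta>) ^ M))\<^sup>2 * (1 + norm \<eta>) ^ N))"
      by (simp add: A_def power_mult_distrib)
    also have "\<dots> \<le> A \<rho> * B \<eta>"
    proof (intro mult_left_mono)
      define t where "t = 1 + norm \<eta>"
      have t: "t \<ge> 1" by (simp add: t_def)
      have "inverse (t ^ M) * t ^ N = inverse (t ^ (2 * CARD('n)))"
        using t by (simp add: M_def power_add field_simps)
      moreover have "inverse (t ^ M) \<le> 1" using t by (simp add: inverse_le_1_iff one_le_power)
      ultimately show "(inverse ((1 + norm \<eta>) ^ M))\<^sup>2 * (1 + norm \<eta>) ^ N \<le> B \<eta>"
        using t unfolding B_def t_def[symmetric] power2_eq_square mult.assoc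
        by (simp add: mult_left_le_one_le)
    qed (use C in \<open>auto simp: A_def\<close>)
    finally show ?thesis .
  qed
  have Gint: "integrable lborel (\<lambda>\<eta>. (G (\<eta> - \<xi>))\<^sup>2 * inverse (weight s \<phi> \<eta>))" for \<xi>
    by (rule Bochner_Integration.integrable_bound[OF integrable_mult_right[OF Bint, of "A (norm \<xi>)"]])
      (use GB[of \<xi> "norm \<xi>"] w in \<open>auto intro!: AE_I2 simp: abs_mult less_imp_le A0 B0\<close>)
  have dGB: "(G (\<eta> - \<xi>) - G (\<eta> - \<zeta>))\<^sup>2 * inverse (weight s \<phi> \<eta>) \<le> 4 * A \<rho> * B \<eta>"
    if "norm \<xi> \<le> \<rho>" "norm \<zeta> \<le> \<rho>" for \<xi> \<zeta> \<eta> \<rho>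
  proof -
    have "(a - b)\<^sup>2 \<le> 2 * a\<^sup>2 + 2 * b\<^sup>2" for a b :: real
      using zero_le_power2[of "a + b"] by (simp add: power2_sum power2_diff)
    then have "(G (\<eta> - \<xi>) - G (\<eta> - \<zeta>))\<^sup>2 * inverse (weight s \<phi> \<eta>) \<le>
        (2 * (G (\<eta> - \<xi>))\<^sup>2 + 2 * (G (\<eta> - \<zeta>))\<^sup>2) * inverse (weight s \<phi> \<eta>)"
      using w[of \<eta>] by (intro mult_right_mono) (auto intro: less_imp_le)
    also have "\<dots> \<le> 4 * A \<rho> * B \<eta>"
      using GB[OF that(1), of \<eta>] GB[OF that(2), of \<eta>] by (simp add: distrib_right)
    finally show ?thesis .
  qed
  have dGint: "integrable lborel (\<lambda>\<eta>. (G (\<eta> - \<xi>) - G (\<eta> - \<zeta>))\<^sup>2 * inverse (weight s \<phi> \<eta>))" for \<xi> \<zeta>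
    by (rule Bochner_Integration.integrable_bound[OF integrable_mult_right[OF Bint, of "4 * A (max (norm \<xi>) (norm \<zeta>))"]])
      (use dGB[of \<xi> "max (norm \<xi>) (norm \<zeta>)" \<zeta>] w in \<open>auto intro!: AE_I2 simp: abs_mult less_imp_le A0 B0\<close>)
  \<comment> \<open>Stated for a general kernel k and parameter c: it is used with one shift of G
    and c = 1, and with a difference of two shifts and c = e.\<close>
  have kernel_bound: "integrable lborel (\<lambda>\<eta>. of_real (k \<eta>) * fourier f \<eta>)"
      "cmod (LINT \<eta>|lborel. of_real (k \<eta>) * fourier f \<eta>) \<le>
      ((LINT \<eta>|lborel. (k \<eta>)\<^sup>2 * inverse (weight s \<phi> \<eta>)) / c + c * energy s \<phi> f) / 2"
    if f: "bump_on R f" and c: "c > 0" and k[measurable]: "k \<in> borel_measurable borel"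
      and ki: "integrable lborel (\<lambda>\<eta>. (k \<eta>)\<^sup>2 * inverse (weight s \<phi> \<eta>))" for f :: "real^'n \<Rightarrow> complex" and k c
  proof -
    have [measurable]: "fourier f \<in> borel_measurable borel"
      using fourier_measurable[OF bump_on_integrable[OF f]] .
    let ?rhs = "\<lambda>\<eta>. ((k \<eta>)\<^sup>2 * inverse (weight s \<phi> \<eta>) / c + c * energy_density s \<phi> f \<eta>) / 2"
    have le: "norm (of_real (k \<eta>) * fourier f \<eta>) \<le> ?rhs \<eta>" for \<eta>
      using weighted_AM_GM[OF w c, of "k \<eta>" "cmod (fourier f \<eta>)" \<eta>] by (simp add: norm_mult)
    have ri: "integrable lborel ?rhs"
      by (intro integrable_divide Bochner_Integration.integrable_add integrable_mult_right ki energy_integrable[OF \<phi> f])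
    show int: "integrable lborel (\<lambda>\<eta>. of_real (k \<eta>) * fourier f \<eta>)"
      by (rule Bochner_Integration.integrable_bound[OF ri])
        (use le in \<open>auto intro!: AE_I2 intro: order_trans[OF _ abs_ge_self]\<close>)
    have "cmod (LINT \<eta>|lborel. of_real (k \<eta>) * fourier f \<eta>) \<le> (LINT \<eta>|lborel. ?rhs \<eta>)"
      by (rule order_trans[OF integral_norm_bound integral_mono]) (use int ri le in auto)
    also have "\<dots> = ((LINT \<eta>|lborel. (k \<eta>)\<^sup>2 * inverse (weight s \<phi> \<eta>)) / c + c * energy s \<phi> f) / 2"
      unfolding energy_def using ki energy_integrable[OF \<phi> f, of s] c by simp
    finally show "cmod (LINT \<eta>|lborel. of_real (k \<eta>) * fourier f \<eta>) \<le>
      ((LINT \<eta>|lborel. (k \<eta>)\<^sup>2 * inverse (weight s \<phi> \<eta>)) / c + c * energy s \<phi> f) / 2" .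
  qed
  show "\<exists>K. \<forall>f::real^'n \<Rightarrow> complex. bump_on R f \<longrightarrow>
      (\<forall>\<xi>. norm \<xi> \<le> r \<longrightarrow> cmod (fourier f \<xi>) \<le> K + energy s \<phi> f)"
  proof (intro exI allI impI)
    fix f :: "real^'n \<Rightarrow> complex" and \<xi> :: "real^'n"
    assume f: "bump_on R f" and \<xi>: "norm \<xi> \<le> r"
    have "cmod (fourier f \<xi>) = cmod (LINT \<eta>|lborel. of_real (G (\<eta> - \<xi>)) * fourier f \<eta>)"
      by (rule arg_cong[OF rep[OF f]])
    also have "\<dots> \<le> ((LINT \<eta>|lborel. (G (\<eta> - \<xi>))\<^sup>2 * inverse (weight s \<phi> \<eta>)) / 1 + 1 * energy s \<phi> f) / 2"
      by (rule kernel_bound(2)[OF f]) (use Gint in auto)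
    also have "(LINT \<eta>|lborel. (G (\<eta> - \<xi>))\<^sup>2 * inverse (weight s \<phi> \<eta>)) \<le> (LINT \<eta>|lborel. A r * B \<eta>)"
      by (intro integral_mono Gint integrable_mult_right Bint GB \<xi>)
    finally show "cmod (fourier f \<xi>) \<le> (LINT \<eta>|lborel. A r * B \<eta>) / 2 + energy s \<phi> f"
      using energy_nonneg[OF \<phi>, of s f] by (simp add: add_divide_distrib)
  qed
  fix \<xi> :: "real^'n" and e :: real assume e: "e > 0"
  \<comment> \<open>The squared L^2 distance of the two shifted kernels with respect to 1/w. It
    tends to 0 by continuity of G, with \<open>dGB\<close> as the majorant for shifts in a
    ball.\<close>
  define \<Phi> where "\<Phi> \<zeta> = (LINT \<eta>|lborel. (G (\<eta> - \<xi>) - G (\<eta> - \<zeta>))\<^sup>2 * inverse (weight s \<phi> \<eta>))" for \<zeta>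
  have "(\<Phi> \<longlongrightarrow> 0) (at \<xi>)"
    unfolding tendsto_at_iff_sequentially
  proof (intro allI impI)
    fix X :: "nat \<Rightarrow> real^'n" assume X: "X \<longlonglongrightarrow> \<xi>"
    have "bounded (range X)" using X by (rule convergent_imp_bounded)
    then obtain \<rho>1 where "\<forall>n. norm (X n) \<le> \<rho>1" by (auto simp: bounded_iff)
    then obtain \<rho> where \<rho>: "\<And>n. norm (X n) \<le> \<rho>" "norm \<xi> \<le> \<rho>"
      by (meson max.cobounded1 max.cobounded2 order_trans)
    have "(\<lambda>n. \<Phi> (X n)) \<longlonglongrightarrow> (LINT \<eta>::real^'n|lborel. (0::real))"
      unfolding \<Phi>_def
    proof (rule integral_dominated_convergence[where w="\<lambda>\<eta>. 4 * A \<rho> * B \<eta>"])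
      show "integrable lborel (\<lambda>\<eta>. 4 * A \<rho> * B \<eta>)" using Bint by (rule integrable_mult_right)
      show "AE \<eta> in lborel. (\<lambda>n. (G (\<eta> - \<xi>) - G (\<eta> - X n))\<^sup>2 * inverse (weight s \<phi> \<eta>)) \<longlonglongrightarrow> 0"
      proof (rule AE_I2)
        fix \<eta> :: "real^'n"
        have "(\<lambda>n. G (\<eta> - X n)) \<longlonglongrightarrow> G (\<eta> - \<xi>)"
          using X Gc by (intro continuous_on_tendsto_compose[OF Gc] tendsto_intros) auto
        then have "(\<lambda>n. (G (\<eta> - \<xi>) - G (\<eta> - X n))\<^sup>2 * inverse (weight s \<phi> \<eta>)) \<longlonglongrightarrow>
          (G (\<eta> - \<xi>) - G (\<eta> - \<xi>))\<^sup>2 * inverse (weight s \<phi> \<eta>)"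
          by (intro tendsto_intros)
        then show "(\<lambda>n. (G (\<eta> - \<xi>) - G (\<eta> - X n))\<^sup>2 * inverse (weight s \<phi> \<eta>)) \<longlonglongrightarrow> 0" by simp
      qed
      show "AE \<eta> in lborel. norm ((G (\<eta> - \<xi>) - G (\<eta> - X n))\<^sup>2 * inverse (weight s \<phi> \<eta>)) \<le> 4 * A \<rho> * B \<eta>" for n
        using dGB[OF \<rho>(2) \<rho>(1)] w by (auto intro!: AE_I2 simp: abs_mult less_imp_le)
    qed measurable
    then show "(\<Phi> \<circ> X) \<longlonglongrightarrow> 0" by (simp add: o_def)
  qed
  then have "\<forall>\<^sub>F \<zeta> in at \<xi>. dist (\<Phi> \<zeta>) 0 < e\<^sup>2"
    by (rule tendstoD) (use e in simp)
  then obtain d where d: "d > 0" "\<And>\<zeta>. \<zeta> \<noteq> \<xi> \<Longrightarrow> dist \<zeta> \<xi> < d \<Longrightarrow> dist (\<Phi> \<zeta>) 0 < e\<^sup>2"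
    unfolding eventually_at by blast
  show "\<exists>d>0. \<forall>f::real^'n \<Rightarrow> complex. bump_on R f \<longrightarrow>
      (\<forall>\<zeta>. norm (\<xi> - \<zeta>) < d \<longrightarrow> cmod (fourier f \<xi> - fourier f \<zeta>) \<le> e * (1 + energy s \<phi> f))"
  proof (intro exI[of _ d] conjI allI impI d(1))
    fix f :: "real^'n \<Rightarrow> complex" and \<zeta> :: "real^'n"
    assume f: "bump_on R f" and \<zeta>: "norm (\<xi> - \<zeta>) < d"
    have \<Phi>: "\<Phi> \<zeta> \<le> e\<^sup>2"
      using d(2)[of \<zeta>] \<zeta> e by (cases "\<zeta> = \<xi>") (auto simp: dist_norm norm_minus_commute \<Phi>_def)
    have G1: "integrable lborel (\<lambda>\<eta>. of_real (G (\<eta> - \<xi>)) * fourier f \<eta>)" for \<xi>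
      by (rule kernel_bound(1)[OF f zero_less_one _ Gint]) measurable
    have "fourier f \<xi> - fourier f \<zeta> = (LINT \<eta>|lborel. of_real (G (\<eta> - \<xi>)) * fourier f \<eta>) -
        (LINT \<eta>|lborel. of_real (G (\<eta> - \<zeta>)) * fourier f \<eta>)"
      by (rule arg_cong2[OF rep[OF f] rep[OF f]])
    also have "\<dots> = (LINT \<eta>|lborel. of_real (G (\<eta> - \<xi>) - G (\<eta> - \<zeta>)) * fourier f \<eta>)"
      using G1 by (simp add: left_diff_distrib)
    \<comment> \<open>The parameter c = e balances the two terms: \<Phi> \<zeta> <= e^2 is divided
      by e, and the energy is multiplied by e.\<close>
    finally have "cmod (fourier f \<xi> - fourier f \<zeta>) \<le> (\<Phi> \<zeta> / e + e * energy s \<phi> f) / 2"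
      using kernel_bound(2)[OF f e _ dGint, of \<xi> \<zeta>] by (simp add: \<Phi>_def)
    also have "\<dots> \<le> (e\<^sup>2 / e + e * energy s \<phi> f) / 2"
      using \<Phi> e by (intro divide_right_mono add_right_mono) auto
    also have "\<dots> \<le> e * (1 + energy s \<phi> f)"
      using e energy_nonneg[OF \<phi>, of s f] by (simp add: power2_eq_square distrib_left)
    finally show "cmod (fourier f \<xi> - fourier f \<zeta>) \<le> e * (1 + energy s \<phi> f)" .
  qed
qed

lemma fourier_uniform_subsequence:
  fixes f :: "nat \<Rightarrow> real^'n \<Rightarrow> complex"
  assumes \<phi>: "\<phi> \<in> class_M" and R: "R \<ge> 0" and f: "\<And>n. bump_on R (f n)"
    and M: "\<And>n. energy s \<phi> (f n) \<le> M"
  shows "\<exists>r. strict_mono (r :: nat \<Rightarrow> nat) \<and> (\<forall>k::nat. \<forall>e>0. \<exists>N. \<forall>i\<ge>N. \<forall>j\<ge>N. \<forall>\<xi>.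
      norm \<xi> \<le> real k \<longrightarrow> cmod (fourier (f (r i)) \<xi> - fourier (f (r j)) \<xi>) < e)"
proof -
  define P where "P k s \<longleftrightarrow> (\<forall>e>0. \<exists>N. \<forall>i\<ge>N. \<forall>j\<ge>N. \<forall>\<xi>.
      norm \<xi> \<le> real k \<longrightarrow> cmod (fourier (f (s i)) \<xi> - fourier (f (s j)) \<xi>) < e)"
    for k :: nat and s :: "nat \<Rightarrow> nat"
  have M0: "M \<ge> 0" using M[of 0] energy_nonneg[OF \<phi>, of s "f 0"] by linarith
  have sub: "\<exists>r'. strict_mono r' \<and> P n (q \<circ> r')" for n and q :: "nat \<Rightarrow> nat"
  proof -
    obtain K where K: "\<And>h \<xi>. bump_on R h \<Longrightarrow> norm \<xi> \<le> real n \<Longrightarrow> cmod (fourier (h :: real^'n \<Rightarrow> complex) \<xi>) \<le> K + energy s \<phi> h"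
      using fourier_controlled_by_energy(1)[OF \<phi> R, of "real n" s] by blast
    obtain g k where k: "strict_mono (k :: nat \<Rightarrow> nat)"
      and lim: "\<And>e. 0 < e \<Longrightarrow> \<exists>N. \<forall>i x. i \<ge> N \<and> x \<in> cball 0 (real n) \<longrightarrow> norm (fourier (f (q (k i))) x - g x) < e"
    proof (rule Arzela_Ascoli[of "cball 0 (real n)" "\<lambda>i. fourier (f (q i))" "K + M"])
      show "norm (fourier (f (q i)) x) \<le> K + M" if "x \<in> cball 0 (real n)" for i x
        using K[OF f, of x "q i"] M[of "q i"] that by simp
      show "\<exists>d>0. \<forall>i y. y \<in> cball 0 (real n) \<and> norm (x - y) < d \<longrightarrow>
          norm (fourier (f (q i)) x - fourier (f (q i)) y) < e" if "0 < e" for x :: "real^'n" and e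
      proof -
        \<comment> \<open>Chosen so that the oscillation bound e' (1 + M) equals e / 2; M >= 0 keeps
          the divisor positive.\<close>
        define e' where "e' = e / (2 * (1 + M))"
        have "e / (2 * a) * a = e / 2" if "a > 0" for a :: real using that by simp
        from this[of "1 + M"] have "e' * (1 + M) = e / 2" using M0 by (simp add: e'_def)
        then have e': "e' * (1 + M) < e" using that by linarith
        have e'0: "e' > 0" using that M0 by (simp add: e'_def)
        obtain d where d: "d > 0" "\<And>h \<zeta>. bump_on R h \<Longrightarrow> norm (x - \<zeta>) < d \<Longrightarrow>
           cmod (fourier h x - fourier h \<zeta>) \<le> e' * (1 + energy s \<phi> h)"
          using fourier_controlled_by_energy(2)[OF \<phi> R e'0, of x s] by blast
        have "norm (fourier (f (q i)) x - fourier (f (q i)) y) < e" if "norm (x - y) < d" for i y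
        proof -
          have "e' * (1 + energy s \<phi> (f (q i))) \<le> e' * (1 + M)"
            using e'0 M by (intro mult_left_mono) auto
          then show ?thesis using d(2)[OF f that, of "q i"] e' by linarith
        qed
        then show ?thesis using d(1) by blast
      qed
    qed auto
    have "P n (q \<circ> k)"
      unfolding P_def
    proof (intro allI impI)
      fix e :: real assume "e > 0"
      then obtain N where N: "\<And>i x. i \<ge> N \<Longrightarrow> norm x \<le> real n \<Longrightarrow> norm (fourier (f (q (k i))) x - g x) < e / 2"
        using lim[of "e / 2"] by auto
      have "cmod (fourier (f ((q \<circ> k) i)) \<xi> - fourier (f ((q \<circ> k) j)) \<xi>) < e"
        if "i \<ge> N" "j \<ge> N" "norm \<xi> \<le> real n" for i j \<xi>
        using norm_triangle_lt[of "fourier (f (q (k i))) \<xi> - g \<xi>" "g \<xi> - fourier (f (q (k j))) \<xi>" e]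
          N[of i \<xi>] N[of j \<xi>] that by (simp add: norm_minus_commute)
      then show "\<exists>N. \<forall>i\<ge>N. \<forall>j\<ge>N. \<forall>\<xi>. norm \<xi> \<le> real n \<longrightarrow>
          cmod (fourier (f ((q \<circ> k) i)) \<xi> - fourier (f ((q \<circ> k) j)) \<xi>) < e"
        by blast
    qed
    with k show ?thesis by blast
  qed
  interpret subseqs P by standard (rule sub)
  have stable: "P n (s \<circ> r)" if "strict_mono r" "P n s" for r s n
    unfolding P_def
  proof (intro allI impI)
    fix e :: real assume "e > 0"
    with that(2) obtain N where "\<forall>i\<ge>N. \<forall>j\<ge>N. \<forall>\<xi>. norm \<xi> \<le> real n \<longrightarrow>
        cmod (fourier (f (s i)) \<xi> - fourier (f (s j)) \<xi>) < e" unfolding P_def by blast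
    then show "\<exists>N. \<forall>i\<ge>N. \<forall>j\<ge>N. \<forall>\<xi>. norm \<xi> \<le> real n \<longrightarrow>
        cmod (fourier (f ((s \<circ> r) i)) \<xi> - fourier (f ((s \<circ> r) j)) \<xi>) < e"
      using seq_suble[OF that(1)] by (auto intro!: exI[of _ N] dest: order_trans)
  qed
  \<comment> \<open>From its index k + 1 on, the diagonal sequence is a subsequence of one with
    property k. An initial segment does not affect a Cauchy condition, so the whole diagonal
    sequence has the property.\<close>
  have shift: "P k q" if "P k (q \<circ> (+) (Suc k))" for k and q :: "nat \<Rightarrow> nat"
    unfolding P_def
  proof (intro allI impI)
    fix e :: real assume "e > 0"
    with that obtain N where N: "\<And>i j \<xi>. i \<ge> N \<Longrightarrow> j \<ge> N \<Longrightarrow> norm \<xi> \<le> real k \<Longrightarrow>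
        cmod (fourier (f (q (Suc k + i))) \<xi> - fourier (f (q (Suc k + j))) \<xi>) < e"
      unfolding P_def o_def by blast
    have "cmod (fourier (f (q i)) \<xi> - fourier (f (q j)) \<xi>) < e"
      if "i \<ge> Suc k + N" "j \<ge> Suc k + N" "norm \<xi> \<le> real k" for i j \<xi>
      using N[of "i - Suc k" "j - Suc k" \<xi>] that by simp
    then show "\<exists>N. \<forall>i\<ge>N. \<forall>j\<ge>N. \<forall>\<xi>. norm \<xi> \<le> real k \<longrightarrow>
        cmod (fourier (f (q i)) \<xi> - fourier (f (q j)) \<xi>) < e" by blast
  qed
  have "P k diagseq" for k
    by (rule shift, rule diagseq_holds, rule stable)
  then have "\<exists>r. strict_mono (r :: nat \<Rightarrow> nat) \<and> (\<forall>k. P k r)"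
    using subseq_diagseq by blast
  then show ?thesis unfolding P_def .
qed

lemma energy_Cauchy_subsequence:
  fixes f :: "nat \<Rightarrow> real^'n \<Rightarrow> complex"
  assumes \<phi>: "\<phi> \<in> class_M" and \<psi>: "\<psi> \<in> class_M" and \<epsilon>: "\<epsilon> > 0" and R: "R \<ge> 0"
    and f: "\<And>n. bump_on R (f n)" and M: "\<And>n. energy (s + \<epsilon>) \<psi> (f n) \<le> M"
  shows "\<exists>r. strict_mono (r :: nat \<Rightarrow> nat) \<and>
    (\<forall>\<delta>>0. \<exists>N. \<forall>i\<ge>N. \<forall>j\<ge>N. energy s \<phi> (\<lambda>x. f (r i) x - f (r j) x) < \<delta>)"
proof -
  obtain r where r: "strict_mono (r :: nat \<Rightarrow> nat)" and unif: "\<And>k::nat. \<And>e. e > 0 \<Longrightarrow>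
      \<exists>N. \<forall>i\<ge>N. \<forall>j\<ge>N. \<forall>\<xi>. norm \<xi> \<le> real k \<longrightarrow> cmod (fourier (f (r i)) \<xi> - fourier (f (r j)) \<xi>) < e"
    using fourier_uniform_subsequence[where f=f, OF \<psi> R f M] by blast
  have M0: "M \<ge> 0" using M[of 0] energy_nonneg[OF \<psi>, of "s + \<epsilon>" "f 0"] by linarith
  obtain K where K: "K > 0" "\<And>\<xi>::real^'n. weight s \<phi> \<xi> \<le> K * japanese_bracket \<xi> powr (- \<epsilon>) * weight (s + \<epsilon>) \<psi> \<xi>"
    using weight_gain[OF \<phi> \<psi> \<epsilon>] by metis
  obtain C L where C: "C > 0" "\<And>\<xi>::real^'n. weight s \<phi> \<xi> \<le> C * (1 + norm \<xi>) ^ L"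
    using weight_le_power[OF \<phi>] by metis
  have "\<exists>N. \<forall>i\<ge>N. \<forall>j\<ge>N. energy s \<phi> (\<lambda>x. f (r i) x - f (r j) x) < \<delta>" if \<delta>: "\<delta> > 0" for \<delta>
  proof -
    \<comment> \<open>The radius k is fixed before the accuracy on the ball. Beyond it the energy of
      a difference is at most K k^(-\<epsilon>) times its source energy, which is at most 2 M + 2
      M.\<close>
    have "((\<lambda>k. K * (real k powr (- \<epsilon>)) * (4 * M)) \<longlongrightarrow> K * 0 * (4 * M)) sequentially"
      using \<epsilon> by (intro tendsto_intros tendsto_neg_powr filterlim_real_sequentially) auto
    then have "\<forall>\<^sub>F k in sequentially. K * (real k powr (- \<epsilon>)) * (4 * M) < \<delta> / 2"
      by (rule order_tendstoD) (use \<delta> in simp)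
    \<comment> \<open>The condition k > 0 matters: \<open>0 powr (- \<epsilon>)\<close> is 0 by
      convention and would not dominate the tail.\<close>
    then have "\<forall>\<^sub>F k in sequentially. k > 0 \<and> K * (real k powr (- \<epsilon>)) * (4 * M) < \<delta> / 2"
      using eventually_gt_at_top[of 0] by eventually_elim auto
    then obtain k :: nat where k: "k > 0" "K * (real k powr (- \<epsilon>)) * (4 * M) < \<delta> / 2"
      by (auto simp: eventually_sequentially)
    define W where "W = C * (1 + real k) ^ L"
    have W: "W > 0" using C(1) by (simp add: W_def)
    define V where "V = measure lborel (cball (0::real^'n) (real k))"
    have V: "V \<ge> 0" by (simp add: V_def)
    \<comment> \<open>Solves W e^2 (V + 1) = \<delta> / 2, where W bounds the weight on the ball and
      V is its volume. V + 1 in place of V keeps the divisor positive and makes the bound for W e^2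
      V strict.\<close>
    define e where "e = sqrt (\<delta> / (2 * (W * (V + 1))))"
    have e: "e > 0" using \<delta> W V by (simp add: e_def)
    have e2: "W * e\<^sup>2 * V < \<delta> / 2"
    proof -
      have "W * e\<^sup>2 * V < W * e\<^sup>2 * (V + 1)" using W e by simp
      moreover have "W * (\<delta> / (2 * (W * a))) * a = \<delta> / 2" if "a > 0" for a :: real
        using that W by simp
      from this[of "V + 1"] have "W * e\<^sup>2 * (V + 1) = \<delta> / 2"
        unfolding e_def using \<delta> W V by simp
      ultimately show ?thesis by linarith
    qed
    obtain N where N: "\<And>i j \<xi>. i \<ge> N \<Longrightarrow> j \<ge> N \<Longrightarrow> norm \<xi> \<le> real k \<Longrightarrow>
        cmod (fourier (f (r i)) \<xi> - fourier (f (r j)) \<xi>) < e"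
      using unif[OF e, of k] by blast
    have "energy s \<phi> (\<lambda>x. f (r i) x - f (r j) x) < \<delta>" if ij: "i \<ge> N" "j \<ge> N" for i j
    proof -
      let ?h = "\<lambda>x. f (r i) x - f (r j) x"
      have h: "bump_on R ?h" by (intro bump_on_diff f)
      have F: "fourier ?h \<xi> = fourier (f (r i)) \<xi> - fourier (f (r j)) \<xi>" for \<xi>
        by (intro fourier_diff bump_on_integrable[OF f])
      have ind: "integrable lborel (\<lambda>\<xi>::real^'n. W * e\<^sup>2 * indicator (cball 0 (real k)) \<xi>)"
        by (intro integrable_mult_right integrable_real_indicator) (use emeasure_bounded_finite[OF bounded_cball, of "0::real^'n" "real k"] in auto)
      have "energy s \<phi> ?h \<le> (LINT \<xi>|lborel. W * e\<^sup>2 * indicator (cball 0 (real k)) \<xi> +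
          K * real k powr (- \<epsilon>) * energy_density (s + \<epsilon>) \<psi> ?h \<xi>)"
        unfolding energy_def
      proof (intro integral_mono Bochner_Integration.integrable_add ind integrable_mult_right
          energy_integrable[OF \<phi> h] energy_integrable[OF \<psi> h])
        fix \<xi> :: "real^'n"
        have w1: "weight (s + \<epsilon>) \<psi> \<xi> \<ge> 0" using weight_pos[OF \<psi>] less_imp_le by blast
        have w0: "weight s \<phi> \<xi> \<ge> 0" using weight_pos[OF \<phi>] less_imp_le by blast
        show "energy_density s \<phi> ?h \<xi> \<le> W * e\<^sup>2 * indicator (cball 0 (real k)) \<xi> +
          K * real k powr (- \<epsilon>) * energy_density (s + \<epsilon>) \<psi> ?h \<xi>"
        proof (cases "norm \<xi> \<le> real k")
          case True
          have "weight s \<phi> \<xi> \<le> W"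
            unfolding W_def using C True by (intro order_trans[OF C(2)] mult_left_mono power_mono) auto
          moreover have "(cmod (fourier ?h \<xi>))\<^sup>2 \<le> e\<^sup>2"
            unfolding F using N[OF ij True] by (intro power_mono) auto
          ultimately have "energy_density s \<phi> ?h \<xi> \<le> W * e\<^sup>2"
            using w0 W by (intro mult_mono) auto
          then show ?thesis using True K(1) w1 by (simp add: add_increasing2)
        next
          case False
          then have "real k \<le> japanese_bracket \<xi>"
            using norm_le_japanese_bracket[of \<xi>] by linarith
          then have "japanese_bracket \<xi> powr (- \<epsilon>) \<le> real k powr (- \<epsilon>)"
            using k \<epsilon> by (intro powr_mono2') auto
          then have "K * japanese_bracket \<xi> powr (- \<epsilon>) * weight (s + \<epsilon>) \<psi> \<xi> \<le> K * real k powr (- \<epsilon>) * weight (s + \<epsilon>) \<psi> \<xi>"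
            using K(1) w1 by (intro mult_right_mono mult_left_mono) auto
          then have "weight s \<phi> \<xi> \<le> K * real k powr (- \<epsilon>) * weight (s + \<epsilon>) \<psi> \<xi>"
            using K(2)[of \<xi>] by linarith
          then have "energy_density s \<phi> ?h \<xi> \<le> K * real k powr (- \<epsilon>) * weight (s + \<epsilon>) \<psi> \<xi> * (cmod (fourier ?h \<xi>))\<^sup>2"
            by (intro mult_right_mono) auto
          then show ?thesis using False by (simp add: mult.assoc)
        qed
      qed
      also have "\<dots> = W * e\<^sup>2 * V + K * real k powr (- \<epsilon>) * energy (s + \<epsilon>) \<psi> ?h"
        unfolding energy_def V_def using ind energy_integrable[OF \<psi> h, of "s + \<epsilon>"]
        by (subst Bochner_Integration.integral_add) auto
      also have "\<dots> \<le> W * e\<^sup>2 * V + K * real k powr (- \<epsilon>) * (4 * M)"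
      proof -
        have "energy (s + \<epsilon>) \<psi> ?h \<le> 4 * M"
          using energy_diff_le[OF \<psi> f f, of "s + \<epsilon>" "r i" "r j"] M[of "r i"] M[of "r j"] by linarith
        then show ?thesis using K(1) by (intro add_left_mono mult_left_mono) auto
      qed
      also have "\<dots> < \<delta>" using e2 k(2) by linarith
      finally show ?thesis .
    qed
    then show ?thesis by blast
  qed
  then show ?thesis using r by blast
qed

text \<open>On a ball the two weights are comparable, but the constant H grows with the ball, so the
  order of limits matters. For a fixed late n, f n is compared with f m, and m goes to infinity
  first. This removes the term with H and leaves a bound independent of the ball, whose radius may
  then grow.\<close>

lemma energy_tendsto_0:
  fixes f :: "nat \<Rightarrow> real^'n \<Rightarrow> complex"
  assumes \<phi>: "\<phi> \<in> class_M" and \<psi>: "\<psi> \<in> class_M" and f: "\<And>n. bump_on R (f n)"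
    and Cauchy: "\<And>\<delta>. \<delta> > 0 \<Longrightarrow> \<exists>N. \<forall>i\<ge>N. \<forall>j\<ge>N. energy t \<psi> (\<lambda>x. f i x - f j x) < \<delta>"
    and lim: "(\<lambda>n. energy s \<phi> (f n)) \<longlonglongrightarrow> 0"
  shows "(\<lambda>n. energy t \<psi> (f n)) \<longlonglongrightarrow> 0"
proof (rule LIMSEQ_I)
  fix \<delta> :: real assume "\<delta> > 0"
  then obtain N where N: "\<And>i j. i \<ge> N \<Longrightarrow> j \<ge> N \<Longrightarrow> energy t \<psi> (\<lambda>x. f i x - f j x) < \<delta> / 3"
    using Cauchy[of "\<delta> / 3"] by auto
  obtain C L where C: "C > 0" "\<And>\<xi>::real^'n. weight t \<psi> \<xi> \<le> C * (1 + norm \<xi>) ^ L"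
    using weight_le_power[OF \<psi>] by metis
  obtain D L' where D: "D > 0" "\<And>\<xi>::real^'n. inverse (weight s \<phi> \<xi>) \<le> D * (1 + norm \<xi>) ^ L'"
    using weight_inverse_le_power[OF \<phi>] by metis
  have [measurable]: "fourier (f n) \<in> borel_measurable borel" "(weight t \<psi> :: real^'n \<Rightarrow> real) \<in> borel_measurable borel" for n
    using fourier_measurable[OF bump_on_integrable[OF f]] weight_measurable[OF \<psi>] by auto
  have "energy t \<psi> (f n) < \<delta>" if n: "n \<ge> N" for n
  proof -
    let ?E = "\<lambda>\<xi>. energy_density t \<psi> (f n) \<xi>"
    have Ei: "integrable lborel ?E" by (rule energy_integrable[OF \<psi> f])
    have E0: "?E \<xi> \<ge> 0" for \<xi> using weight_pos[OF \<psi>, of t \<xi>] by simp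
    have part: "(LINT \<xi>|lborel. indicator (cball 0 (real k)) \<xi> * ?E \<xi>) \<le> 2 * (\<delta> / 3)" for k
    proof (rule LIMSEQ_le_const)
      define H where "H = C * (1 + real k) ^ L * (D * (1 + real k) ^ L')"
      show "(\<lambda>m. 2 * (\<delta> / 3) + 2 * H * energy s \<phi> (f m)) \<longlonglongrightarrow> 2 * (\<delta> / 3)"
        using tendsto_add[OF tendsto_const tendsto_mult[OF tendsto_const lim], of "2 * (\<delta> / 3)" "2 * H"] by simp
      have "(LINT \<xi>|lborel. indicator (cball 0 (real k)) \<xi> * ?E \<xi>) \<le> 2 * (\<delta> / 3) + 2 * H * energy s \<phi> (f m)"
        if m: "m \<ge> N" for m
      proof -
        let ?h = "\<lambda>x. f n x - f m x"
        have h: "bump_on R ?h" by (intro bump_on_diff f)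
        have F: "fourier ?h \<xi> = fourier (f n) \<xi> - fourier (f m) \<xi>" for \<xi>
          by (intro fourier_diff bump_on_integrable[OF f])
        have "(LINT \<xi>|lborel. indicator (cball 0 (real k)) \<xi> * ?E \<xi>) \<le>
          (LINT \<xi>|lborel. 2 * energy_density t \<psi> ?h \<xi> + 2 * H * energy_density s \<phi> (f m) \<xi>)"
        proof (intro integral_mono Bochner_Integration.integrable_add integrable_mult_right
            energy_integrable[OF \<psi> h] energy_integrable[OF \<phi> f])
          show "integrable lborel (\<lambda>\<xi>. indicator (cball 0 (real k)) \<xi> * ?E \<xi>)"
            using integrable_mult_indicator[OF _ Ei, of "cball 0 (real k)"] by simp
          fix \<xi> :: "real^'n"
          have w1: "weight t \<psi> \<xi> > 0" and w0: "weight s \<phi> \<xi> > 0" using weight_pos \<phi> \<psi> by auto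
          have H0: "H \<ge> 0" using C(1) D(1) by (simp add: H_def)
          show "indicator (cball 0 (real k)) \<xi> * ?E \<xi> \<le>
            2 * energy_density t \<psi> ?h \<xi> + 2 * H * energy_density s \<phi> (f m) \<xi>"
          proof (cases "norm \<xi> \<le> real k")
            case True
            have "weight t \<psi> \<xi> * inverse (weight s \<phi> \<xi>) \<le> H"
              unfolding H_def using C D True w1 w0
              by (intro mult_mono order_trans[OF C(2)] order_trans[OF D(2)] mult_left_mono power_mono)
                (auto intro: less_imp_le)
            then have wH: "weight t \<psi> \<xi> \<le> H * weight s \<phi> \<xi>" using w0 by (simp add: field_simps)
            have "(cmod (fourier (f n) \<xi>))\<^sup>2 \<le> (cmod (fourier ?h \<xi>) + cmod (fourier (f m) \<xi>))\<^sup>2"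
              unfolding F using norm_triangle_sub[of "fourier (f n) \<xi>" "fourier (f m) \<xi>"]
              by (intro power_mono) (auto simp: add.commute)
            also have "\<dots> \<le> 2 * (cmod (fourier ?h \<xi>))\<^sup>2 + 2 * (cmod (fourier (f m) \<xi>))\<^sup>2"
              using sum_squares_bound[of "cmod (fourier ?h \<xi>)" "cmod (fourier (f m) \<xi>)"] by (simp add: power2_sum)
            finally have "?E \<xi> \<le> weight t \<psi> \<xi> * (2 * (cmod (fourier ?h \<xi>))\<^sup>2 + 2 * (cmod (fourier (f m) \<xi>))\<^sup>2)"
              using w1 by (intro mult_left_mono) auto
            also have "\<dots> = 2 * energy_density t \<psi> ?h \<xi> + 2 * energy_density t \<psi> (f m) \<xi>"
              by (simp only: distrib_left mult.left_commute)
            also have "energy_density t \<psi> (f m) \<xi> \<le> H * weight s \<phi> \<xi> * (cmod (fourier (f m) \<xi>))\<^sup>2"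
              by (intro mult_right_mono wH) auto
            finally show ?thesis using True by (simp add: mult.assoc)
          next
            case False
            then show ?thesis using w1 w0 H0 by simp
          qed
        qed
        also have "\<dots> = 2 * energy t \<psi> ?h + 2 * H * energy s \<phi> (f m)"
          unfolding energy_def using energy_integrable[OF \<psi> h, of t] energy_integrable[OF \<phi> f, of s m] by simp
        also have "\<dots> \<le> 2 * (\<delta> / 3) + 2 * H * energy s \<phi> (f m)"
          using N[OF n m] by simp
        finally show ?thesis .
      qed
      then show "\<exists>N. \<forall>m\<ge>N. (LINT \<xi>|lborel. indicator (cball 0 (real k)) \<xi> * ?E \<xi>) \<le> 2 * (\<delta> / 3) + 2 * H * energy s \<phi> (f m)"
        by blast
    qed
    have "(\<lambda>k. LINT \<xi>|lborel. indicator (cball 0 (real k)) \<xi> * ?E \<xi>) \<longlonglongrightarrow> (LINT \<xi>|lborel. ?E \<xi>)"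
    proof (rule integral_dominated_convergence[where w="?E"])
      show "AE \<xi> in lborel. (\<lambda>k. indicator (cball 0 (real k)) \<xi> * ?E \<xi>) \<longlonglongrightarrow> ?E \<xi>"
      proof (rule AE_I2)
        fix \<xi> :: "real^'n"
        obtain k0 where k0: "norm \<xi> \<le> real k0" using real_arch_simple by blast
        have "\<forall>\<^sub>F k in sequentially. ?E \<xi> = indicator (cball 0 (real k)) \<xi> * ?E \<xi>"
          using eventually_ge_at_top[of k0] by eventually_elim (use k0 in auto)
        then show "(\<lambda>k. indicator (cball 0 (real k)) \<xi> * ?E \<xi>) \<longlonglongrightarrow> ?E \<xi>"
          by (rule Lim_transform_eventually[OF tendsto_const])
      qed
      show "AE \<xi> in lborel. norm (indicator (cball 0 (real k)) \<xi> * ?E \<xi>) \<le> ?E \<xi>" for k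
        using E0 by (intro AE_I2) (auto simp: indicator_def)
      show "(\<lambda>\<xi>. indicator (cball 0 (real k)) \<xi> * ?E \<xi>) \<in> borel_measurable lborel" for k
        using borel_measurable_integrable[OF Ei] by (intro borel_measurable_times borel_measurable_indicator) auto
    qed (use Ei in auto)
    then have "energy t \<psi> (f n) \<le> 2 * (\<delta> / 3)"
      unfolding energy_def by (rule LIMSEQ_le_const2) (use part in blast)
    then show ?thesis using \<open>\<delta> > 0\<close> by linarith
  qed
  then show "\<exists>N. \<forall>n\<ge>N. norm (energy t \<psi> (f n) - 0) < \<delta>"
    by (intro exI[of _ N]) (simp add: abs_of_nonneg[OF energy_nonneg[OF \<psi>]])
qed

section \<open>Smooth sections and their local components\<close>

text \<open>The properties of an atlas that compositions of smooth maps depend on.\<close>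

definition nice_atlas :: "('m::topological_space, 'a::euclidean_space) chart set \<Rightarrow> bool" where
  "nice_atlas A \<longleftrightarrow> (\<forall>x. \<exists>(U, c)\<in>A. x \<in> U) \<and>
     (\<forall>(U, c)\<in>A. open U \<and> inj_on c U \<and> (\<forall>X. open X \<and> X \<subseteq> U \<longrightarrow> open (c ` X)))"

lemma nice_atlasD:
  assumes "nice_atlas A" "(U, c) \<in> A"
  shows "open U" "inj_on c U" "open X \<Longrightarrow> X \<subseteq> U \<Longrightarrow> open (c ` X)"
  using assms by (auto simp: nice_atlas_def)

lemma nice_atlas_cover:
  assumes "nice_atlas A"
  obtains U c where "(U, c) \<in> A" "x \<in> U"
  using assms unfolding nice_atlas_def by blast

lemma nice_atlasI:
  assumes "\<And>x. \<exists>U c. (U, c) \<in> A \<and> x \<in> U"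
    and "\<And>U c. (U, c) \<in> A \<Longrightarrow> open U" "\<And>U c. (U, c) \<in> A \<Longrightarrow> inj_on c U"
    and "\<And>U c X. (U, c) \<in> A \<Longrightarrow> open X \<Longrightarrow> X \<subseteq> U \<Longrightarrow> open (c ` X)"
  shows "nice_atlas A"
  using assms unfolding nice_atlas_def by fast

lemma smooth_atlas_nice:
  assumes "smooth_atlas A"
  shows "nice_atlas A"
proof (rule nice_atlasI)
  fix x
  have "x \<in> (\<Union>(U, c)\<in>A. U)" using assms by (simp add: smooth_atlas_def)
  then show "\<exists>U c. (U, c) \<in> A \<and> x \<in> U" by blast
next
  fix U c assume "(U, c) \<in> A"
  then have U: "open U" "open (c ` U)" and hom: "homeomorphism U (c ` U) c (inv_into U c)"
    using assms unfolding smooth_atlas_def by blast+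
  show "open U" by (rule U)
  show inj: "inj_on c U"
    using hom by (metis homeomorphism_apply1 inj_on_inverseI)
  fix X assume X: "open X" "X \<subseteq> U"
  have "c ` X = c ` U \<inter> inv_into U c -` X"
    using inj X(2) by (auto simp: subset_iff)
  then show "open (c ` X)"
    using continuous_open_preimage[OF homeomorphism_cont2[OF hom] U(2) X(1)] by simp
qed

lemma euclidean_atlas_nice: "nice_atlas euclidean_atlas"
  by (auto simp: nice_atlas_def euclidean_atlas_def)

text \<open>Trivializations take values in the product of the base and the fibre, so compositions
  through them use this atlas.\<close>

lemma product_atlas_nice:
  assumes "nice_atlas (A :: ('m::topological_space, 'a::euclidean_space) chart set)"
  shows "nice_atlas (product_atlas A :: ('m \<times> 'b::euclidean_space, 'a \<times> 'b) chart set)"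
proof (rule nice_atlasI)
  fix z :: "'m \<times> 'b"
  obtain U c where "(U, c) \<in> A" "fst z \<in> U" using nice_atlas_cover[OF assms] by blast
  then have "(U \<times> UNIV, \<lambda>(x, a). (c x, a)) \<in> product_atlas A \<and> z \<in> U \<times> UNIV"
    by (auto simp: product_atlas_def mem_Times_iff)
  then show "\<exists>V b. (V, b) \<in> (product_atlas A :: ('m \<times> 'b, 'a \<times> 'b) chart set) \<and> z \<in> V" by blast
next
  fix V :: "('m \<times> 'b) set" and b :: "'m \<times> 'b \<Rightarrow> 'a \<times> 'b" assume "(V, b) \<in> product_atlas A"
  then obtain U c where Uc: "(U, c) \<in> A" and V: "V = U \<times> UNIV" and b: "b = (\<lambda>(x, a). (c x, a))"
    by (auto simp: product_atlas_def)
  note U = nice_atlasD[OF assms Uc]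
  show "open V" unfolding V using U(1) by (intro open_Times) auto
  show "inj_on b V" using U(2) by (auto simp: inj_on_def b V)
  fix X assume X: "open X" "X \<subseteq> V"
  show "open (b ` X)"
  proof (rule Topological_Spaces.openI)
    fix y assume "y \<in> b ` X"
    then obtain x a where xa: "(x, a) \<in> X" "y = (c x, a)" by (auto simp: b)
    obtain P Q where PQ: "open P" "open Q" "(x, a) \<in> P \<times> Q" "P \<times> Q \<subseteq> X"
      using open_prod_elim[OF X(1) xa(1)] by blast
    have "open (c ` (P \<inter> U) \<times> Q)" using PQ U by (intro open_Times U(3)) auto
    moreover have "y \<in> c ` (P \<inter> U) \<times> Q" using PQ xa X(2) V by auto
    moreover have "c ` (P \<inter> U) \<times> Q \<subseteq> b ` X" using PQ(4) by (force simp: b)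
    ultimately show "\<exists>T. open T \<and> y \<in> T \<and> T \<subseteq> b ` X" by blast
  qed
qed

lemma smooth_map_compose:
  assumes A: "nice_atlas A" and B: "nice_atlas B" and C: "nice_atlas C"
    and S: "open S" and T: "open T"
    and f: "smooth_map A B S f" and g: "smooth_map B C T g" and fS: "f ` S \<subseteq> T"
  shows "smooth_map A C S (\<lambda>x. g (f x))"
proof -
  have fc: "continuous_on S f" and gc: "continuous_on T g"
    using f g by (auto simp: smooth_map_def)
  have "smooth_on (c ` (S \<inter> U \<inter> (\<lambda>x. g (f x)) -` W)) (d \<circ> (\<lambda>x. g (f x)) \<circ> inv_into U c)"
    if Uc: "(U, c) \<in> A" and Wd: "(W, d) \<in> C" for U c W d
  proof (rule smooth_on_locally)
    fix y assume "y \<in> c ` (S \<inter> U \<inter> (\<lambda>x. g (f x)) -` W)"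
    then obtain x where x: "x \<in> S" "x \<in> U" "g (f x) \<in> W" "y = c x" by auto
    \<comment> \<open>In coordinates the composition factors through a chart V of the middle
      manifold only near x: on the set Y below, which f maps into V and g after f maps into
      W.\<close>
    obtain V b where Vb: "(V, b) \<in> B" "f x \<in> V" using nice_atlas_cover[OF B] by blast
    define X where "X = T \<inter> V \<inter> g -` W"
    have "X = V \<inter> (T \<inter> g -` W)" by (auto simp: X_def)
    then have X: "open X"
      using continuous_open_preimage[OF gc T nice_atlasD(1)[OF C Wd]] nice_atlasD(1)[OF B Vb(1)] by auto
    define Y where "Y = U \<inter> (S \<inter> f -` X)"
    have Y: "open Y"
      unfolding Y_def using continuous_open_preimage[OF fc S X] nice_atlasD(1)[OF A Uc] by auto
    have cY: "open (c ` Y)" by (rule nice_atlasD(3)[OF A Uc Y]) (auto simp: Y_def)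
    have inv: "inv_into U c (c z) = z" if "z \<in> U" for z
      using nice_atlasD(2)[OF A Uc] that by simp
    have "smooth_on (c ` Y) (\<lambda>z. (d \<circ> g \<circ> inv_into V b) ((b \<circ> f \<circ> inv_into U c) z))"
    proof (rule smooth_on_compose[OF cY, where f="d \<circ> g \<circ> inv_into V b" and g="b \<circ> f \<circ> inv_into U c"])
      show "open (b ` X)" by (rule nice_atlasD(3)[OF B Vb(1) X]) (auto simp: X_def)
      show "(b \<circ> f \<circ> inv_into U c) ` c ` Y \<subseteq> b ` X" using inv by (auto simp: Y_def)
      show "smooth_on (b ` X) (d \<circ> g \<circ> inv_into V b)"
        unfolding X_def using g Vb(1) Wd unfolding smooth_map_def by blast
      have "smooth_on (c ` (S \<inter> U \<inter> f -` V)) (b \<circ> f \<circ> inv_into U c)"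
        using f Vb(1) Uc unfolding smooth_map_def by blast
      then show "smooth_on (c ` Y) (b \<circ> f \<circ> inv_into U c)"
        by (rule smooth_on_subset) (auto simp: Y_def X_def)
    qed
    then have "smooth_on (c ` Y) (d \<circ> (\<lambda>x. g (f x)) \<circ> inv_into U c)"
    proof (rule smooth_on_cong[OF cY])
      fix z assume "z \<in> c ` Y"
      then show "(d \<circ> g \<circ> inv_into V b) ((b \<circ> f \<circ> inv_into U c) z) = (d \<circ> (\<lambda>x. g (f x)) \<circ> inv_into U c) z"
        using inv nice_atlasD(2)[OF B Vb(1)] by (auto simp: Y_def X_def)
    qed
    moreover have "y \<in> c ` Y" using x Vb fS by (auto simp: Y_def X_def)
    ultimately show "\<exists>T. y \<in> T \<and> smooth_on T (d \<circ> (\<lambda>x. g (f x)) \<circ> inv_into U c)" by blast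
  qed
  moreover have "continuous_on S (\<lambda>x. g (f x))"
    using continuous_on_compose2[OF gc fc fS] .
  ultimately show ?thesis unfolding smooth_map_def by blast
qed

lemma smooth_map_subset:
  assumes "smooth_map A B S f" "T \<subseteq> S"
  shows "smooth_map A B T f"
proof -
  have "smooth_on (c ` (T \<inter> U \<inter> f -` W)) (d \<circ> f \<circ> inv_into U c)"
    if "(U, c) \<in> A" "(W, d) \<in> B" for U c W d
  proof (rule smooth_on_subset)
    show "smooth_on (c ` (S \<inter> U \<inter> f -` W)) (d \<circ> f \<circ> inv_into U c)"
      using assms(1) that unfolding smooth_map_def by blast
  qed (use assms(2) in auto)
  moreover have "continuous_on T f"
    using assms by (auto simp: smooth_map_def intro: continuous_on_subset)
  ultimately show ?thesis unfolding smooth_map_def by blast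
qed

lemma smooth_map_cong:
  assumes "nice_atlas A" "nice_atlas B" "open S" "smooth_map A B S f" "\<And>x. x \<in> S \<Longrightarrow> f x = g x"
  shows "smooth_map A B S g"
proof -
  have c: "continuous_on S f" using assms by (simp add: smooth_map_def)
  have "smooth_on (c ` (S \<inter> U \<inter> g -` W)) (d \<circ> g \<circ> inv_into U c)"
    if Uc: "(U, c) \<in> A" and Wd: "(W, d) \<in> B" for U c W d
  proof (rule smooth_on_cong)
    have eq: "S \<inter> U \<inter> g -` W = S \<inter> U \<inter> f -` W" using assms(5) by auto
    have "open (U \<inter> (S \<inter> f -` W))"
      using continuous_open_preimage[OF c assms(3) nice_atlasD(1)[OF assms(2) Wd]]
        nice_atlasD(1)[OF assms(1) Uc] by auto
    also have "U \<inter> (S \<inter> f -` W) = S \<inter> U \<inter> f -` W" by auto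
    finally show "open (c ` (S \<inter> U \<inter> g -` W))"
      unfolding eq by (rule nice_atlasD(3)[OF assms(1) Uc]) auto
    show "smooth_on (c ` (S \<inter> U \<inter> g -` W)) (d \<circ> f \<circ> inv_into U c)"
      unfolding eq using assms(4) Uc Wd unfolding smooth_map_def by blast
    show "(d \<circ> f \<circ> inv_into U c) x = (d \<circ> g \<circ> inv_into U c) x" if "x \<in> c ` (S \<inter> U \<inter> g -` W)" for x
      using that nice_atlasD(2)[OF assms(1) Uc] assms(5) by auto
  qed
  moreover have "continuous_on S g" using c assms(5) by (metis continuous_on_cong)
  ultimately show ?thesis unfolding smooth_map_def by blast
qed

lemma smooth_map_locally:
  assumes "\<And>x. \<exists>T. open T \<and> x \<in> T \<and> smooth_map A B T f"
  shows "smooth_map A B UNIV f"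
proof -
  obtain T where T: "\<And>x. open (T x)" "\<And>x. x \<in> T x" "\<And>x. smooth_map A B (T x) f"
    using assms by metis
  have "continuous_on (\<Union>x. T x) f"
    using T(1,3) by (intro continuous_on_open_UN) (auto simp: smooth_map_def)
  moreover have "(\<Union>x. T x) = UNIV" using T(2) by auto
  ultimately have "continuous_on UNIV f" by simp
  moreover have "smooth_on (c ` (UNIV \<inter> U \<inter> f -` W)) (d \<circ> f \<circ> inv_into U c)"
    if "(U, c) \<in> A" "(W, d) \<in> B" for U c W d
  proof (rule smooth_on_locally)
    fix y assume "y \<in> c ` (UNIV \<inter> U \<inter> f -` W)"
    then obtain x where x: "x \<in> U" "f x \<in> W" "y = c x" by auto
    have "smooth_on (c ` (T x \<inter> U \<inter> f -` W)) (d \<circ> f \<circ> inv_into U c)"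
      using T(3)[of x] that unfolding smooth_map_def by blast
    moreover have "y \<in> c ` (T x \<inter> U \<inter> f -` W)" using x T(2) by auto
    ultimately show "\<exists>T. y \<in> T \<and> smooth_on T (d \<circ> f \<circ> inv_into U c)" by (intro exI conjI)
  qed
  ultimately show ?thesis unfolding smooth_map_def by blast
qed

lemma smooth_map_euclidean: "smooth_map euclidean_atlas euclidean_atlas UNIV f \<Longrightarrow> smooth_on UNIV f"
  by (simp add: smooth_map_def euclidean_atlas_def inv_into_def o_def)

text \<open>Product charts leave the fibre coordinate unchanged, so it can be read off from f in any
  of them.\<close>

lemma smooth_map_snd:
  fixes f :: "'a::euclidean_space \<Rightarrow> 'm::topological_space \<times> 'b::euclidean_space"
  assumes A: "nice_atlas A" and f: "smooth_map euclidean_atlas (product_atlas A) UNIV f"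
  shows "smooth_on UNIV (\<lambda>x. snd (f x))"
proof (rule smooth_on_locally)
  fix x
  obtain U c where Uc: "(U, c) \<in> A" "fst (f x) \<in> U" using nice_atlas_cover[OF A] by blast
  then have ch: "(U \<times> UNIV, \<lambda>(x, a). (c x, a)) \<in> product_atlas A" by (auto simp: product_atlas_def)
  have "open (f -` (U \<times> UNIV))"
    using f nice_atlasD(1)[OF A Uc(1)] continuous_open_preimage[of UNIV f "U \<times> UNIV"]
    by (auto simp: smooth_map_def intro: open_Times)
  moreover have "smooth_on (f -` (U \<times> UNIV)) ((\<lambda>(x, a). (c x, a)) \<circ> f)"
    using f ch unfolding smooth_map_def euclidean_atlas_def
    by (fastforce simp: inv_into_def o_def)
  ultimately have "smooth_on (f -` (U \<times> UNIV)) (\<lambda>x. snd (((\<lambda>(x, a). (c x, a)) \<circ> f) x))"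
    by (rule smooth_on_linear[OF _ bounded_linear_snd])
  moreover have "(\<lambda>x. snd (((\<lambda>(x, a). (c x, a)) \<circ> f) x)) = (\<lambda>x. snd (f x))"
    by (auto simp: fun_eq_iff case_prod_beta)
  ultimately show "\<exists>T. x \<in> T \<and> smooth_on T (\<lambda>x. snd (f x))"
    using Uc by (intro exI[of _ "f -` (U \<times> UNIV)"]) (auto simp: mem_Times_iff)
qed

section \<open>The linear structure of the space of smooth sections\<close>

lemma bounded_linear_vector_scale: "bounded_linear (\<lambda>a::complex^'p. c *s a)"
  unfolding linear_conv_bounded_linear[symmetric]
  by (intro linearI) (auto simp: vec_eq_iff distrib_left scaleR_conv_of_real)

text \<open>The fibre operations are not assumed smooth; their smoothness comes from the
  trivializations, which are linear on fibres. Sums and scalar multiples are both of this form: w is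
  computed in a trivialization and carried back by the inverse diffeomorphism.\<close>

lemma smooth_sections_combine:
  fixes B :: "('m::{t2_space,second_countable_topology}, 'e::{t2_space,second_countable_topology},
      'n::finite, 'p::finite) vbundle"
  assumes vb: "smooth_vector_bundle B"
    and u: "u \<in> smooth_sections B" and v: "v \<in> smooth_sections B"
    and lin: "bounded_linear F" "bounded_linear G"
    and proj: "\<And>x. proj B (w x) = x"
    and w: "\<And>U \<beta> x. local_trivialization B U \<beta> \<Longrightarrow> x \<in> U \<Longrightarrow>
      snd (\<beta> (w x)) = F (snd (\<beta> (u x))) + G (snd (\<beta> (v x)))"
  shows "w \<in> smooth_sections B"
proof -
  let ?A = "base_atlas B" and ?E = "total_atlas B"
  let ?P = "product_atlas ?A :: ('m \<times> (complex^'p), (real^'n) \<times> (complex^'p)) chart set"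
  have A: "nice_atlas ?A" and E: "nice_atlas ?E"
    using vb smooth_atlas_nice by (auto simp: smooth_vector_bundle_def)
  have P: "nice_atlas ?P" by (rule product_atlas_nice[OF A])
  have "smooth_map ?A ?E UNIV w"
  proof (rule smooth_map_locally)
    fix x0
    obtain U \<beta> where x0: "x0 \<in> U" and triv: "local_trivialization B U \<beta>"
      using vb unfolding smooth_vector_bundle_def by blast
    from triv have U: "open U"
      and diffeo: "diffeomorphism ?E ?P (proj B -` U) (U \<times> UNIV) \<beta>"
      and fst: "\<And>e. proj B e \<in> U \<Longrightarrow> fst (\<beta> e) = proj B e"
      by (auto simp: local_trivialization_def)
    have section_proj: "proj B (u x) = x" "proj B (v x) = x" for x
      using u v by (auto simp: smooth_sections_def)
    have triv_section: "smooth_map ?A ?P U (\<lambda>x. \<beta> (q x))" if q: "q \<in> smooth_sections B" for q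
    proof (rule smooth_map_compose[OF A E P U])
      show "open (proj B -` U)" "smooth_map ?E ?P (proj B -` U) \<beta>"
        using diffeo by (auto simp: diffeomorphism_def)
      show "smooth_map ?A ?E U q"
        using q smooth_map_subset[of ?A ?E UNIV q U] by (auto simp: smooth_sections_def)
      show "q ` U \<subseteq> proj B -` U" using q by (auto simp: smooth_sections_def)
    qed
    \<comment> \<open>This is w read in the trivialization, written so that smoothness can be
      checked on the coordinates of u and v.\<close>
    define h where "h x = (x, F (snd (\<beta> (u x))) + G (snd (\<beta> (v x))))" for x
    have "continuous_on U h"
    proof -
      have "continuous_on U (\<lambda>x. \<beta> (u x))" "continuous_on U (\<lambda>x. \<beta> (v x))"
        using triv_section[OF u] triv_section[OF v] by (auto simp: smooth_map_def)
      then show ?thesis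
        unfolding h_def by (intro continuous_intros bounded_linear.continuous_on[OF lin(1)]
            bounded_linear.continuous_on[OF lin(2)])
    qed
    moreover have "smooth_on (c ` (U \<inter> V \<inter> h -` W')) (d' \<circ> h \<circ> inv_into V c)"
      if Vc: "(V, c) \<in> ?A" and Wd': "(W', d') \<in> ?P" for V c W' d'
    proof -
      obtain W d where chP: "W' = W \<times> UNIV" "d' = (\<lambda>(x, a). (d x, a))" and Wd: "(W, d) \<in> ?A"
        using Wd' by (auto simp: product_atlas_def)
      let ?d = "\<lambda>(x, a::complex^'p). (d x, a)"
      have inP: "(W \<times> UNIV, ?d) \<in> ?P" using Wd by (auto simp: product_atlas_def)
      \<comment> \<open>h and the trivialized sections keep the base point, so landing in the
        product chart over W only constrains x to this open set.\<close>
      define O' where "O' = U \<inter> V \<inter> W"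
      have "open O'" unfolding O'_def
        using U nice_atlasD(1)[OF A Vc] nice_atlasD(1)[OF A Wd] by auto
      then have cO: "open (c ` O')"
        by (rule nice_atlasD(3)[OF A Vc]) (auto simp: O'_def)
      have sm: "smooth_on (c ` O') (?d \<circ> (\<lambda>x. \<beta> (q x)) \<circ> inv_into V c)"
        if q: "q \<in> smooth_sections B" for q
      proof -
        have "smooth_on (c ` (U \<inter> V \<inter> (\<lambda>x. \<beta> (q x)) -` (W \<times> UNIV))) (?d \<circ> (\<lambda>x. \<beta> (q x)) \<circ> inv_into V c)"
          using triv_section[OF q] Vc inP unfolding smooth_map_def by fast
        moreover have "O' \<subseteq> U \<inter> V \<inter> (\<lambda>x. \<beta> (q x)) -` (W \<times> UNIV)"
          using q fst by (auto simp: O'_def smooth_sections_def mem_Times_iff)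
        ultimately show ?thesis by (meson image_mono smooth_on_subset)
      qed
      let ?u = "?d \<circ> (\<lambda>x. \<beta> (u x)) \<circ> inv_into V c" and ?v = "?d \<circ> (\<lambda>x. \<beta> (v x)) \<circ> inv_into V c"
      have "smooth_on (c ` O') (\<lambda>y. (fst (?u y), F (snd (?u y)) + G (snd (?v y))))"
        by (rule smooth_on_Pair[OF cO smooth_on_linear[OF cO bounded_linear_fst sm[OF u]]
            smooth_on_add[OF cO smooth_on_linear[OF cO lin(1) smooth_on_linear[OF cO bounded_linear_snd sm[OF u]]]
              smooth_on_linear[OF cO lin(2) smooth_on_linear[OF cO bounded_linear_snd sm[OF v]]]]])
      then have "smooth_on (c ` O') (?d \<circ> h \<circ> inv_into V c)"
      proof (rule smooth_on_cong[OF cO])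
        fix y assume "y \<in> c ` O'"
        then obtain x where x: "x \<in> O'" "y = c x" by auto
        then have "inv_into V c y = x" using nice_atlasD(2)[OF A Vc] by (simp add: O'_def)
        moreover have "fst (\<beta> (u x)) = x" using fst[of "u x"] section_proj x by (simp add: O'_def)
        ultimately show "(fst (?u y), F (snd (?u y)) + G (snd (?v y))) = (?d \<circ> h \<circ> inv_into V c) y"
          by (simp add: h_def case_prod_beta)
      qed
      moreover have "U \<inter> V \<inter> h -` (W \<times> UNIV) = O'" by (auto simp: O'_def h_def)
      ultimately show ?thesis unfolding chP by simp
    qed
    ultimately have h: "smooth_map ?A ?P U h" unfolding smooth_map_def by blast
    have "smooth_map ?A ?E U (\<lambda>x. inv_into (proj B -` U) \<beta> (h x))"
    proof (rule smooth_map_compose[OF A P E U _ h])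
      show "open (U \<times> (UNIV :: (complex^'p) set))" using U by (intro open_Times) auto
      show "smooth_map ?P ?E (U \<times> UNIV) (inv_into (proj B -` U) \<beta>)"
        using diffeo by (auto simp: diffeomorphism_def)
      show "h ` U \<subseteq> U \<times> UNIV" by (auto simp: h_def)
    qed
    then have "smooth_map ?A ?E U w"
    proof (rule smooth_map_cong[OF A E U])
      fix x assume x: "x \<in> U"
      have "\<beta> (w x) = h x"
        using fst[of "w x"] proj[of x] w[OF triv x] x by (simp add: h_def prod_eq_iff)
      moreover have "inj_on \<beta> (proj B -` U)"
        using diffeo by (auto simp: diffeomorphism_def bij_betw_def)
      ultimately show "inv_into (proj B -` U) \<beta> (h x) = w x"
        using proj[of x] x by (metis inv_into_f_f vimageI)
    qed
    then show "\<exists>T. open T \<and> x0 \<in> T \<and> smooth_map ?A ?E T w" using U x0 by blast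
  qed
  then show ?thesis using proj by (simp add: smooth_sections_def)
qed

lemma local_trivialization_linear:
  assumes "local_trivialization B U \<beta>" "proj B e \<in> U"
  shows "proj B e' = proj B e \<Longrightarrow> snd (\<beta> (fadd B e e')) = snd (\<beta> e) + snd (\<beta> e')"
    and "snd (\<beta> (fscale B c e)) = c *s snd (\<beta> e)"
  using assms by (auto simp: local_trivialization_def)

lemma smooth_sections_add:
  assumes "smooth_vector_bundle B" "u \<in> smooth_sections B" "v \<in> smooth_sections B"
  shows "section_add B u v \<in> smooth_sections B"
proof (rule smooth_sections_combine[OF assms bounded_linear_ident bounded_linear_ident])
  have p: "proj B (u x) = x" "proj B (v x) = x" for x
    using assms by (auto simp: smooth_sections_def)
  show "proj B (section_add B u v x) = x" for x
    using assms(1) p[of x] by (simp add: smooth_vector_bundle_def section_add_def)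
  show "snd (\<beta> (section_add B u v x)) = snd (\<beta> (u x)) + snd (\<beta> (v x))"
    if "local_trivialization B U \<beta>" "x \<in> U" for U \<beta> x
    using local_trivialization_linear(1)[OF that(1), of "u x" "v x"] that(2) p[of x]
    by (simp add: section_add_def)
qed

lemma smooth_sections_scale:
  assumes "smooth_vector_bundle B" "u \<in> smooth_sections B"
  shows "section_scale B c u \<in> smooth_sections B"
proof (rule smooth_sections_combine[OF assms assms(2) bounded_linear_vector_scale[of c] bounded_linear_zero])
  have p: "proj B (u x) = x" for x
    using assms by (auto simp: smooth_sections_def)
  show "proj B (section_scale B c u x) = x" for x
    using assms(1) p[of x] by (simp add: smooth_vector_bundle_def section_scale_def)
  show "snd (\<beta> (section_scale B c u x)) = c *s snd (\<beta> (u x)) + 0"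
    if "local_trivialization B U \<beta>" "x \<in> U" for U \<beta> x
    using local_trivialization_linear(2)[OF that(1), of "u x" c] that(2) p[of x]
    by (simp add: section_scale_def)
qed

section \<open>Local components as functions on R^n\<close>

lemma param_in_patch:
  assumes "localization_of B L" "j \<in> {1..patches L}"
  shows "param L j y \<in> patch L j"
proof -
  have "bij_betw (param L j) UNIV (patch L j)"
    using assms by (auto simp: localization_of_def diffeomorphism_def)
  then show ?thesis by (auto simp: bij_betw_def)
qed

lemma local_component_eq:
  assumes "localization_of B L" "j \<in> {1..patches L}" "u \<in> smooth_sections B"
  shows "local_component B L j k u y =
     of_real (cutoff L j (param L j y)) * snd (triv L j (u (param L j y))) $ k"
proof -
  have "local_trivialization B (patch L j) (triv L j)"
    using assms(1,2) by (auto simp: localization_of_def)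
  moreover have "proj B (u (param L j y)) = param L j y"
    using assms(3) by (auto simp: smooth_sections_def)
  ultimately show ?thesis
    unfolding local_component_def Let_def
    using local_trivialization_linear(2)[of B "patch L j" "triv L j" "u (param L j y)"]
      param_in_patch[OF assms(1,2), of y] by simp
qed

text \<open>The bundle carries addition and scaling only, so a difference of sections is formed with
  the scalar -1; the trivialization is linear on each fibre.\<close>

lemma local_component_diff:
  assumes "smooth_vector_bundle B" "localization_of B L" "j \<in> {1..patches L}"
    and u: "u \<in> smooth_sections B" and v: "v \<in> smooth_sections B"
  shows "local_component B L j k (section_add B u (section_scale B (-1) v)) =
     (\<lambda>y. local_component B L j k u y - local_component B L j k v y)"
proof
  fix y
  let ?x = "param L j y" and ?v = "section_scale B (-1) v"
  have v': "?v \<in> smooth_sections B" by (rule smooth_sections_scale[OF assms(1) v])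
  have w: "section_add B u ?v \<in> smooth_sections B" by (rule smooth_sections_add[OF assms(1) u v'])
  have triv: "local_trivialization B (patch L j) (triv L j)"
    using assms(2,3) by (auto simp: localization_of_def)
  have p: "proj B (u ?x) = ?x" "proj B (v ?x) = ?x" "proj B (?v ?x) = ?x"
    using u v v' by (auto simp: smooth_sections_def)
  have "snd (triv L j (section_add B u ?v ?x)) = snd (triv L j (u ?x)) + (-1) *s snd (triv L j (v ?x))"
    using local_trivialization_linear(1)[OF triv, of "u ?x" "?v ?x"]
      local_trivialization_linear(2)[OF triv, of "v ?x" "-1"] param_in_patch[OF assms(2,3), of y] p
    by (simp add: section_add_def section_scale_def)
  then have "snd (triv L j (section_add B u ?v ?x)) $ k = snd (triv L j (u ?x)) $ k - snd (triv L j (v ?x)) $ k"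
    by (simp only: vector_add_component vector_smult_component) simp
  then show "local_component B L j k (section_add B u ?v) y =
      local_component B L j k u y - local_component B L j k v y"
    unfolding local_component_eq[OF assms(2,3) u] local_component_eq[OF assms(2,3) v]
      local_component_eq[OF assms(2,3) w]
    by (simp add: right_diff_distrib)
qed

text \<open>The support of the cutoff is compact as a closed subset of a compact manifold, and so is
  its preimage in the parameter space. The radius therefore depends on the chart alone, neither on
  the section nor on the fibre component.\<close>

lemma local_component_bump:
  fixes B :: "('m::{t2_space,second_countable_topology}, 'e::{t2_space,second_countable_topology},
      'n::finite, 'p::finite) vbundle"
  assumes "closed_manifold (base_atlas B)" and vb: "smooth_vector_bundle B"
    and loc: "localization_of B L" and j: "j \<in> {1..patches L}"
  shows "\<exists>R\<ge>0. \<forall>k. \<forall>u\<in>smooth_sections B. bump_on R (local_component B L j k u)"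
proof -
  let ?A = "base_atlas B" and ?E = "total_atlas B" and ?x = "param L j"
  let ?P = "product_atlas ?A :: ('m \<times> (complex^'p), (real^'n) \<times> (complex^'p)) chart set"
  have A: "nice_atlas ?A" and E: "nice_atlas ?E"
    using vb smooth_atlas_nice by (auto simp: smooth_vector_bundle_def)
  have P: "nice_atlas ?P" by (rule product_atlas_nice[OF A])
  have diffeo: "diffeomorphism euclidean_atlas ?A UNIV (patch L j) ?x"
    and triv: "local_trivialization B (patch L j) (triv L j)"
    and cut: "smooth_map ?A euclidean_atlas UNIV (cutoff L j)"
    and supp: "closure {x. cutoff L j x \<noteq> 0} \<subseteq> patch L j"
    using loc j by (auto simp: localization_of_def)
  have xs: "smooth_map euclidean_atlas ?A UNIV ?x" and patch: "open (patch L j)"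
    using diffeo by (auto simp: diffeomorphism_def)
  have inj: "inj ?x" using diffeo by (auto simp: diffeomorphism_def bij_betw_def)
  have "compact (closure {x. cutoff L j x \<noteq> 0})"
    using assms(1) compact_Int_closed[of UNIV "closure {x. cutoff L j x \<noteq> 0}"]
    by (simp add: closed_manifold_def)
  moreover have "continuous_on (closure {x. cutoff L j x \<noteq> 0}) (inv ?x)"
    using diffeo supp by (auto simp: diffeomorphism_def smooth_map_def intro: continuous_on_subset)
  ultimately have "bounded (inv ?x ` closure {x. cutoff L j x \<noteq> 0})"
    by (intro compact_imp_bounded compact_continuous_image)
  then obtain R0 where R0: "\<forall>y\<in>inv ?x ` closure {x. cutoff L j x \<noteq> 0}. norm y \<le> R0"
    by (auto simp: bounded_iff)
  have zero: "cutoff L j (?x y) = 0" if "norm y > max R0 0" for y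
  proof (rule ccontr)
    assume "cutoff L j (?x y) \<noteq> 0"
    then have "?x y \<in> closure {x. cutoff L j x \<noteq> 0}"
      using closure_subset[of "{x. cutoff L j x \<noteq> 0}"] by auto
    then have "inv ?x (?x y) \<in> inv ?x ` closure {x. cutoff L j x \<noteq> 0}" by blast
    then show False using R0 that inj by auto
  qed
  have "bump_on (max R0 0) (local_component B L j k u)" if u: "u \<in> smooth_sections B" for k u
    unfolding bump_on_def
  proof (intro conjI allI impI)
    have us: "smooth_map ?A ?E UNIV u" and up: "\<And>x. proj B (u x) = x"
      using u by (auto simp: smooth_sections_def)
    have "smooth_map euclidean_atlas euclidean_atlas UNIV (\<lambda>y. cutoff L j (?x y))"
      by (rule smooth_map_compose[OF euclidean_atlas_nice A euclidean_atlas_nice _ _ xs cut]) auto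
    then have c: "smooth_on UNIV (\<lambda>y. cutoff L j (?x y))" by (rule smooth_map_euclidean)
    have "smooth_map euclidean_atlas ?E UNIV (\<lambda>y. u (?x y))"
      by (rule smooth_map_compose[OF euclidean_atlas_nice A E _ _ xs us]) auto
    moreover have "open (proj B -` patch L j)" "smooth_map ?E ?P (proj B -` patch L j) (triv L j)"
      using triv by (auto simp: local_trivialization_def diffeomorphism_def)
    ultimately have "smooth_map euclidean_atlas ?P UNIV (\<lambda>y. triv L j (u (?x y)))"
      using param_in_patch[OF loc j] up
      by (intro smooth_map_compose[OF euclidean_atlas_nice E P, where T="proj B -` patch L j"]) auto
    then have "smooth_on UNIV (\<lambda>y. snd (triv L j (u (?x y))))" by (rule smooth_map_snd[OF A])
    then have "smooth_on UNIV (\<lambda>y. cutoff L j (?x y) *\<^sub>R (snd (triv L j (u (?x y))) $ k))"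
      using smooth_on_bilinear[OF open_UNIV bounded_bilinear_scaleR c smooth_on_linear[OF open_UNIV bounded_linear_vec_nth]]
      by blast
    moreover have "(\<lambda>y. cutoff L j (?x y) *\<^sub>R (snd (triv L j (u (?x y))) $ k)) = local_component B L j k u"
      using local_component_eq[OF loc j u] by (auto simp: fun_eq_iff scaleR_conv_of_real)
    ultimately show "smooth_on UNIV (local_component B L j k u)" by simp
    show "local_component B L j k u y = 0" if "norm y > max R0 0" for y
      using zero[OF that] by (simp add: local_component_eq[OF loc j u])
  qed
  then show ?thesis by (intro exI[of _ "max R0 0"]) auto
qed

section \<open>Compact embeddings from dense subspaces\<close>

text \<open>The sequence is refined for one index at a time; stability under passing to subsequences
  preserves what was achieved for the earlier indices.\<close>

lemma finite_common_subsequence: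
  assumes "finite I"
    and "\<And>i r. i \<in> I \<Longrightarrow> strict_mono (r :: nat \<Rightarrow> nat) \<Longrightarrow> \<exists>r'. strict_mono r' \<and> P i (r \<circ> r')"
    and stable: "\<And>i r r'. P i r \<Longrightarrow> strict_mono r' \<Longrightarrow> P i (r \<circ> r')"
  shows "\<exists>r :: nat \<Rightarrow> nat. strict_mono r \<and> (\<forall>i\<in>I. P i r)"
  using assms(1,2)
proof (induction I)
  case empty
  show ?case by (intro exI[of _ id]) (auto simp: strict_mono_def)
next
  case (insert i I)
  then obtain r where r: "strict_mono r" "\<forall>i\<in>I. P i r" by auto
  then obtain r' where r': "strict_mono r'" "P i (r \<circ> r')" using insert.prems by blast
  have "strict_mono (r \<circ> r')" by (rule strict_mono_o[OF r(1) r'(1)])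
  moreover have "\<forall>k\<in>insert i I. P k (r \<circ> r')" using r(2) r' stable by blast
  ultimately show ?case by blast
qed

lemma dense_extension:
  fixes \<iota>\<^sub>1 :: "'s \<Rightarrow> 'g::banach" and \<iota> :: "'s \<Rightarrow> 'h::banach"
  assumes dense: "closure (\<iota>\<^sub>1 ` D) = UNIV" and "K \<ge> 0"
    and bound: "\<And>u v. u \<in> D \<Longrightarrow> v \<in> D \<Longrightarrow> norm (\<iota> u - \<iota> v) \<le> K * norm (\<iota>\<^sub>1 u - \<iota>\<^sub>1 v)"
  shows "\<exists>T. continuous_on UNIV T \<and> (\<forall>u\<in>D. T (\<iota>\<^sub>1 u) = \<iota> u)"
proof -
  \<comment> \<open>Elements of D with the same image under \<open>\<iota>\<^sub>1\<close> also have
    the same image under \<open>\<iota>\<close>, by the bound, so the choice does not affect the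
    value.\<close>
  define f where "f x = \<iota> (SOME u. u \<in> D \<and> \<iota>\<^sub>1 u = x)" for x
  have f: "f (\<iota>\<^sub>1 u) = \<iota> u" if u: "u \<in> D" for u
  proof -
    define v where "v = (SOME v. v \<in> D \<and> \<iota>\<^sub>1 v = \<iota>\<^sub>1 u)"
    have "v \<in> D \<and> \<iota>\<^sub>1 v = \<iota>\<^sub>1 u" unfolding v_def by (rule someI[of _ u]) (use u in simp)
    then show ?thesis using bound[of v u] u by (simp add: f_def v_def)
  qed
  have "K-lipschitz_on (\<iota>\<^sub>1 ` D) f"
    using bound \<open>K \<ge> 0\<close> by (intro lipschitz_onI) (auto simp: f dist_norm)
  then obtain T where T: "uniformly_continuous_on (closure (\<iota>\<^sub>1 ` D)) T" "\<And>x. x \<in> \<iota>\<^sub>1 ` D \<Longrightarrow> f x = T x"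
    using uniformly_continuous_on_extension_on_closure[OF lipschitz_on_uniformly_continuous] by metis
  have "T (\<iota>\<^sub>1 u) = \<iota> u" if "u \<in> D" for u using T(2)[of "\<iota>\<^sub>1 u"] f[OF that] that by simp
  then show ?thesis using uniformly_continuous_imp_continuous[OF T(1)] unfolding dense by blast
qed

lemma dense_sequence:
  fixes \<iota>\<^sub>1 :: "'s \<Rightarrow> 'g::real_normed_vector"
  assumes "closure (\<iota>\<^sub>1 ` D) = UNIV"
  obtains u :: "nat \<Rightarrow> 's" where "\<And>n. u n \<in> D" "(\<lambda>n. \<iota>\<^sub>1 (u n)) \<longlonglongrightarrow> x"
proof -
  have "x \<in> closure (\<iota>\<^sub>1 ` D)" using assms by simp
  then obtain X where X: "\<forall>n. X n \<in> \<iota>\<^sub>1 ` D" "X \<longlonglongrightarrow> x"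
    unfolding closure_sequential by blast
  show ?thesis
  proof (rule that[of "\<lambda>n. inv_into D \<iota>\<^sub>1 (X n)"])
    show "inv_into D \<iota>\<^sub>1 (X n) \<in> D" for n using X(1) by (simp add: inv_into_into)
    show "(\<lambda>n. \<iota>\<^sub>1 (inv_into D \<iota>\<^sub>1 (X n))) \<longlonglongrightarrow> x" using X by (simp add: f_inv_into_f)
  qed
qed

text \<open>A sequence in the closure is shadowed by images of elements of D whose source norms are
  bounded. For these \<open>cpt\<close> supplies a Cauchy subsequence, and its limit is shared by
  the original sequence.\<close>

lemma compact_closure_image:
  fixes \<iota>\<^sub>1 :: "'s \<Rightarrow> 'g::banach" and \<iota> :: "'s \<Rightarrow> 'h::banach"
  assumes dense: "closure (\<iota>\<^sub>1 ` D) = UNIV" and T: "continuous_on UNIV T"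
    and T\<iota>: "\<And>u. u \<in> D \<Longrightarrow> T (\<iota>\<^sub>1 u) = \<iota> u"
    and cpt: "\<And>u b. (\<And>n::nat. u n \<in> D) \<Longrightarrow> (\<And>n. norm (\<iota>\<^sub>1 (u n)) \<le> b) \<Longrightarrow>
      \<exists>r. strict_mono (r :: nat \<Rightarrow> nat) \<and> Cauchy (\<lambda>n. \<iota> (u (r n)))"
    and E: "bounded E"
  shows "compact (closure (T ` E))"
  unfolding compact_eq_seq_compact_metric seq_compact_def
proof (intro allI impI)
  fix y :: "nat \<Rightarrow> 'h" assume y: "\<forall>n. y n \<in> closure (T ` E)"
  obtain b where b: "\<And>x. x \<in> E \<Longrightarrow> norm x \<le> b" using E unfolding bounded_iff by blast
  define h where "h n = inverse (real (Suc n))" for n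
  have h: "h n > 0" for n by (simp add: h_def)
  \<comment> \<open>One h n is spent between y n and T x, another between T x and the image of u;
    the bound b + 1 leaves room for approximating x in the source norm.\<close>
  have "\<exists>u\<in>D. norm (\<iota>\<^sub>1 u) \<le> b + 1 \<and> dist (\<iota> u) (y n) < 2 * h n" for n
  proof -
    obtain x where x: "x \<in> E" "dist (T x) (y n) < h n"
      using y h[of n] unfolding closure_approachable by fastforce
    obtain d where d: "d > 0" "\<And>z. dist z x < d \<Longrightarrow> dist (T z) (T x) < h n"
      using T h[of n] unfolding continuous_on_iff by (metis UNIV_I)
    have "x \<in> closure (\<iota>\<^sub>1 ` D)" using dense by simp
    then obtain u where u: "u \<in> D" "dist (\<iota>\<^sub>1 u) x < min d 1"
      using d(1) unfolding closure_approachable by (metis imageE min_less_iff_conj zero_less_one)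
    have "norm (\<iota>\<^sub>1 u) \<le> norm x + norm (\<iota>\<^sub>1 u - x)" using norm_triangle_sub by blast
    then have "norm (\<iota>\<^sub>1 u) \<le> b + 1" using u(2) b[OF x(1)] by (simp add: dist_norm)
    moreover have "dist (\<iota> u) (y n) < 2 * h n"
      using d(2)[of "\<iota>\<^sub>1 u"] u T\<iota>[OF u(1)] x(2) dist_triangle[of "\<iota> u" "y n" "T x"] by simp
    ultimately show ?thesis using u(1) by blast
  qed
  then obtain u where u: "\<And>n. u n \<in> D" "\<And>n. norm (\<iota>\<^sub>1 (u n)) \<le> b + 1" "\<And>n. dist (\<iota> (u n)) (y n) < 2 * h n"
    by metis
  obtain r where r: "strict_mono (r :: nat \<Rightarrow> nat)" and "Cauchy (\<lambda>n. \<iota> (u (r n)))"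
    using cpt[of u "b + 1", OF u(1) u(2)] by blast
  then obtain l where l: "(\<lambda>n. \<iota> (u (r n))) \<longlonglongrightarrow> l"
    using Cauchy_convergent_iff convergent_def by blast
  have "h \<longlonglongrightarrow> 0" unfolding h_def by (rule LIMSEQ_inverse_real_of_nat)
  then have "(\<lambda>n. 2 * h (r n)) \<longlonglongrightarrow> 2 * 0"
    using LIMSEQ_subseq_LIMSEQ[OF _ r, of h] by (intro tendsto_intros) (simp add: o_def)
  then have "(\<lambda>n. 2 * h (r n)) \<longlonglongrightarrow> 0" by simp
  then have "(\<lambda>n. dist (\<iota> (u (r n))) (y (r n))) \<longlonglongrightarrow> 0"
    by (rule Lim_null_comparison[rotated]) (use u(3) in \<open>auto intro!: always_eventually less_imp_le\<close>)
  then have "(\<lambda>n. norm (\<iota> (u (r n)) - y (r n))) \<longlonglongrightarrow> 0" by (simp only: dist_norm)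
  then have "(\<lambda>n. \<iota> (u (r n)) - y (r n)) \<longlonglongrightarrow> 0" by (rule tendsto_norm_zero_cancel)
  from tendsto_diff[OF l this] have lim: "(\<lambda>n. y (r n)) \<longlonglongrightarrow> l" by simp
  moreover have "l \<in> closure (T ` E)"
    using closed_sequentially[OF closed_closure, of "\<lambda>n. y (r n)"] y lim by blast
  ultimately show "\<exists>l\<in>closure (T ` E). \<exists>r. strict_mono r \<and> (y \<circ> r) \<longlonglongrightarrow> l"
    using r by (auto simp: o_def)
qed

lemma complex_banach_tendsto:
  assumes "complex_banach scl" "X \<longlonglongrightarrow> x"
  shows "(\<lambda>n. scl c (X n)) \<longlonglongrightarrow> scl c x"
proof -
  interpret vector_space scl using assms(1) by (simp add: complex_banach_def)
  have "(\<lambda>n. cmod c * norm (X n - x)) \<longlonglongrightarrow> cmod c * 0"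
    using assms(2) by (intro tendsto_intros) (simp add: tendsto_norm_zero LIM_zero)
  moreover have "cmod c * norm (X n - x) = norm (scl c (X n) - scl c x)" for n
    using assms(1) by (simp add: complex_banach_def scale_right_diff_distrib[symmetric])
  ultimately have "(\<lambda>n. norm (scl c (X n) - scl c x)) \<longlonglongrightarrow> 0" by simp
  then show ?thesis by (rule LIM_zero_cancel[OF tendsto_norm_zero_cancel])
qed

section \<open>The norms of the completions in terms of local energies\<close>

text \<open>Pairs of a chart and a fibre component are merged into one index, so that sums and
  common subsequences run over a single finite set.\<close>

definition component_energy ::
    "('m, 'e, 'n::finite, 'p::finite) vbundle \<Rightarrow> ('m, 'e, 'n, 'p) localization \<Rightarrow>
     real \<Rightarrow> (real \<Rightarrow> real) \<Rightarrow> ('m \<Rightarrow> 'e) \<Rightarrow> ('m \<Rightarrow> 'e) \<Rightarrow> nat \<times> 'p \<Rightarrow> real" where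
  "component_energy B L s \<phi> u v i = energy s \<phi>
     (\<lambda>y. local_component B L (fst i) (snd i) u y - local_component B L (fst i) (snd i) v y)"

text \<open>Translates the norm of an abstract completion into a finite sum of energies, also for
  differences, because the map into the completion is linear on sections.\<close>

lemma H_bundle_space_norm:
  assumes man: "closed_manifold (base_atlas B)" and vb: "smooth_vector_bundle B"
    and loc: "localization_of B L" and \<phi>: "\<phi> \<in> class_M" and H: "H_bundle_space B L s \<phi> scl \<iota>"
    and u: "u \<in> smooth_sections B"
  shows "(norm (\<iota> u))\<^sup>2 = (\<Sum>i\<in>{1..patches L} \<times> UNIV. energy s \<phi> (local_component B L (fst i) (snd i) u))"
    and "v \<in> smooth_sections B \<Longrightarrow> (norm (\<iota> u - \<iota> v))\<^sup>2 =
      (\<Sum>i\<in>{1..patches L} \<times> UNIV. component_energy B L s \<phi> u v i)"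
proof -
  have sq: "(norm (\<iota> w))\<^sup>2 = (\<Sum>i\<in>{1..patches L} \<times> UNIV. energy s \<phi> (local_component B L (fst i) (snd i) w))"
    if w: "w \<in> smooth_sections B" for w
  proof -
    have "(norm (\<iota> w))\<^sup>2 = (\<Sum>j=1..patches L. \<Sum>k\<in>UNIV.
       (H_norm s \<phi> (regular_distribution (local_component B L j k w)))\<^sup>2)"
      using H w by (simp add: H_bundle_space_def bundle_norm_def sum_nonneg)
    also have "\<dots> = (\<Sum>j=1..patches L. \<Sum>k\<in>UNIV. energy s \<phi> (local_component B L j k w))"
    proof (intro sum.cong refl)
      fix j k assume "j \<in> {1..patches L}"
      from local_component_bump[OF man vb loc this] w
      show "(H_norm s \<phi> (regular_distribution (local_component B L j k w)))\<^sup>2 = energy s \<phi> (local_component B L j k w)"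
        using H_norm_regular_square[OF \<phi>] by blast
    qed
    finally show ?thesis by (simp add: sum.cartesian_product case_prod_beta)
  qed
  show "(norm (\<iota> u))\<^sup>2 = (\<Sum>i\<in>{1..patches L} \<times> UNIV. energy s \<phi> (local_component B L (fst i) (snd i) u))"
    by (rule sq[OF u])
  assume v: "v \<in> smooth_sections B"
  let ?w = "section_add B u (section_scale B (-1) v)"
  have v': "section_scale B (-1) v \<in> smooth_sections B" by (rule smooth_sections_scale[OF vb v])
  \<comment> \<open>The complex scalar -1 acts as the real one, so a formal difference of sections
    becomes a difference in the Banach space.\<close>
  have "scl (complex_of_real (-1)) (\<iota> v) = (-1) *\<^sub>R \<iota> v"
    using H unfolding H_bundle_space_def complex_banach_def by blast
  then have "\<iota> (section_scale B (-1) v) = - \<iota> v"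
    using H v by (simp add: H_bundle_space_def)
  then have "\<iota> u - \<iota> v = \<iota> ?w"
    using H u v' by (simp add: H_bundle_space_def)
  then show "(norm (\<iota> u - \<iota> v))\<^sup>2 = (\<Sum>i\<in>{1..patches L} \<times> UNIV. component_energy B L s \<phi> u v i)"
    using sq[OF smooth_sections_add[OF vb u v']] local_component_diff[OF vb loc _ u v]
    by (simp add: component_energy_def mem_Times_iff)
qed

lemma sum_component_le:
  fixes f :: "'i \<Rightarrow> real"
  assumes "finite I" "\<And>i. i \<in> I \<Longrightarrow> f i \<ge> 0" "i \<in> I"
  shows "f i \<le> sum f I"
  using assms by (intro member_le_sum) auto

section \<open>Sequences of smooth sections in the source and the target norm\<close>

context
  fixes B :: "('m::{t2_space,second_countable_topology}, 'e::{t2_space,second_countable_topology},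
      'n::finite, 'p::finite) vbundle" and L \<phi> \<phi>\<^sub>1 s \<epsilon> scl\<^sub>1 \<iota>\<^sub>1 scl \<iota>
  assumes man: "closed_manifold (base_atlas B)" and vb: "smooth_vector_bundle B"
    and loc: "localization_of B L" and \<phi>: "\<phi> \<in> class_M" "\<phi>\<^sub>1 \<in> class_M" and \<epsilon>: "\<epsilon> > 0"
    and H1: "H_bundle_space B L (s + \<epsilon>) \<phi>\<^sub>1 scl\<^sub>1 \<iota>\<^sub>1" and H: "H_bundle_space B L s \<phi> scl \<iota>"
begin

text \<open>The comparison of energies, applied to every component of a difference. This is the
  Lipschitz form that the extension from the dense image requires.\<close>

lemma H_bundle_space_bound: "\<exists>K\<ge>0. \<forall>u\<in>smooth_sections B. \<forall>v\<in>smooth_sections B.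
    norm (\<iota> u - \<iota> v) \<le> K * norm (\<iota>\<^sub>1 u - \<iota>\<^sub>1 v)"
proof -
  obtain K where K: "K > 0" "\<And>R f::real^'n \<Rightarrow> complex. bump_on R f \<Longrightarrow> energy s \<phi> f \<le> K * energy (s + \<epsilon>) \<phi>\<^sub>1 f"
    using energy_embedding[OF \<phi> \<epsilon>, where 'n='n] by blast
  have "norm (\<iota> u - \<iota> v) \<le> sqrt K * norm (\<iota>\<^sub>1 u - \<iota>\<^sub>1 v)"
    if u: "u \<in> smooth_sections B" and v: "v \<in> smooth_sections B" for u v
  proof -
    have "(norm (\<iota> u - \<iota> v))\<^sup>2 \<le> K * (norm (\<iota>\<^sub>1 u - \<iota>\<^sub>1 v))\<^sup>2"
      unfolding H_bundle_space_norm(2)[OF man vb loc \<phi>(1) H u v]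
        H_bundle_space_norm(2)[OF man vb loc \<phi>(2) H1 u v] sum_distrib_left
    proof (rule sum_mono)
      fix i assume "i \<in> {1..patches L} \<times> (UNIV :: 'p set)"
      then obtain R where "bump_on R (local_component B L (fst i) (snd i) u)"
        "bump_on R (local_component B L (fst i) (snd i) v)"
        using local_component_bump[OF man vb loc, of "fst i"] u v by (auto simp: mem_Times_iff)
      then show "component_energy B L s \<phi> u v i \<le> K * component_energy B L (s + \<epsilon>) \<phi>\<^sub>1 u v i"
        unfolding component_energy_def by (intro K(2) bump_on_diff)
    qed
    also have "\<dots> = (sqrt K * norm (\<iota>\<^sub>1 u - \<iota>\<^sub>1 v))\<^sup>2" using K(1) by (simp add: power_mult_distrib)
    finally show ?thesis using K(1) by (simp add: power2_le_iff_abs_le)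
  qed
  then show ?thesis using K(1) by (intro exI[of _ "sqrt K"]) auto
qed

lemma H_bundle_space_Cauchy_subsequence:
  assumes u: "\<And>n::nat. u n \<in> smooth_sections B" and b: "\<And>n. norm (\<iota>\<^sub>1 (u n)) \<le> b"
  shows "\<exists>r. strict_mono (r :: nat \<Rightarrow> nat) \<and> Cauchy (\<lambda>n. \<iota> (u (r n)))"
proof -
  let ?I = "{1..patches L} \<times> (UNIV :: 'p set)"
  let ?c = "\<lambda>i n. local_component B L (fst i) (snd i) (u n)"
  define P where "P i r \<longleftrightarrow> (\<forall>\<delta>>0. \<exists>N. \<forall>m\<ge>N. \<forall>n\<ge>N. component_energy B L s \<phi> (u (r m)) (u (r n)) i < \<delta>)"
    for i and r :: "nat \<Rightarrow> nat"
  have "\<exists>r. strict_mono r \<and> (\<forall>i\<in>?I. P i r)"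
  proof (rule finite_common_subsequence)
    fix i and q :: "nat \<Rightarrow> nat" assume i: "i \<in> ?I"
    then obtain R where R: "R \<ge> 0" "\<And>n. bump_on R (?c i (q n))"
      using local_component_bump[OF man vb loc, of "fst i"] u by (auto simp: mem_Times_iff)
    have "energy (s + \<epsilon>) \<phi>\<^sub>1 (?c i (q n)) \<le> b\<^sup>2" for n
    proof -
      have "energy (s + \<epsilon>) \<phi>\<^sub>1 (?c i (q n)) \<le> (norm (\<iota>\<^sub>1 (u (q n))))\<^sup>2"
        unfolding H_bundle_space_norm(1)[OF man vb loc \<phi>(2) H1 u]
        by (rule sum_component_le[OF _ energy_nonneg[OF \<phi>(2)] i]) auto
      also have "\<dots> \<le> b\<^sup>2" using b by (intro power_mono) auto
      finally show ?thesis .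
    qed
    from energy_Cauchy_subsequence[where f="\<lambda>n. ?c i (q n)", OF \<phi> \<epsilon> R this]
    show "\<exists>r'. strict_mono r' \<and> P i (q \<circ> r')"
      by (simp only: P_def component_energy_def o_def)
  next
    fix i r r' assume P: "P i r" and r': "strict_mono (r' :: nat \<Rightarrow> nat)"
    show "P i (r \<circ> r')"
      unfolding P_def
    proof (intro allI impI)
      fix \<delta> :: real assume "\<delta> > 0"
      then obtain N where N: "\<And>m n. m \<ge> N \<Longrightarrow> n \<ge> N \<Longrightarrow> component_energy B L s \<phi> (u (r m)) (u (r n)) i < \<delta>"
        using P unfolding P_def by blast
      have "r' n \<ge> n" for n using seq_suble[OF r'] .
      then have "component_energy B L s \<phi> (u ((r \<circ> r') m)) (u ((r \<circ> r') n)) i < \<delta>" if "m \<ge> N" "n \<ge> N" for m n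
        using N[of "r' m" "r' n"] that by (simp add: order_trans)
      then show "\<exists>N. \<forall>m\<ge>N. \<forall>n\<ge>N. component_energy B L s \<phi> (u ((r \<circ> r') m)) (u ((r \<circ> r') n)) i < \<delta>"
        by blast
    qed
  qed simp
  then obtain r where r: "strict_mono (r :: nat \<Rightarrow> nat)" and P: "\<And>i. i \<in> ?I \<Longrightarrow> P i r" by blast
  have "Cauchy (\<lambda>n. \<iota> (u (r n)))"
  proof (rule CauchyI)
    fix e :: real assume e: "e > 0"
    \<comment> \<open>With card + 1 in the denominator the sum of card many bounds \<delta> is
      strictly below e^2.\<close>
    define \<delta> where "\<delta> = e\<^sup>2 / (real (card ?I) + 1)"
    have \<delta>: "\<delta> > 0" using e by (simp add: \<delta>_def add_nonneg_pos)
    have "\<forall>i\<in>?I. \<exists>N. \<forall>m\<ge>N. \<forall>n\<ge>N. component_energy B L s \<phi> (u (r m)) (u (r n)) i < \<delta>"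
      using P \<delta> unfolding P_def by blast
    then obtain N where N: "\<And>i m n. i \<in> ?I \<Longrightarrow> m \<ge> N i \<Longrightarrow> n \<ge> N i \<Longrightarrow>
        component_energy B L s \<phi> (u (r m)) (u (r n)) i < \<delta>" by metis
    \<comment> \<open>The sum of the finitely many thresholds N i is an upper bound for each of
      them.\<close>
    have "norm (\<iota> (u (r m)) - \<iota> (u (r n))) < e" if mn: "m \<ge> sum N ?I" "n \<ge> sum N ?I" for m n
    proof -
      have Ni: "N i \<le> sum N ?I" if "i \<in> ?I" for i using that by (intro member_le_sum) auto
      have "(norm (\<iota> (u (r m)) - \<iota> (u (r n))))\<^sup>2 \<le> real (card ?I) * \<delta>"
        unfolding H_bundle_space_norm(2)[OF man vb loc \<phi>(1) H u u]
        using N Ni mn by (intro sum_bounded_above) (meson less_imp_le order_trans)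
      also have "\<dots> < (real (card ?I) + 1) * \<delta>" using \<delta> by simp
      also have "\<dots> = e\<^sup>2" by (simp add: \<delta>_def add_nonneg_eq_0_iff)
      finally show ?thesis using e by (simp add: power2_less_imp_less)
    qed
    then show "\<exists>M. \<forall>m\<ge>M. \<forall>n\<ge>M. norm (\<iota> (u (r m)) - \<iota> (u (r n))) < e" by blast
  qed
  then show ?thesis using r by blast
qed

text \<open>Each component energy is at most the squared norm, so the Cauchy property and the null
  limit pass to the components, where \<open>energy_tendsto_0\<close> applies; summation returns to
  the source norm. This closability is what makes the extended map injective.\<close>

lemma H_bundle_space_null_sequence:
  assumes u: "\<And>n::nat. u n \<in> smooth_sections B" and Cauchy: "Cauchy (\<lambda>n. \<iota>\<^sub>1 (u n))"
    and lim: "(\<lambda>n. \<iota> (u n)) \<longlonglongrightarrow> 0"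
  shows "(\<lambda>n. \<iota>\<^sub>1 (u n)) \<longlonglongrightarrow> 0"
proof -
  let ?I = "{1..patches L} \<times> (UNIV :: 'p set)"
  let ?c = "\<lambda>i n. local_component B L (fst i) (snd i) (u n)"
  have "(\<lambda>n. energy (s + \<epsilon>) \<phi>\<^sub>1 (?c i n)) \<longlonglongrightarrow> 0" if i: "i \<in> ?I" for i
  proof -
    obtain R where R: "\<And>n. bump_on R (?c i n)"
      using local_component_bump[OF man vb loc, of "fst i"] i u by (auto simp: mem_Times_iff)
    show ?thesis
    proof (rule energy_tendsto_0[OF \<phi> R])
      fix \<delta> :: real assume "\<delta> > 0"
      then have "sqrt \<delta> > 0" by simp
      then obtain N where N: "\<And>m n. m \<ge> N \<Longrightarrow> n \<ge> N \<Longrightarrow> norm (\<iota>\<^sub>1 (u m) - \<iota>\<^sub>1 (u n)) < sqrt \<delta>"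
        using CauchyD[OF Cauchy] by blast
      have "energy (s + \<epsilon>) \<phi>\<^sub>1 (\<lambda>x. ?c i m x - ?c i n x) < \<delta>" if "m \<ge> N" "n \<ge> N" for m n
      proof -
        have "component_energy B L (s + \<epsilon>) \<phi>\<^sub>1 (u m) (u n) i \<le> (norm (\<iota>\<^sub>1 (u m) - \<iota>\<^sub>1 (u n)))\<^sup>2"
          unfolding H_bundle_space_norm(2)[OF man vb loc \<phi>(2) H1 u u]
          by (rule sum_component_le[OF _ _ i]) (auto simp: component_energy_def energy_nonneg[OF \<phi>(2)])
        also have "\<dots> < (sqrt \<delta>)\<^sup>2"
          using N[OF that] by (intro power_strict_mono) auto
        finally show ?thesis using \<open>\<delta> > 0\<close> by (simp add: component_energy_def)
      qed
      then show "\<exists>N. \<forall>m\<ge>N. \<forall>n\<ge>N. energy (s + \<epsilon>) \<phi>\<^sub>1 (\<lambda>x. ?c i m x - ?c i n x) < \<delta>" by blast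
    next
      have "(\<lambda>n. (norm (\<iota> (u n)))\<^sup>2) \<longlonglongrightarrow> 0\<^sup>2"
        using tendsto_norm_zero[OF lim] by (rule tendsto_power)
      then have lim2: "(\<lambda>n. (norm (\<iota> (u n)))\<^sup>2) \<longlonglongrightarrow> 0" by simp
      have le: "energy s \<phi> (?c i n) \<le> (norm (\<iota> (u n)))\<^sup>2" for n
        unfolding H_bundle_space_norm(1)[OF man vb loc \<phi>(1) H u]
        by (rule sum_component_le[OF _ energy_nonneg[OF \<phi>(1)] i]) auto
      show "(\<lambda>n. energy s \<phi> (?c i n)) \<longlonglongrightarrow> 0"
        by (rule tendsto_sandwich[OF always_eventually always_eventually tendsto_const lim2])
          (use le energy_nonneg[OF \<phi>(1)] in auto)
    qed
  qed
  then have "(\<lambda>n. (norm (\<iota>\<^sub>1 (u n)))\<^sup>2) \<longlonglongrightarrow> (\<Sum>i\<in>?I. 0)"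
    unfolding H_bundle_space_norm(1)[OF man vb loc \<phi>(2) H1 u] by (intro tendsto_sum)
  then have "(\<lambda>n. sqrt ((norm (\<iota>\<^sub>1 (u n)))\<^sup>2)) \<longlonglongrightarrow> sqrt 0"
    by (intro tendsto_real_sqrt) simp
  then show ?thesis by (simp add: tendsto_norm_zero_iff)
qed

end

theorem theorem4p3:
  fixes B :: "('m::{t2_space,second_countable_topology}, 'e::{t2_space,second_countable_topology},
               'n::finite, 'p::finite) vbundle"
    and \<mu> :: "'m measure"
    and L :: "('m, 'e, 'n, 'p) localization"
    and s \<epsilon> :: real
    and \<phi> \<phi>\<^sub>1 :: "real \<Rightarrow> real"
    and scl\<^sub>1 :: "complex \<Rightarrow> 'g::banach \<Rightarrow> 'g" and \<iota>\<^sub>1 :: "('m \<Rightarrow> 'e) \<Rightarrow> 'g"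
    and scl :: "complex \<Rightarrow> 'h::banach \<Rightarrow> 'h" and \<iota> :: "('m \<Rightarrow> 'e) \<Rightarrow> 'h"
  assumes "closed_manifold (base_atlas B)"
    and "smooth_density (base_atlas B) \<mu>"
    and "smooth_vector_bundle B"
    and "localization_of B L"
    and "\<phi> \<in> class_M" and "\<phi>\<^sub>1 \<in> class_M"
    and "\<epsilon> > 0"
    and "H_bundle_space B L (s + \<epsilon>) \<phi>\<^sub>1 scl\<^sub>1 \<iota>\<^sub>1"
    and "H_bundle_space B L s \<phi> scl \<iota>"
  shows "\<exists>T. compact_embedding scl\<^sub>1 scl T \<and> (\<forall>u\<in>smooth_sections B. T (\<iota>\<^sub>1 u) = \<iota> u) \<and>
    (\<forall>T'. continuous_on UNIV T' \<and> (\<forall>u\<in>smooth_sections B. T' (\<iota>\<^sub>1 u) = \<iota> u) \<longrightarrow> T' = T)"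
proof -
  note man = assms(1) and vb = assms(3) and loc = assms(4) and \<phi> = assms(5,6) and \<epsilon> = assms(7)
    and H1 = assms(8) and H = assms(9)
  let ?D = "smooth_sections B"
  have dense: "closure (\<iota>\<^sub>1 ` ?D) = UNIV" using H1 by (simp add: H_bundle_space_def)
  have cb1: "complex_banach scl\<^sub>1" and cb: "complex_banach scl"
    using H1 H by (auto simp: H_bundle_space_def)
  obtain K where "K \<ge> 0" "\<And>u v. u \<in> ?D \<Longrightarrow> v \<in> ?D \<Longrightarrow> norm (\<iota> u - \<iota> v) \<le> K * norm (\<iota>\<^sub>1 u - \<iota>\<^sub>1 v)"
    using H_bundle_space_bound[OF man vb loc \<phi> \<epsilon> H1 H] by blast
  from dense_extension[OF dense this] obtain T where T: "continuous_on UNIV T"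
    and T\<iota>: "\<And>u. u \<in> ?D \<Longrightarrow> T (\<iota>\<^sub>1 u) = \<iota> u" by blast
  have T_lim: "(\<lambda>n. T (X n)) \<longlonglongrightarrow> T x" if "X \<longlonglongrightarrow> x" for X x
    using continuous_on_tendsto_compose[OF T that] by simp
  \<comment> \<open>Both sides are continuous in x and y, so additivity is inherited from the dense
    image of the sections; scaling is treated in the same way below.\<close>
  have add: "T (x + y) = T x + T y" for x y
  proof -
    obtain u where u: "\<And>n. u n \<in> ?D" "(\<lambda>n. \<iota>\<^sub>1 (u n)) \<longlonglongrightarrow> x" using dense_sequence[OF dense] by metis
    obtain v where v: "\<And>n. v n \<in> ?D" "(\<lambda>n. \<iota>\<^sub>1 (v n)) \<longlonglongrightarrow> y" using dense_sequence[OF dense] by metis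
    have w: "section_add B (u n) (v n) \<in> ?D" for n by (rule smooth_sections_add[OF vb u(1) v(1)])
    have "T (\<iota>\<^sub>1 (u n) + \<iota>\<^sub>1 (v n)) = T (\<iota>\<^sub>1 (u n)) + T (\<iota>\<^sub>1 (v n))" for n
      using H1 H T\<iota>[OF w[of n]] T\<iota>[OF u(1)] T\<iota>[OF v(1)] u(1) v(1) by (simp add: H_bundle_space_def)
    then show ?thesis
      using LIMSEQ_unique[OF T_lim[OF tendsto_add[OF u(2) v(2)]]] tendsto_add[OF T_lim[OF u(2)] T_lim[OF v(2)]]
      by simp
  qed
  have scale: "T (scl\<^sub>1 c x) = scl c (T x)" for c x
  proof -
    obtain u where u: "\<And>n. u n \<in> ?D" "(\<lambda>n. \<iota>\<^sub>1 (u n)) \<longlonglongrightarrow> x" using dense_sequence[OF dense] by metis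
    have w: "section_scale B c (u n) \<in> ?D" for n by (rule smooth_sections_scale[OF vb u(1)])
    have "T (scl\<^sub>1 c (\<iota>\<^sub>1 (u n))) = scl c (T (\<iota>\<^sub>1 (u n)))" for n
      using H1 H T\<iota>[OF w[of n]] T\<iota>[OF u(1)] u(1) by (simp add: H_bundle_space_def)
    then show ?thesis
      using LIMSEQ_unique[OF T_lim[OF complex_banach_tendsto[OF cb1 u(2), of c]]]
        complex_banach_tendsto[OF cb T_lim[OF u(2)], of c] by simp
  qed
  \<comment> \<open>Approximate x by images of sections. They are Cauchy in the source space, and
    the images of the same sections in the target space tend to T x = 0, so closability gives the
    source limit 0.\<close>
  have kernel: "x = 0" if x: "T x = 0" for x
  proof -
    obtain u where u: "\<And>n. u n \<in> ?D" "(\<lambda>n. \<iota>\<^sub>1 (u n)) \<longlonglongrightarrow> x" using dense_sequence[OF dense] by metis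
    have "(\<lambda>n. \<iota> (u n)) \<longlonglongrightarrow> 0" using T_lim[OF u(2)] by (simp add: T\<iota>[OF u(1)] x)
    moreover have "Cauchy (\<lambda>n. \<iota>\<^sub>1 (u n))" by (rule LIMSEQ_imp_Cauchy[OF u(2)])
    ultimately have "(\<lambda>n. \<iota>\<^sub>1 (u n)) \<longlonglongrightarrow> 0"
      by (intro H_bundle_space_null_sequence[OF man vb loc \<phi> \<epsilon> H1 H u(1)])
    then show ?thesis using LIMSEQ_unique u(2) by blast
  qed
  have "inj T"
  proof (rule injI)
    fix x y assume "T x = T y"
    then have "T (x - y) = 0" using add[of "x - y" y] by simp
    then show "x = y" using kernel[of "x - y"] by simp
  qed
  moreover have "Vector_Spaces.linear scl\<^sub>1 scl T"
    using cb1 cb add scale by (simp add: Vector_Spaces.linear_iff complex_banach_def)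
  moreover have "compact (closure (T ` E))" if "bounded E" for E
    by (rule compact_closure_image[OF dense T T\<iota> H_bundle_space_Cauchy_subsequence[OF man vb loc \<phi> \<epsilon> H1 H] that])
  ultimately have "compact_embedding scl\<^sub>1 scl T" unfolding compact_embedding_def by blast
  \<comment> \<open>Two continuous maps that agree on the dense image of the sections
    coincide.\<close>
  moreover have "T' = T" if T': "continuous_on UNIV T'" "\<forall>u\<in>?D. T' (\<iota>\<^sub>1 u) = \<iota> u" for T'
  proof
    fix x
    obtain u where u: "\<And>n. u n \<in> ?D" "(\<lambda>n. \<iota>\<^sub>1 (u n)) \<longlonglongrightarrow> x" using dense_sequence[OF dense] by metis
    have "(\<lambda>n. T' (\<iota>\<^sub>1 (u n))) \<longlonglongrightarrow> T' x" using continuous_on_tendsto_compose[OF T'(1) u(2)] by simp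
    then have "(\<lambda>n. T (\<iota>\<^sub>1 (u n))) \<longlonglongrightarrow> T' x" using T'(2) T\<iota> u(1) by simp
    then show "T' x = T x" using LIMSEQ_unique T_lim[OF u(2)] by blast
  qed
  ultimately show ?thesis using T\<iota> by blast
qed

end
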